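(* For each $n\in\mathbb{N}$, the identity checking problem for $\mathsf{styl}_n$ is decidable in linearithmic time, that is, in time $O(\ell\log\ell)$ where $\ell=|u|+|v|$ is the size of the input identity $u\approx v$. Therefore, $\textsc{Check-Id}(\mathsf{styl}_n)$ is in the complexity class $\mathsf{P}$.
   Context: $\mathbb{N}=\{1,2,3,\dots\}$ and $\mathcal{A}_n=\{1<2<\cdots<n\}$. The stylic monoid of rank $n$, $\mathsf{styl}_n$, is the monoid presented by generators $\mathcal{A}_n$ and relations $acb=cab$ (for $a\le b<c$), $bac=bca$ (for $a<b\le c$), and $a^2=a$ (for $a\in\mathcal{A}_n$). A monoid identity is a formal equality $u\approx v$ of words over an alphabet of variables; a monoid $M$ satisfies it if $\psi(u)=\psi(v)$ for every monoid morphism $\psi$ from the free monoid on the variables to $M$. For a fixed monoid $M$, the identity checking problem $\textsc{Check-Id}(M)$ is the decision problem whose instance is an arbitrary identity $u\approx v$ and whose answer is positive if $M$ satisfies $u\approx v$ and negative otherwise. The monoid is not part of the input, so the time complexity is measured only in terms of the size of the identity. *)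

theory Defs
  imports "HOL-Algebra.Group" "HOL-Library.Landau_Symbols"
begin

section \<open>Monoid presentations and the stylic monoid\<close>

text \<open>The least congruence on the free monoid over \<open>A\<close> containing the relations \<open>R\<close>.\<close>

inductive_set presentation_cong :: "'a set \<Rightarrow> ('a list \<times> 'a list) set \<Rightarrow> ('a list \<times> 'a list) set"
  for A :: "'a set" and R :: "('a list \<times> 'a list) set"
where
  rel: "(x, y) \<in> R \<Longrightarrow> x \<in> lists A \<Longrightarrow> y \<in> lists A \<Longrightarrow> (x, y) \<in> presentation_cong A R"
| refl: "x \<in> lists A \<Longrightarrow> (x, x) \<in> presentation_cong A R"
| sym: "(x, y) \<in> presentation_cong A R \<Longrightarrow> (y, x) \<in> presentation_cong A R"
| trans: "(x, y) \<in> presentation_cong A R \<Longrightarrow> (y, z) \<in> presentation_cong A R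
    \<Longrightarrow> (x, z) \<in> presentation_cong A R"
| mult: "(x, y) \<in> presentation_cong A R \<Longrightarrow> (x', y') \<in> presentation_cong A R
    \<Longrightarrow> (x @ x', y @ y') \<in> presentation_cong A R"

definition presented_monoid :: "'a set \<Rightarrow> ('a list \<times> 'a list) set \<Rightarrow> 'a list set monoid" where
  "presented_monoid A R =
    \<lparr>carrier = lists A // presentation_cong A R,
     mult = (\<lambda>X Y. presentation_cong A R `` {x @ y | x y. x \<in> X \<and> y \<in> Y}),
     one = presentation_cong A R `` {[]}\<rparr>"

definition stylic_relations :: "nat \<Rightarrow> (nat list \<times> nat list) set" where
  "stylic_relations n =
     {([a, c, b], [c, a, b]) | a b c. {a, b, c} \<subseteq> {1..n} \<and> a \<le> b \<and> b < c}
   \<union> {([b, a, c], [b, c, a]) | a b c. {a, b, c} \<subseteq> {1..n} \<and> a < b \<and> b \<le> c}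
   \<union> {([a, a], [a]) | a. a \<in> {1..n}}"

definition styl :: "nat \<Rightarrow> nat list set monoid" where
  "styl n = presented_monoid {1..n} (stylic_relations n)"

lemma presentation_cong_lists:
  assumes "(x, y) \<in> presentation_cong A R"
  shows "x \<in> lists A \<and> y \<in> lists A"
  using assms by induction auto

lemma equiv_presentation_cong: "equiv (lists A) (presentation_cong A R)"
proof (rule equivI)
  show "presentation_cong A R \<subseteq> lists A \<times> lists A"
    by (auto dest: presentation_cong_lists)
  show "refl_on (lists A) (presentation_cong A R)"
    by (intro refl_onI presentation_cong.refl)
  show "sym (presentation_cong A R)"
    by (intro symI) (rule presentation_cong.sym)
  show "trans (presentation_cong A R)"
    by (intro transI) (rule presentation_cong.trans)
qed

lemma presented_monoid_mult:
  assumes "x \<in> lists A" "y \<in> lists A"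
  shows "presentation_cong A R `` {x} \<otimes>\<^bsub>presented_monoid A R\<^esub> presentation_cong A R `` {y}
    = presentation_cong A R `` {x @ y}"
proof (intro equalityI subsetI)
  fix z
  assume "z \<in> presentation_cong A R `` {x} \<otimes>\<^bsub>presented_monoid A R\<^esub> presentation_cong A R `` {y}"
  then obtain x' y' where "(x, x') \<in> presentation_cong A R" "(y, y') \<in> presentation_cong A R"
    and z: "(x' @ y', z) \<in> presentation_cong A R"
    by (auto simp: presented_monoid_def)
  then have "(x @ y, x' @ y') \<in> presentation_cong A R"
    by (intro presentation_cong.mult)
  from presentation_cong.trans[OF this z] show "z \<in> presentation_cong A R `` {x @ y}"
    by simp
next
  fix z
  assume "z \<in> presentation_cong A R `` {x @ y}"
  moreover have "(x, x) \<in> presentation_cong A R" "(y, y) \<in> presentation_cong A R"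
    using assms by (auto intro: presentation_cong.refl)
  ultimately show "z \<in> presentation_cong A R `` {x} \<otimes>\<^bsub>presented_monoid A R\<^esub> presentation_cong A R `` {y}"
    by (auto simp: presented_monoid_def)
qed

lemma presented_monoid_carrierE:
  assumes "X \<in> carrier (presented_monoid A R)"
  obtains x where "x \<in> lists A" "X = presentation_cong A R `` {x}"
  using assms by (auto simp: presented_monoid_def quotient_def)

lemma presented_monoid_carrierI:
  "x \<in> lists A \<Longrightarrow> presentation_cong A R `` {x} \<in> carrier (presented_monoid A R)"
  by (auto simp: presented_monoid_def intro: quotientI)

lemma monoid_presented_monoid: "monoid (presented_monoid A R)"
proof -
  have one: "\<one>\<^bsub>presented_monoid A R\<^esub> = presentation_cong A R `` {[]}"
    by (simp add: presented_monoid_def)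
  note mult = presented_monoid_mult[of _ A _ R] and carr = presented_monoid_carrierI[of _ A R]
  show ?thesis
  proof
    fix X Y assume "X \<in> carrier (presented_monoid A R)" "Y \<in> carrier (presented_monoid A R)"
    then show "X \<otimes>\<^bsub>presented_monoid A R\<^esub> Y \<in> carrier (presented_monoid A R)"
      by (elim presented_monoid_carrierE) (simp add: mult carr)
  next
    fix X Y Z assume "X \<in> carrier (presented_monoid A R)" "Y \<in> carrier (presented_monoid A R)"
      "Z \<in> carrier (presented_monoid A R)"
    then show "X \<otimes>\<^bsub>presented_monoid A R\<^esub> Y \<otimes>\<^bsub>presented_monoid A R\<^esub> Z
      = X \<otimes>\<^bsub>presented_monoid A R\<^esub> (Y \<otimes>\<^bsub>presented_monoid A R\<^esub> Z)"
      by (elim presented_monoid_carrierE) (simp add: mult)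
  next
    show "\<one>\<^bsub>presented_monoid A R\<^esub> \<in> carrier (presented_monoid A R)"
      by (simp add: one carr)
  next
    fix X assume "X \<in> carrier (presented_monoid A R)"
    then show "\<one>\<^bsub>presented_monoid A R\<^esub> \<otimes>\<^bsub>presented_monoid A R\<^esub> X = X"
      by (elim presented_monoid_carrierE) (simp add: mult one)
  next
    fix X assume "X \<in> carrier (presented_monoid A R)"
    then show "X \<otimes>\<^bsub>presented_monoid A R\<^esub> \<one>\<^bsub>presented_monoid A R\<^esub> = X"
      by (elim presented_monoid_carrierE) (simp add: mult one)
  qed
qed

lemma monoid_styl: "monoid (styl n)"
  unfolding styl_def by (rule monoid_presented_monoid)


section \<open>Identities and the identity checking problem\<close>

text \<open>The variables are the natural numbers, a countably infinite supply. An identity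
  \<open>u \<approx> v\<close> is the pair \<open>(u, v)\<close>.\<close>

definition free_monoid :: "nat list monoid" where
  "free_monoid = \<lparr>carrier = UNIV, mult = (@), one = []\<rparr>"

text \<open>\<^const>\<open>hom\<close> does not require the unit to be preserved, hence the second condition.\<close>

definition monoid_hom :: "('a, 'c) monoid_scheme \<Rightarrow> ('b, 'd) monoid_scheme \<Rightarrow> ('a \<Rightarrow> 'b) set" where
  "monoid_hom G H = {\<psi> \<in> hom G H. \<psi> \<one>\<^bsub>G\<^esub> = \<one>\<^bsub>H\<^esub>}"

type_synonym identity = "nat list \<times> nat list"

definition satisfies_identity :: "('a, 'b) monoid_scheme \<Rightarrow> identity \<Rightarrow> bool" where
  "satisfies_identity M = (\<lambda>(u, v). \<forall>\<psi> \<in> monoid_hom free_monoid M. \<psi> u = \<psi> v)"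

definition Check_Id :: "('a, 'b) monoid_scheme \<Rightarrow> identity set" where
  "Check_Id M = {e. satisfies_identity M e}"

definition identity_size :: "identity \<Rightarrow> nat" where
  "identity_size = (\<lambda>(u, v). length u + length v)"


section \<open>Random access machines\<close>

text \<open>
  Time bounds finer than polynomial refer to the unit-cost RAM: finitely many registers are
  mentioned by a program, and a memory of cells is addressed through registers. The only
  arithmetic is addition and truncated subtraction.
\<close>

datatype instr =
    Const nat nat          \<comment> \<open>\<open>Const r c\<close>: \<open>r := c\<close>\<close>
  | Add nat nat nat        \<comment> \<open>\<open>Add r s t\<close>: \<open>r := s + t\<close>\<close>
  | Sub nat nat nat        \<comment> \<open>\<open>Sub r s t\<close>: \<open>r := s - t\<close>, truncated at 0\<close>
  | Load nat nat           \<comment> \<open>\<open>Load r s\<close>: \<open>r := mem[s]\<close>\<close>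
  | Store nat nat          \<comment> \<open>\<open>Store r s\<close>: \<open>mem[r] := s\<close>\<close>
  | JumpLess nat nat nat   \<comment> \<open>\<open>JumpLess r s l\<close>: \<open>if r < s then goto l\<close>\<close>
  | Halt bool

record ram_config =
  pc :: nat
  reg :: "nat \<Rightarrow> nat"
  mem :: "nat \<Rightarrow> nat"

fun exec_instr :: "instr \<Rightarrow> ram_config \<Rightarrow> ram_config" where
  "exec_instr (Const r k) c = c\<lparr>pc := pc c + 1, reg := (reg c)(r := k)\<rparr>"
| "exec_instr (Add r s t) c = c\<lparr>pc := pc c + 1, reg := (reg c)(r := reg c s + reg c t)\<rparr>"
| "exec_instr (Sub r s t) c = c\<lparr>pc := pc c + 1, reg := (reg c)(r := reg c s - reg c t)\<rparr>"
| "exec_instr (Load r s) c = c\<lparr>pc := pc c + 1, reg := (reg c)(r := mem c (reg c s))\<rparr>"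
| "exec_instr (Store r s) c = c\<lparr>pc := pc c + 1, mem := (mem c)(reg c r := reg c s)\<rparr>"
| "exec_instr (JumpLess r s l) c = c\<lparr>pc := (if reg c r < reg c s then l else pc c + 1)\<rparr>"
| "exec_instr (Halt b) c = c"

definition ram_step :: "instr list \<Rightarrow> ram_config \<Rightarrow> ram_config" where
  "ram_step p c = (if pc c < length p then exec_instr (p ! pc c) c else c)"

definition ram_run :: "instr list \<Rightarrow> nat \<Rightarrow> ram_config \<Rightarrow> ram_config" where
  "ram_run p t = ram_step p ^^ t"

definition ram_halts_with :: "instr list \<Rightarrow> ram_config \<Rightarrow> bool \<Rightarrow> bool" where
  "ram_halts_with p c b \<longleftrightarrow> pc c < length p \<and> p ! pc c = Halt b"

text \<open>The memory initially holds \<open>|u|\<close>, \<open>|v|\<close>, the letters of \<open>u\<close> and the letters of \<open>v\<close>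
  (one variable per cell), followed by zeros.\<close>

definition ram_init :: "identity \<Rightarrow> ram_config" where
  "ram_init = (\<lambda>(u, v).
     let xs = [length u, length v] @ u @ v
     in \<lparr>pc = 0, reg = (\<lambda>_. 0), mem = (\<lambda>i. if i < length xs then xs ! i else 0)\<rparr>)"

definition max_input :: "identity \<Rightarrow> nat" where
  "max_input = (\<lambda>(u, v). Max (insert (length u + length v) (set u \<union> set v)))"

text \<open>
  So that charging one unit per instruction is realistic, all numbers that ever occur (and hence
  all addresses) must fit into machine words of \<open>O(log N)\<close> bits, where \<open>N\<close> bounds the size of the
  identity and the variables occurring in it. The running time may depend on the size only.
\<close>

definition ram_decides_in_time :: "instr list \<Rightarrow> identity set \<Rightarrow> (nat \<Rightarrow> nat) \<Rightarrow> bool" where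
  "ram_decides_in_time p D T \<longleftrightarrow>
     (\<forall>e. \<exists>t \<le> T (identity_size e). ram_halts_with p (ram_run p t (ram_init e)) (e \<in> D)) \<and>
     (\<exists>K. \<forall>e t i. reg (ram_run p t (ram_init e)) i < (max_input e + 2) ^ K \<and>
                  mem (ram_run p t (ram_init e)) i < (max_input e + 2) ^ K)"

definition decidable_in_linearithmic_time :: "identity set \<Rightarrow> bool" where
  "decidable_in_linearithmic_time D \<longleftrightarrow>
     (\<exists>p T. ram_decides_in_time p D T \<and>
            (\<lambda>l. real (T l)) \<in> O(\<lambda>l. real l * ln (real l)))"


section \<open>Turing machines and the class P\<close>

text \<open>
  Deterministic multi-tape Turing machines with two-way infinite tapes. The states are
  \<open>0, \<dots>, states - 1\<close>, the tape symbols \<open>0, \<dots>, symbols - 1\<close>. State 0 is initial, 1 accepts and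
  2 rejects; symbol 0 is the blank, 1 and 2 represent the input bits.
\<close>

datatype move = MoveLeft | Stay | MoveRight

record tm =
  tapes :: nat
  states :: nat
  symbols :: nat
  delta :: "nat \<Rightarrow> nat list \<Rightarrow> nat \<times> (nat \<times> move) list"

definition wf_tm :: "tm \<Rightarrow> bool" where
  "wf_tm M \<longleftrightarrow> tapes M \<ge> 1 \<and> states M \<ge> 3 \<and> symbols M \<ge> 3 \<and>
     (\<forall>q ss. q < states M \<and> length ss = tapes M \<and> (\<forall>s \<in> set ss. s < symbols M) \<longrightarrow>
        (case delta M q ss of (q', as) \<Rightarrow>
           q' < states M \<and> length as = tapes M \<and> (\<forall>(s, d) \<in> set as. s < symbols M)))"

type_synonym tape = "int \<times> (int \<Rightarrow> nat)"  \<comment> \<open>head position and contents\<close>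

type_synonym tm_config = "nat \<times> tape list"

fun move_offset :: "move \<Rightarrow> int" where
  "move_offset MoveLeft = -1"
| "move_offset Stay = 0"
| "move_offset MoveRight = 1"

fun tape_act :: "nat \<times> move \<Rightarrow> tape \<Rightarrow> tape" where
  "tape_act (s, d) (h, f) = (h + move_offset d, f(h := s))"

fun tm_step :: "tm \<Rightarrow> tm_config \<Rightarrow> tm_config" where
  "tm_step M (q, ts) =
     (if q = 1 \<or> q = 2 then (q, ts)
      else let (q', as) = delta M q (map (\<lambda>(h, f). f h) ts) in (q', map2 tape_act as ts))"

definition input_tape :: "bool list \<Rightarrow> tape" where
  "input_tape x =
     (0, \<lambda>i. if 0 \<le> i \<and> i < int (length x) then (if x ! nat i then 2 else 1) else 0)"

definition tm_init :: "tm \<Rightarrow> bool list \<Rightarrow> tm_config" where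
  "tm_init M x = (0, input_tape x # replicate (tapes M - 1) (0, \<lambda>_. 0))"

definition tm_decides_in_time :: "tm \<Rightarrow> bool list set \<Rightarrow> (nat \<Rightarrow> nat) \<Rightarrow> bool" where
  "tm_decides_in_time M L T \<longleftrightarrow>
     (\<forall>x. \<exists>t \<le> T (length x). fst ((tm_step M ^^ t) (tm_init M x)) = (if x \<in> L then 1 else 2))"

definition class_P :: "bool list set set" where
  "class_P = {L. \<exists>M c k. wf_tm M \<and> tm_decides_in_time M L (\<lambda>m. c * m ^ k + c)}"


section \<open>Identities as bit strings\<close>

text \<open>Binary representation, least significant bit first, without leading zeros.\<close>

fun bits :: "nat \<Rightarrow> bool list" where
  "bits m = (if m = 0 then [] else odd m # bits (m div 2))"

declare bits.simps [simp del]

text \<open>A bit \<open>b\<close> of a variable is written as \<open>1b\<close>, the end of a variable as \<open>00\<close>, and the symbol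
  separating the two sides of the identity as \<open>01\<close>.\<close>

definition encode_var :: "nat \<Rightarrow> bool list" where
  "encode_var m = concat (map (\<lambda>b. [True, b]) (bits m)) @ [False, False]"

definition encode_word :: "nat list \<Rightarrow> bool list" where
  "encode_word u = concat (map encode_var u)"

definition encode_identity :: "identity \<Rightarrow> bool list" where
  "encode_identity = (\<lambda>(u, v). encode_word u @ [False, True] @ encode_word v)"

lemma bits_inject: "bits m = bits m' \<Longrightarrow> m = m'"
proof (induction m arbitrary: m' rule: bits.induct)
  case (1 m)
  show ?case
  proof (cases "m = 0 \<or> m' = 0")
    case True
    with "1.prems" show ?thesis
      by (auto simp: bits.simps[of m] bits.simps[of m'] split: if_splits)
  next
    case False
    with "1.prems" have "odd m = odd m'" and "bits (m div 2) = bits (m' div 2)"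
      by (auto simp: bits.simps[of m] bits.simps[of m'])
    have "m div 2 = m' div 2"
      by (rule "1.IH") (use False \<open>bits (m div 2) = bits (m' div 2)\<close> in simp_all)
    with \<open>odd m = odd m'\<close> show ?thesis by presburger
  qed
qed

lemma encode_var_append_eq:
  "encode_var m @ x = encode_var m' @ x' \<longleftrightarrow> m = m' \<and> x = x'"
proof -
  have "bs = bs' \<and> x = x'"
    if "concat (map (\<lambda>b. [True, b]) bs) @ [False, False] @ x
      = concat (map (\<lambda>b. [True, b]) bs') @ [False, False] @ x'" for bs bs'
    using that
  proof (induction bs arbitrary: bs')
    case Nil
    then show ?case by (cases bs') auto
  next
    case (Cons b bs)
    then show ?case by (cases bs') auto
  qed
  from this[of "bits m" "bits m'"] show ?thesis
    unfolding encode_var_def append_assoc by (metis bits_inject)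
qed

lemma encode_var_append_neq:
  "encode_var m @ x \<noteq> False # True # y" "encode_var m @ x \<noteq> []"
  by (cases "bits m"; simp add: encode_var_def)+

lemma inj_encode_identity: "inj encode_identity"
proof (rule injI)
  have w: "v = v'" if "encode_word v = encode_word v'" for v v'
    using that
  proof (induction v arbitrary: v')
    case Nil
    then show ?case
      by (cases v') (auto simp: encode_word_def encode_var_def)
  next
    case (Cons a v)
    then show ?case
      by (cases v') (auto simp: encode_word_def encode_var_append_eq, simp add: encode_var_def)
  qed
  have "u = u' \<and> v = v'"
    if "encode_word u @ [False, True] @ encode_word v
      = encode_word u' @ [False, True] @ encode_word v'" for u v u' v'
    using that
  proof (induction u arbitrary: u')
    case Nil
    show ?case
    proof (cases u')
      case (Cons a u'')
      with Nil have "encode_var a @ (encode_word u'' @ [False, True] @ encode_word v')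
        = False # True # encode_word v"
        by (simp add: encode_word_def)
      then show ?thesis by (simp only: encode_var_append_neq)
    next
      case u': Nil
      with Nil show ?thesis by (simp add: encode_word_def[of "[]"] w)
    qed
  next
    case (Cons a u)
    show ?case
    proof (cases u')
      case Nil
      with Cons.prems have "encode_var a @ (encode_word u @ [False, True] @ encode_word v)
        = False # True # encode_word v'"
        by (simp add: encode_word_def)
      then show ?thesis by (simp only: encode_var_append_neq)
    next
      case u': (Cons a' u'')
      with Cons.prems have "encode_var a @ (encode_word u @ [False, True] @ encode_word v)
        = encode_var a' @ (encode_word u'' @ [False, True] @ encode_word v')"
        by (simp add: encode_word_def)
      then have "a = a'" "encode_word u @ [False, True] @ encode_word v
        = encode_word u'' @ [False, True] @ encode_word v'"
        unfolding encode_var_append_eq by auto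
      with Cons.IH u' show ?thesis by blast
    qed
  qed
  then show "e = e'" if "encode_identity e = encode_identity e'" for e e'
    using that unfolding encode_identity_def by (cases e; cases e') simp
qed

end

theory Submission
  imports Defs "HOL-Library.Sublist"
begin

text \<open>
  The monoid \<open>styl n\<close> satisfies \<open>u \<approx> v\<close> iff \<open>u\<close> and \<open>v\<close> have the same scattered subwords of length at most
  \<open>n\<close>. If a short word \<open>w\<close> distinguishes them, so does the action of the generators on a chain in which
  the letter \<open>i\<close> moves \<open>n - i\<close> to \<open>n - i + 1\<close>: the variables can be mapped so that the state counts the
  letters of \<open>w\<close> embedded so far. Conversely, the lengths of the strictly decreasing subwords with letters
  in a given interval are invariants of the stylic congruence (Greene's theorem for columns). Row insertion
  writes every word as \<open>t r\<close>, where \<open>r\<close> lists its support increasingly and \<open>t\<close> avoids the least letter;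
  the invariants determine the support and the invariants of \<open>t\<close>, hence by induction the class. They only
  depend on the subwords of length at most \<open>n\<close>.

  Inclusion of the subwords of length at most \<open>d\<close> of a suffix of \<open>u\<close> in those of a suffix of \<open>v\<close> holds up to
  a maximal start of the suffix of \<open>v\<close>, and these maximal starts obey a recursion in \<open>d\<close>. Because they are
  monotone, the last occurrences of all letters in the relevant prefix of \<open>v\<close> can be kept in a table
  indexed by letters, which is rolled back once per \<open>d\<close>; so the recursion takes linear time on a RAM.

  For membership in P, a Turing machine copies the decoded input to \<open>n + 1\<close> tapes, whose heads then run
  through all words of length at most \<open>n\<close>. Apart from flags it no longer writes, so it passes through
  polynomially many configurations, and a halting deterministic machine never repeats one.
\<close>

section \<open>Identities of the stylic monoid\<close>

text \<open>The maximal length of a decreasing subword alone is not compatible with products.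
  Restricted to all intervals of letters, the lengths for a product are determined by those for its
  factors, because a decreasing subword of a product splits at a threshold. The bound
  \<open>n\<close> arises on both sides: a strictly decreasing word over \<open>n\<close> letters
  has length at most \<open>n\<close>, and a chain with \<open>n\<close> moving states can count up
  to \<open>n\<close>. On the RAM, letters may be far larger than the identity is long, so a table
  indexed by letters cannot be initialised or cleared cell by cell in time depending on the size
  only. Fresh memory already represents the empty prefix, and undoing recorded updates restores this
  state after every pass. The RAM program does not transfer to Turing machines without a simulation.
  The separate machine is slow but simple: only its termination has to be proved, as the time bound
  comes from counting configurations.\<close>

definition subwords :: "nat \<Rightarrow> 'a list \<Rightarrow> 'a list set" where
  "subwords n u = {w. subseq w u \<and> length w \<le> n}"

section \<open>Lengths of strictly decreasing subwords as invariants\<close>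

lemma subseq_set: "subseq s p \<Longrightarrow> x \<in> set s \<Longrightarrow> x \<in> set p"
  by (auto elim: list_emb_set)

lemma subseq_sorted: "subseq s p \<Longrightarrow> sorted p \<Longrightarrow> sorted s"
  by (induction rule: list_emb.induct) (auto dest: subseq_set)

text \<open>Half-open intervals are used so that a chain in \<open>{m<..j}\<close> followed by one
  in \<open>{i<..m}\<close> is a chain in \<open>{i<..j}\<close>. The conjunct
  \<open>i \<le> j\<close> keeps thresholds ordered even when a chain is empty.\<close>

definition dec_chain :: "nat \<Rightarrow> nat \<Rightarrow> nat list \<Rightarrow> nat list \<Rightarrow> bool" where
  "dec_chain i j p s \<longleftrightarrow> i \<le> j \<and> subseq s p \<and> sorted_wrt (>) s \<and> set s \<subseteq> {i<..j}"

definition dec_lengths :: "nat list \<Rightarrow> (nat \<times> nat \<times> nat) set" where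
  "dec_lengths p = {(i, j, r). \<exists>s. dec_chain i j p s \<and> length s = r}"

lemma dec_lengths_iff: "(i, j, r) \<in> dec_lengths p \<longleftrightarrow> (\<exists>s. dec_chain i j p s \<and> length s = r)"
  by (simp add: dec_lengths_def)

text \<open>A decreasing subword of a product is cut where it passes from the first factor to the
  second, and any threshold between the two parts will do. Hence equality of
  \<open>dec_lengths\<close> is a congruence.\<close>

lemma dec_lengths_append:
  "(i, j, r) \<in> dec_lengths (p @ q) \<longleftrightarrow>
    (\<exists>m r1 r2. r = r1 + r2 \<and> (m, j, r1) \<in> dec_lengths p \<and> (i, m, r2) \<in> dec_lengths q)"
    (is "?L \<longleftrightarrow> ?R")
proof
  assume ?L
  then obtain s where s: "i \<le> j" "subseq s (p @ q)" "sorted_wrt (>) s" "set s \<subseteq> {i<..j}" "length s = r"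
    by (auto simp: dec_lengths_iff dec_chain_def)
  obtain s1 s2 where s12: "s = s1 @ s2" "subseq s1 p" "subseq s2 q"
    using s(2) by (auto simp: subseq_append_iff)
  \<comment> \<open>The largest letter of the second part: all of \<open>s1\<close> lies strictly
    above it, and \<open>s2\<close> at or below it, as the half-open interval admits.\<close>
  define m where "m = (if s2 = [] then i else hd s2)"
  have "dec_chain m j p s1"
    using s s12 by (cases s2) (auto simp: dec_chain_def m_def sorted_wrt_append)
  moreover have "dec_chain i m q s2"
    using s s12 by (cases s2) (auto simp: dec_chain_def m_def sorted_wrt_append subset_iff less_imp_le)
  ultimately show ?R using s s12 unfolding dec_lengths_iff by (metis length_append)
next
  assume ?R
  then obtain m s1 s2 where "dec_chain m j p s1" "dec_chain i m q s2" "r = length s1 + length s2"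
    by (auto simp: dec_lengths_iff)
  then have "dec_chain i j (p @ q) (s1 @ s2) \<and> length (s1 @ s2) = r"
    by (force simp: dec_chain_def sorted_wrt_append subset_iff intro: list_emb_append_mono)
  then show ?L unfolding dec_lengths_iff by blast
qed

lemma dec_lengths_append_cong:
  assumes "dec_lengths p = dec_lengths p'" "dec_lengths q = dec_lengths q'"
  shows "dec_lengths (p @ q) = dec_lengths (p' @ q')"
  by (simp add: set_eq_iff dec_lengths_append assms)

lemma subseq_letters:
  "subseq s [a] \<longleftrightarrow> s = [] \<or> s = [a]"
  "subseq s [a, b] \<longleftrightarrow> s = [] \<or> s = [a] \<or> s = [b] \<or> s = [a, b]"
  "subseq s [a, b, c] \<longleftrightarrow> s = [] \<or> s = [a] \<or> s = [b] \<or> s = [c] \<or>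
    s = [a, b] \<or> s = [a, c] \<or> s = [b, c] \<or> s = [a, b, c]"
  unfolding in_set_subseqs[symmetric] by (simp_all add: Let_def del: in_set_subseqs) blast+

text \<open>A relation on three letters can only create or destroy the decreasing pair
  \<open>[c, a]\<close>. Replacing one of its letters by the middle letter, to \<open>[c, b]\<close>
  or \<open>[b, a]\<close>, gives a pair that is present on both sides, has the same length and
  stays within every interval containing \<open>a\<close> and \<open>c\<close>.\<close>

lemma dec_lengths_relation:
  assumes "(x, y) \<in> stylic_relations n"
  shows "dec_lengths x = dec_lengths y"
proof -
  have *: "dec_lengths x \<subseteq> dec_lengths y"
    if dec: "\<And>s. subseq s x \<Longrightarrow> sorted_wrt (>) s \<Longrightarrow> subseq s y \<or>
      (\<exists>a b c. s = [c, a] \<and> subseq [c, b] y \<and> a \<le> b \<and> b < c) \<or>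
      (\<exists>a b c. s = [c, a] \<and> subseq [b, a] y \<and> a < b \<and> b \<le> c)" for x y :: "nat list"
  proof (rule subrelI, clarsimp)
    fix i j r
    assume "(i, j, r) \<in> dec_lengths x"
    then obtain s where s: "dec_chain i j x s" "length s = r" by (auto simp: dec_lengths_iff)
    then have "subseq s x" "sorted_wrt (>) s" by (simp_all add: dec_chain_def)
    from dec[OF this] consider "subseq s y"
      | a b c where "s = [c, a]" "subseq [c, b] y" "a \<le> b" "b < c"
      | a b c where "s = [c, a]" "subseq [b, a] y" "a < b" "b \<le> c"
      by blast
    then show "(i, j, r) \<in> dec_lengths y"
    proof cases
      case 1
      then show ?thesis using s by (auto simp: dec_lengths_iff dec_chain_def)
    next
      case 2
      then show ?thesis using s unfolding dec_lengths_iff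
        by (intro exI[of _ "[c, b]"]) (auto simp: dec_chain_def)
    next
      case 3
      then show ?thesis using s unfolding dec_lengths_iff
        by (intro exI[of _ "[b, a]"]) (auto simp: dec_chain_def)
    qed
  qed
  consider (1) a b c where "x = [a, c, b]" "y = [c, a, b]" "a \<le> b" "b < c"
    | (2) a b c where "x = [b, a, c]" "y = [b, c, a]" "a < b" "b \<le> c"
    | (3) a where "x = [a, a]" "y = [a]"
    using assms by (auto simp: stylic_relations_def)
  then show ?thesis
  proof cases
    case 1
    have "subseq s y" if "subseq s x" "sorted_wrt (>) s" for s
      using that 1(3,4) unfolding 1(1,2) subseq_letters(3)[of s a c b] by auto
    then have "dec_lengths x \<subseteq> dec_lengths y" by (intro *) blast
    moreover have "subseq s x \<or> s = [c, a]" if "subseq s y" "sorted_wrt (>) s" for s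
      using that 1(3,4) unfolding 1(1,2) subseq_letters(3)[of s c a b] by auto
    moreover have "subseq [c, b] x" using 1 by simp
    ultimately have "dec_lengths y \<subseteq> dec_lengths x" using 1(3,4) by (intro *) metis
    with \<open>dec_lengths x \<subseteq> dec_lengths y\<close> show ?thesis by (rule equalityI)
  next
    case 2
    have "subseq s y" if "subseq s x" "sorted_wrt (>) s" for s
      using that 2(3,4) unfolding 2(1,2) subseq_letters(3)[of s b a c] by auto
    then have "dec_lengths x \<subseteq> dec_lengths y" by (intro *) blast
    moreover have "subseq s x \<or> s = [c, a]" if "subseq s y" "sorted_wrt (>) s" for s
      using that 2(3,4) unfolding 2(1,2) subseq_letters(3)[of s b c a] by auto
    moreover have "subseq [b, a] x" using 2 by simp
    ultimately have "dec_lengths y \<subseteq> dec_lengths x" using 2(3,4) by (intro *) metis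
    with \<open>dec_lengths x \<subseteq> dec_lengths y\<close> show ?thesis by (rule equalityI)
  next
    case 3
    have "subseq s y" if "subseq s x" "sorted_wrt (>) s" for s
      using that 3 by (auto simp: subseq_letters)
    then have "dec_lengths x \<subseteq> dec_lengths y" by (intro *) blast
    moreover have "subseq s x" if "subseq s y" for s
      using that 3 by (auto simp: subseq_letters)
    then have "dec_lengths y \<subseteq> dec_lengths x" by (intro *) blast
    ultimately show ?thesis by (rule equalityI)
  qed
qed

section \<open>Row insertion inside the stylic congruence\<close>

abbreviation styl_cong :: "nat \<Rightarrow> (nat list \<times> nat list) set" where
  "styl_cong n \<equiv> presentation_cong {1..n} (stylic_relations n)"

declare presentation_cong.trans [trans]

lemma dec_lengths_styl_cong:
  assumes "(p, q) \<in> styl_cong n"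
  shows "dec_lengths p = dec_lengths q"
  using assms
proof induction
  case (rel x y)
  then show ?case by (intro dec_lengths_relation)
next
  case (mult x y x' y')
  show ?case by (rule dec_lengths_append_cong[OF mult.IH])
qed simp_all

lemma styl_cong_context:
  assumes "(x, y) \<in> styl_cong n" "set p \<subseteq> {1..n}" "set q \<subseteq> {1..n}"
  shows "(p @ x @ q, p @ y @ q) \<in> styl_cong n"
  using assms by (intro presentation_cong.mult) (auto intro: presentation_cong.refl)

lemma styl_cong_left: "(x, y) \<in> styl_cong n \<Longrightarrow> set p \<subseteq> {1..n} \<Longrightarrow> (p @ x, p @ y) \<in> styl_cong n"
  using styl_cong_context[of x y n p "[]"] by simp

lemma styl_cong_right: "(x, y) \<in> styl_cong n \<Longrightarrow> set q \<subseteq> {1..n} \<Longrightarrow> (x @ q, y @ q) \<in> styl_cong n"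
  using styl_cong_context[of x y n "[]" q] by simp

text \<open>The last two are derived: \<open>cac = cca = ca\<close> uses the second relation with
  \<open>b = c\<close>, and \<open>aca = caa = ca\<close> the first with \<open>b = a\<close>, each
  followed by idempotence.\<close>

lemma styl_cong_rules:
  assumes "1 \<le> a" "c \<le> n"
  shows "a \<le> b \<Longrightarrow> b < c \<Longrightarrow> ([a, c, b], [c, a, b]) \<in> styl_cong n"
    and "a < b \<Longrightarrow> b \<le> c \<Longrightarrow> ([b, a, c], [b, c, a]) \<in> styl_cong n"
    and "a \<le> c \<Longrightarrow> ([a, a], [a]) \<in> styl_cong n"
    and "a < c \<Longrightarrow> ([c, a, c], [c, a]) \<in> styl_cong n"
    and "a < c \<Longrightarrow> ([a, c, a], [c, a]) \<in> styl_cong n"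
proof -
  show "a \<le> b \<Longrightarrow> b < c \<Longrightarrow> ([a, c, b], [c, a, b]) \<in> styl_cong n"
    using assms by (intro presentation_cong.rel) (auto simp: stylic_relations_def)
  show *: "a < b \<Longrightarrow> b \<le> c \<Longrightarrow> ([b, a, c], [b, c, a]) \<in> styl_cong n" for b
    using assms by (intro presentation_cong.rel) (auto simp: stylic_relations_def)
  have sq: "([x, x], [x]) \<in> styl_cong n" if "1 \<le> x" "x \<le> n" for x
    using that by (intro presentation_cong.rel) (auto simp: stylic_relations_def)
  show "a \<le> c \<Longrightarrow> ([a, a], [a]) \<in> styl_cong n" using assms by (intro sq) auto
  show "([c, a, c], [c, a]) \<in> styl_cong n" if "a < c"
    using presentation_cong.trans[OF *[of c], of "[c, a]"] styl_cong_right[OF sq[of c], of "[a]"] that assms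
    by simp
  have "([a, c, a], [c, a, a]) \<in> styl_cong n" if "a < c"
    using assms that by (intro presentation_cong.rel) (auto simp: stylic_relations_def)
  then show "([a, c, a], [c, a]) \<in> styl_cong n" if "a < c"
    using presentation_cong.trans[OF _ styl_cong_left[OF sq[of a], of "[c]"]] that assms by simp
qed

text \<open>The small letter \<open>c\<close> jumps over the row letters one at a time by
  \<open>bac = bca\<close>, in which it is the least letter. The row letter to the left of the jump
  is the witness this relation needs, so \<open>c\<close> stops right after
  \<open>d\<close>.\<close>

lemma styl_cong_move_left:
  assumes "1 \<le> c" "c < d" "sorted_wrt (<) (d # bs)" "set (d # bs) \<subseteq> {1..n}"
  shows "(d # bs @ [c], d # c # bs) \<in> styl_cong n"
  using assms
proof (induction bs arbitrary: d)
  case Nil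
  then show ?case by (auto intro!: presentation_cong.refl)
next
  case (Cons b bs)
  have "(b # bs @ [c], b # c # bs) \<in> styl_cong n" using Cons by auto
  from styl_cong_left[OF this, of "[d]"] Cons.prems
  have 1: "(d # (b # bs) @ [c], [d, b, c] @ bs) \<in> styl_cong n" by simp
  have "([d, b, c], [d, c, b]) \<in> styl_cong n"
    using Cons.prems by (intro presentation_cong.sym[OF styl_cong_rules(2)]) auto
  from styl_cong_right[OF this, of bs] Cons.prems
  have "([d, b, c] @ bs, d # c # b # bs) \<in> styl_cong n" by simp
  with 1 show ?case by (rule presentation_cong.trans)
qed

text \<open>Mirror image of the previous rule: the large letter \<open>d\<close> jumps leftwards
  over the row letters by \<open>acb = cab\<close>, with the row letter to the right of the jump as
  witness.\<close>

lemma styl_cong_move_right: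
  assumes "sorted_wrt (<) (as @ [c])" "c < d" "set (d # as @ [c]) \<subseteq> {1..n}"
  shows "(as @ [d, c], d # as @ [c]) \<in> styl_cong n"
  using assms
proof (induction as)
  case Nil
  then show ?case by (auto intro!: presentation_cong.refl)
next
  case (Cons a as)
  have "(as @ [d, c], d # as @ [c]) \<in> styl_cong n" using Cons by auto
  from styl_cong_left[OF this, of "[a]"] Cons.prems
  have 1: "((a # as) @ [d, c], a # d # as @ [c]) \<in> styl_cong n" by simp
  obtain b as' where b: "as @ [c] = b # as'" by (cases as) auto
  have set_b: "set (as @ [c]) = insert b (set as')" unfolding b by simp
  have "\<forall>x \<in> set (as @ [c]). a < x \<and> x < d"
    using Cons.prems by (auto simp: sorted_wrt_append)
  then have b': "a < b" "b < d" unfolding set_b by simp_all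
  have "set (as @ [c]) \<subseteq> {1..n}" using Cons.prems by simp
  then have as': "set as' \<subseteq> {1..n}" unfolding set_b by simp
  have "([a, d, b], [d, a, b]) \<in> styl_cong n"
    using Cons.prems b' by (intro styl_cong_rules(1)) auto
  from styl_cong_right[OF this as']
  have "(a # d # as @ [c], d # (a # as) @ [c]) \<in> styl_cong n" by (simp add: b)
  with 1 show ?case by (rule presentation_cong.trans)
qed

text \<open>Schensted row insertion, except that the bumped letter stays in the row.\<close>

lemma styl_cong_insert:
  assumes S: "finite S" "S \<subseteq> {1..n}" and c: "c \<in> {1..n}"
  shows "\<exists>t. set t \<subseteq> S \<inter> {c<..} \<and> (sorted_list_of_set S @ [c], t @ sorted_list_of_set (insert c S)) \<in> styl_cong n"
proof -
  define A where "A = sorted_list_of_set {x \<in> S. x < c}"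
  define B where "B = sorted_list_of_set {x \<in> S. c < x}"
  have setA: "set A = {x \<in> S. x < c}" and setB: "set B = {x \<in> S. c < x}"
    using S by (auto simp: A_def B_def)
  have sA: "sorted_wrt (<) A" and sB: "sorted_wrt (<) B"
    by (auto simp: A_def B_def)
  have sorted_eq: "sorted_list_of_set T = xs" if "sorted_wrt (<) xs" "set xs = T" for T :: "nat set" and xs
    using that strict_sorted_equal[of "sorted_list_of_set T" xs] by auto
  have row: "sorted_list_of_set (insert c S) = A @ [c] @ B"
    using S sA sB by (intro sorted_eq) (auto simp: sorted_wrt_append setA setB)
  have row': "sorted_list_of_set S = A @ B" if "c \<notin> S"
  proof (rule sorted_eq)
    show "sorted_wrt (<) (A @ B)" using sA sB by (auto simp: sorted_wrt_append setA setB)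
    show "set (A @ B) = S" using that by (auto simp: setA setB) (metis linorder_neqE_nat)
  qed
  have in_n: "set A \<subseteq> {1..n}" "set B \<subseteq> {1..n}" using S setA setB by auto
  show ?thesis
  proof (cases B)
    case Nil
    have "(sorted_list_of_set S @ [c], sorted_list_of_set (insert c S)) \<in> styl_cong n"
    proof (cases "c \<in> S")
      case True
      then have "sorted_list_of_set S = A @ [c]" using row Nil by (simp add: insert_absorb)
      moreover have "([c, c], [c]) \<in> styl_cong n" using c by (intro styl_cong_rules(3)) auto
      ultimately show ?thesis
        using styl_cong_left[of "[c, c]" "[c]" n A] row Nil in_n by simp
    next
      case False
      then show ?thesis using row row' Nil c in_n by (auto intro!: presentation_cong.refl)
    qed
    then show ?thesis by (intro exI[of _ "[]"]) auto
  next
    case (Cons d B')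
    have d: "d \<in> S" "c < d" "d \<in> {1..n}" "set B' \<subseteq> {1..n}" using setB Cons S by auto
    have move: "(B @ [c], d # c # B') \<in> styl_cong n"
      using styl_cong_move_left[of c d B' n] d c sB Cons by auto
    \<comment> \<open>The bumped letter \<open>d\<close>, the least one above \<open>c\<close>, is
      doubled: one copy leaves the row to the left, the other remains in it.\<close>
    have dcd: "([d, c], [d, c, d]) \<in> styl_cong n"
      using presentation_cong.sym[OF styl_cong_rules(4)[of c d n]] c d by auto
    have 1: "(sorted_list_of_set S @ [c], A @ [d, c] @ B') \<in> styl_cong n"
    proof (cases "c \<in> S")
      case True
      then have "sorted_list_of_set S = A @ [c] @ B" using row by (simp add: insert_absorb)
      then have 1: "(sorted_list_of_set S @ [c], A @ [c, d, c] @ B') \<in> styl_cong n"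
        using styl_cong_left[OF move, of "A @ [c]"] c in_n by simp
      have "([c, d, c], [d, c]) \<in> styl_cong n" using c d by (intro styl_cong_rules(5)) auto
      then have "(A @ [c, d, c] @ B', A @ [d, c] @ B') \<in> styl_cong n"
        using in_n d by (intro styl_cong_context) auto
      with 1 show ?thesis by (rule presentation_cong.trans)
    next
      case False
      then show ?thesis using styl_cong_left[OF move, of A] in_n row' by simp
    qed
    have 2: "(A @ [d, c] @ B', A @ [d, c, d] @ B') \<in> styl_cong n"
      using in_n d by (intro styl_cong_context dcd) auto
    have 3: "(A @ [d, c, d] @ B', [d] @ A @ [c] @ B) \<in> styl_cong n"
    proof -
      have "(A @ [d, c], d # A @ [c]) \<in> styl_cong n"
        using sA d c setA in_n by (intro styl_cong_move_right) (auto simp: sorted_wrt_append)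
      from styl_cong_right[OF this, of "d # B'"] d show ?thesis by (simp add: Cons)
    qed
    have "(sorted_list_of_set S @ [c], [d] @ sorted_list_of_set (insert c S)) \<in> styl_cong n"
      unfolding row by (rule presentation_cong.trans[OF 1 presentation_cong.trans[OF 2 3]])
    then show ?thesis using d by (intro exI[of _ "[d]"]) auto
  qed
qed

text \<open>Every letter pushed out by an insertion exceeds the inserted letter, so the least letter
  of the support never enters \<open>t\<close>. This loss of a letter drives the later
  induction.\<close>

lemma styl_cong_normal_form:
  assumes "set p \<subseteq> {1..n}"
  shows "\<exists>t. set t \<subseteq> {x \<in> set p. \<exists>y \<in> set p. y < x} \<and> (p, t @ sorted_list_of_set (set p)) \<in> styl_cong n"
  using assms
proof (induction p rule: rev_induct)
  case Nil
  then show ?case by (intro exI[of _ "[]"]) (auto intro: presentation_cong.refl)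
next
  case (snoc c p)
  then obtain t where t: "set t \<subseteq> {x \<in> set p. \<exists>y \<in> set p. y < x}"
    "(p, t @ sorted_list_of_set (set p)) \<in> styl_cong n" by auto
  obtain t' where t': "set t' \<subseteq> set p \<inter> {c<..}"
    "(sorted_list_of_set (set p) @ [c], t' @ sorted_list_of_set (insert c (set p))) \<in> styl_cong n"
    using styl_cong_insert[of "set p" n c] snoc.prems by auto
  have "(p @ [c], (t @ sorted_list_of_set (set p)) @ [c]) \<in> styl_cong n"
    using snoc.prems by (intro styl_cong_right t) auto
  then have "(p @ [c], t @ sorted_list_of_set (set p) @ [c]) \<in> styl_cong n" by simp
  also have "(t @ sorted_list_of_set (set p) @ [c], t @ t' @ sorted_list_of_set (insert c (set p))) \<in> styl_cong n"
    using t snoc.prems by (intro styl_cong_left t') auto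
  finally have "(p @ [c], (t @ t') @ sorted_list_of_set (set (p @ [c]))) \<in> styl_cong n" by simp
  moreover have "set (t @ t') \<subseteq> {x \<in> set (p @ [c]). \<exists>y \<in> set (p @ [c]). y < x}"
    using t t' by auto
  ultimately show ?case by (intro exI[of _ "t @ t'"] conjI)
qed

section \<open>Recovering a class from its invariants\<close>

lemma dec_lengths_row:
  assumes "(i, j, r) \<in> dec_lengths (sorted_list_of_set S)"
  shows "r \<le> 1"
proof -
  obtain s where s: "subseq s (sorted_list_of_set S)" "sorted_wrt (>) s" "length s = r"
    using assms by (auto simp: dec_lengths_iff dec_chain_def)
  have "sorted s" using subseq_sorted[OF s(1)] by simp
  then show ?thesis using s by (cases s; cases "tl s") auto
qed

text \<open>A decreasing chain takes at most one letter from an increasing row. For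
  \<open>x \<in> S\<close> the row does supply \<open>x\<close>, so admitting \<open>x\<close> in
  addition to the letters above it lengthens chains by exactly one.\<close>

lemma dec_lengths_shift:
  assumes S: "finite S" "x \<in> S" and x: "0 < x" "x \<le> j"
  shows "(x, j, r) \<in> dec_lengths t \<longleftrightarrow> (x - 1, j, Suc r) \<in> dec_lengths (t @ sorted_list_of_set S)"
proof
  assume "(x, j, r) \<in> dec_lengths t"
  moreover have "(x - 1, x, 1) \<in> dec_lengths (sorted_list_of_set S)"
    using S x unfolding dec_lengths_iff dec_chain_def
    by (intro exI[of _ "[x]"]) (auto simp: subseq_singleton_left)
  ultimately show "(x - 1, j, Suc r) \<in> dec_lengths (t @ sorted_list_of_set S)"
    unfolding dec_lengths_append by force
next
  assume "(x - 1, j, Suc r) \<in> dec_lengths (t @ sorted_list_of_set S)"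
  then obtain m r1 r2 where r: "Suc r = r1 + r2" "(m, j, r1) \<in> dec_lengths t"
    "(x - 1, m, r2) \<in> dec_lengths (sorted_list_of_set S)"
    by (auto simp: dec_lengths_append)
  have "r2 \<le> 1" using r dec_lengths_row by blast
  obtain s where s: "dec_chain m j t s" "length s = r1" using r by (auto simp: dec_lengths_iff)
  obtain s' where s': "dec_chain (x - 1) m (sorted_list_of_set S) s'" "length s' = r2"
    using r by (auto simp: dec_lengths_iff)
  show "(x, j, r) \<in> dec_lengths t"
  proof (cases "r2 = 0")
    case True
    \<comment> \<open>The chain lies in \<open>t\<close> entirely; dropping its last and smallest
      letter \<open>z \<ge> x\<close> leaves letters above \<open>x\<close>.\<close>
    then obtain s0 z where s0: "s = s0 @ [z]" "length s0 = r"
      using r s by (cases s rule: rev_cases) auto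
    have "subseq s0 t"
      using s s0 subseq_order.trans[of s0 "s0 @ [z]" t] by (auto simp: dec_chain_def)
    moreover have "m \<ge> x - 1" using s' by (auto simp: dec_chain_def)
    ultimately have "dec_chain x j t s0"
      using s x unfolding dec_chain_def s0 by (fastforce simp: sorted_wrt_append)
    then show ?thesis using s0 dec_lengths_iff by blast
  next
    case False
    then have "r2 = 1" using \<open>r2 \<le> 1\<close> by auto
    then obtain y where "s' = [y]" using s' by (auto simp: length_Suc_conv)
    then have "x \<le> m" using s' by (auto simp: dec_chain_def)
    then have "dec_chain x j t s" using s x by (fastforce simp: dec_chain_def)
    then show ?thesis using s r \<open>r2 = 1\<close> dec_lengths_iff by auto
  qed
qed

text \<open>The shift lemma compares \<open>t\<close> and \<open>t'\<close> only at lower thresholds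
  in \<open>S\<close>. As both words use only letters of \<open>S\<close> above its minimum, every
  other lower threshold can be replaced by one in \<open>S\<close>.\<close>

lemma dec_lengths_subset:
  assumes S: "finite S" and t: "set t \<subseteq> S" and t': "set t' \<subseteq> {x \<in> S. \<exists>y \<in> S. y < x}"
    and tm: "set t \<subseteq> {x \<in> S. \<exists>y \<in> S. y < x}"
    and eq: "\<And>x j r. x \<in> S \<Longrightarrow> x \<le> j \<Longrightarrow> (x, j, r) \<in> dec_lengths t \<Longrightarrow> (x, j, r) \<in> dec_lengths t'"
  shows "dec_lengths t \<subseteq> dec_lengths t'"
proof (rule subrelI, clarsimp)
  fix i j r
  assume A: "(i, j, r) \<in> dec_lengths t"
  then obtain s where s: "dec_chain i j t s" "length s = r" by (auto simp: dec_lengths_iff)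
  show "(i, j, r) \<in> dec_lengths t'"
  proof (cases "s = []")
    case True
    then show ?thesis using s unfolding dec_lengths_iff by (intro exI[of _ "[]"]) (auto simp: dec_chain_def)
  next
    case False
    define X where "X = {y \<in> S. y \<le> i}"
    \<comment> \<open>Round \<open>i\<close> down to an element of \<open>S\<close>. If there is
      none, take the minimum: it lies above \<open>i\<close>, but below every letter of
      \<open>t\<close> and \<open>t'\<close>.\<close>
    define x where "x = (if X = {} then Min S else Max X)"
    have setst: "set s \<subseteq> set t"
      using s by (auto simp: dec_chain_def dest: subseq_set)
    obtain z where z: "z \<in> set s" "z \<in> S" "i < z" "z \<le> j"
      using False s setst t by (cases s) (auto simp: dec_chain_def)
    have X: "finite X" using S by (simp add: X_def)
    have "S \<noteq> {}" using z by auto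
    then have "x \<in> S" using X Max_in[of X] Min_in[OF S] by (auto simp: x_def X_def)
    have "i \<le> j" using s by (auto simp: dec_chain_def)
    have "x \<le> j"
      using Max_in[OF X] Min_le[OF S z(2)] z \<open>i \<le> j\<close> by (auto simp: x_def X_def split: if_splits)
    have above: "x < y" if y: "y \<in> set s" for y
    proof (cases "X = {}")
      case True
      obtain y' where "y' \<in> S" "y' < y" using y setst tm by blast
      then show ?thesis using Min_le[OF S, of y'] True by (auto simp: x_def)
    next
      case False
      then show ?thesis using Max_in[OF X] s that by (auto simp: x_def X_def dec_chain_def)
    qed
    then have "dec_chain x j t s" using s \<open>x \<le> j\<close> by (auto simp: dec_chain_def)
    then have "(x, j, r) \<in> dec_lengths t" using s(2) unfolding dec_lengths_iff by blast
    then have "(x, j, r) \<in> dec_lengths t'" by (rule eq[OF \<open>x \<in> S\<close> \<open>x \<le> j\<close>])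
    then obtain s' where s': "dec_chain x j t' s'" "length s' = r" by (auto simp: dec_lengths_iff)
    have "i < y" if "y \<in> set s'" for y
    proof (rule ccontr)
      assume "\<not> i < y"
      moreover have "y \<in> set t'" using s' that by (auto simp: dec_chain_def dest: subseq_set)
      ultimately have "y \<in> X" using t' by (auto simp: X_def)
      then have "y \<le> x" using Max_ge[OF X] by (auto simp: x_def)
      then show False using s' that by (auto simp: dec_chain_def)
    qed
    then have "dec_chain i j t' s'" using s' \<open>i \<le> j\<close> by (auto simp: dec_chain_def)
    then show ?thesis using s'(2) unfolding dec_lengths_iff by blast
  qed
qed

lemma dec_lengths_support: "0 < x \<Longrightarrow> x \<in> set p \<longleftrightarrow> (x - 1, x, 1) \<in> dec_lengths p"
proof
  assume "0 < x" "x \<in> set p"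
  then show "(x - 1, x, 1) \<in> dec_lengths p"
    unfolding dec_lengths_iff by (intro exI[of _ "[x]"]) (auto simp: dec_chain_def subseq_singleton_left)
next
  assume x: "0 < x" "(x - 1, x, 1) \<in> dec_lengths p"
  then obtain y where "dec_chain (x - 1) x p [y]" by (auto simp: dec_lengths_iff length_Suc_conv)
  moreover from this have "y = x" using x by (auto simp: dec_chain_def)
  ultimately show "x \<in> set p" by (auto simp: dec_chain_def subseq_singleton_left)
qed

lemma styl_cong_if_dec_lengths:
  assumes "set p \<subseteq> {1..n}" "set q \<subseteq> {1..n}" "dec_lengths p = dec_lengths q"
  shows "(p, q) \<in> styl_cong n"
  using assms
proof (induction "card (set p)" arbitrary: p q rule: less_induct)
  case less
  have "x \<in> set p \<longleftrightarrow> x \<in> set q" for x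
    using dec_lengths_support[of x p] dec_lengths_support[of x q] less.prems by (cases "x = 0") auto
  then have S: "set q = set p" by auto
  define S where "S = set p"
  have fin: "finite S" by (simp add: S_def)
  obtain t where t: "set t \<subseteq> {x \<in> S. \<exists>y \<in> S. y < x}" "(p, t @ sorted_list_of_set S) \<in> styl_cong n"
    using styl_cong_normal_form[OF less.prems(1)] by (auto simp: S_def)
  obtain t' where t': "set t' \<subseteq> {x \<in> S. \<exists>y \<in> S. y < x}" "(q, t' @ sorted_list_of_set S) \<in> styl_cong n"
    using styl_cong_normal_form[OF less.prems(2)] by (auto simp: S_def S)
  have D: "dec_lengths (t @ sorted_list_of_set S) = dec_lengths (t' @ sorted_list_of_set S)"
    using t t' dec_lengths_styl_cong less.prems by metis
  have pos: "0 < x" if "x \<in> S" for x using that less.prems by (auto simp: S_def)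
  have eq: "(x, j, r) \<in> dec_lengths t \<longleftrightarrow> (x, j, r) \<in> dec_lengths t'" if "x \<in> S" "x \<le> j" for x j r
    using dec_lengths_shift[OF fin that(1) pos[OF that(1)] that(2)] D by auto
  have Dt: "dec_lengths t = dec_lengths t'"
    using t t' fin eq by (intro equalityI dec_lengths_subset[of S]) auto
  have "(t, t') \<in> styl_cong n"
  proof (cases "S = {}")
    case True
    then show ?thesis using t t' by (auto intro!: presentation_cong.refl)
  next
    case False
    have "Min S \<notin> set t" using t(1) Min_le[OF fin] by fastforce
    then have "set t \<subset> S" using t(1) Min_in[OF fin False] by blast
    then have "card (set t) < card (set p)" using fin by (simp add: S_def psubset_card_mono)
    then show ?thesis using less.hyps Dt t t' less.prems by (auto simp: S_def subset_iff)
  qed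
  then have "(t @ sorted_list_of_set S, t' @ sorted_list_of_set S) \<in> styl_cong n"
    using less.prems fin by (intro styl_cong_right) (auto simp: S_def)
  then show ?case
    by (rule presentation_cong.trans[OF t(2) presentation_cong.trans[OF _ presentation_cong.sym[OF t'(2)]]])
qed

text \<open>A strictly decreasing word repeats no letter, so over \<open>{1..n}\<close> its length
  is at most \<open>n\<close>.\<close>

lemma dec_lengths_if_subwords:
  assumes "set p \<subseteq> {1..n}" "subwords n p \<subseteq> subwords n q"
  shows "dec_lengths p \<subseteq> dec_lengths q"
proof (rule subrelI, clarsimp)
  fix i j r
  assume "(i, j, r) \<in> dec_lengths p"
  then obtain s where s: "i \<le> j" "subseq s p" "sorted_wrt (>) s" "set s \<subseteq> {i<..j}" "length s = r"
    by (auto simp: dec_lengths_iff dec_chain_def)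
  have "distinct s" using s(3) by (induction s) auto
  then have "length s = card (set s)" by (simp add: distinct_card)
  also have "\<dots> \<le> card {1..n}"
    using s(2) assms by (intro card_mono) (auto dest: subseq_set)
  finally have "s \<in> subwords n q" using s assms by (auto simp: subwords_def)
  then show "(i, j, r) \<in> dec_lengths q"
    using s by (auto simp: subwords_def dec_lengths_iff dec_chain_def)
qed

text \<open>Keep only those variables of \<open>u\<close> whose image supplies at least one letter
  of the embedded \<open>w\<close>; there are at most \<open>length w\<close> of them.\<close>

lemma subseq_concat_mapE:
  assumes "subseq w (concat (map f u))"
  obtains x where "subseq x u" "length x \<le> length w" "subseq w (concat (map f x))"
  using assms
proof (induction u arbitrary: w thesis)
  case Nil
  show ?case using Nil.prems(1)[of "[]"] Nil.prems(2) by auto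
next
  case (Cons a u)
  obtain w1 w2 where w: "w = w1 @ w2" "subseq w1 (f a)" "subseq w2 (concat (map f u))"
    using Cons.prems(2) by (auto simp: subseq_append_iff)
  obtain x where x: "subseq x u" "length x \<le> length w2" "subseq w2 (concat (map f x))"
    using Cons.IH[OF _ w(3)] by blast
  show ?case
  proof (cases w1)
    case Nil
    then show ?thesis using Cons.prems(1)[of x] x w by auto
  next
    case (Cons b w1')
    then show ?thesis using Cons.prems(1)[of "a # x"] x w list_emb_append_mono[OF w(2) x(3)] by simp
  qed
qed

lemma subseq_concat_map: "subseq x u \<Longrightarrow> subseq (concat (map f x)) (concat (map f u))"
  by (induction rule: list_emb.induct) (auto intro: list_emb_append_mono)

lemma subwords_concat_map:
  assumes "subwords n u \<subseteq> subwords n v"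
  shows "subwords n (concat (map f u)) \<subseteq> subwords n (concat (map f v))"
proof
  fix w assume w: "w \<in> subwords n (concat (map f u))"
  then obtain x where x: "subseq x u" "length x \<le> length w" "subseq w (concat (map f x))"
    by (auto simp: subwords_def elim: subseq_concat_mapE)
  then have "x \<in> subwords n v" using w assms by (auto simp: subwords_def)
  then have "subseq w (concat (map f v))"
    using x subseq_concat_map[of x v f] by (auto simp: subwords_def)
  then show "w \<in> subwords n (concat (map f v))" using w by (auto simp: subwords_def)
qed

section \<open>Morphisms into the stylic monoid and the separating action\<close>

lemma styl_class: "X \<in> carrier (styl n) \<Longrightarrow> \<exists>x. set x \<subseteq> {1..n} \<and> X = styl_cong n `` {x}"
  unfolding styl_def by (erule presented_monoid_carrierE) auto

lemma monoid_hom_styl: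
  assumes "\<psi> \<in> monoid_hom free_monoid (styl n)"
  shows "\<exists>f. (\<forall>a. set (f a) \<subseteq> {1..n}) \<and> (\<forall>u. \<psi> u = styl_cong n `` {concat (map f u)})"
proof -
  have "\<psi> [a] \<in> carrier (styl n)" for a
    using assms by (auto simp: monoid_hom_def hom_def free_monoid_def)
  then have "\<exists>x. set x \<subseteq> {1..n} \<and> \<psi> [a] = styl_cong n `` {x}" for a
    by (rule styl_class)
  then obtain f where f: "\<And>a. set (f a) \<subseteq> {1..n}" "\<And>a. \<psi> [a] = styl_cong n `` {f a}"
    by metis
  have "\<psi> u = styl_cong n `` {concat (map f u)}" for u
  proof (induction u)
    case Nil
    then show ?case using assms by (auto simp: monoid_hom_def free_monoid_def styl_def presented_monoid_def)
  next
    case (Cons a u)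
    have "\<psi> (a # u) = \<psi> [a] \<otimes>\<^bsub>styl n\<^esub> \<psi> u"
      using assms hom_mult[of \<psi> free_monoid "styl n" "[a]" u] by (auto simp: monoid_hom_def free_monoid_def)
    also have "\<dots> = styl_cong n `` {f a @ concat (map f u)}"
      unfolding Cons f styl_def using f by (intro presented_monoid_mult) (auto simp: subset_iff)
    finally show ?case by simp
  qed
  with f show ?thesis by blast
qed

lemma concat_map_monoid_hom_styl:
  assumes "\<And>a. set (f a) \<subseteq> {1..n}"
  shows "(\<lambda>u. styl_cong n `` {concat (map f u)}) \<in> monoid_hom free_monoid (styl n)"
proof -
  have l: "concat (map f u) \<in> lists {1..n}" for u using assms by (auto simp: subset_iff)
  show ?thesis
    unfolding monoid_hom_def hom_def styl_def
    using l by (auto simp: free_monoid_def presented_monoid_mult presented_monoid_carrierI)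
      (auto simp: presented_monoid_def)
qed

text \<open>For \<open>1 \<le> i \<le> n\<close>, the letter \<open>i\<close> moves the single state
  \<open>n - i\<close>, so larger letters move lower states. These maps are the usual generators of
  the monoid of order-preserving extensive maps of a chain, the Catalan monoid.\<close>

definition chain_act :: "nat \<Rightarrow> nat \<Rightarrow> nat \<Rightarrow> nat" where
  "chain_act n i s = (if s + i = n then Suc s else s)"

lemma fold_chain_act_styl_cong:
  assumes "(p, q) \<in> styl_cong n"
  shows "fold (chain_act n) p = fold (chain_act n) q"
  using assms
proof induction
  case (rel x y)
  then show ?case by (auto simp: stylic_relations_def fun_eq_iff chain_act_def)
qed auto

text \<open>Letter \<open>i\<close> stands for position \<open>n - i\<close> of \<open>w\<close>,
  the state that it moves. The image of a variable thus lists its positions in \<open>w\<close> from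
  right to left.\<close>

definition pos_letters :: "nat \<Rightarrow> 'a list \<Rightarrow> 'a \<Rightarrow> nat list" where
  "pos_letters n w a = filter (\<lambda>i. w ! (n - i) = a) [Suc (n - length w)..<Suc n]"

text \<open>Since the letters are applied in increasing order, each variable moves a state at most once.\<close>

lemma fold_pos_letters:
  assumes "length w \<le> n" "s \<le> n"
  shows "fold (chain_act n) (pos_letters n w a) s = (if s < length w \<and> w ! s = a then Suc s else s)"
proof -
  have nop: "fold (chain_act n) is s = s" if "\<forall>i \<in> set is. s + i \<noteq> n" for "is" s
    using that by (induction "is") (auto simp: chain_act_def)
  show ?thesis
  proof (cases "s < length w \<and> w ! s = a")
    case True
    \<comment> \<open>Only \<open>n - s\<close> moves \<open>s\<close>, and the letter that would
      move \<open>Suc s\<close> is smaller, hence already applied.\<close>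
    have split: "[Suc (n - length w)..<Suc n] = [Suc (n - length w)..<n - s] @ [n - s] @ [Suc (n - s)..<Suc n]"
    proof -
      have "[Suc (n - length w)..<Suc n] = [Suc (n - length w)..<n - s] @ [n - s..<Suc n]"
        using True assms upt_add_eq_append[of "Suc (n - length w)" "n - s" "Suc s"] by auto
      moreover have "[n - s..<Suc n] = (n - s) # [Suc (n - s)..<Suc n]" by (intro upt_conv_Cons) simp
      ultimately show ?thesis by simp
    qed
    have inner: "fold (chain_act n) (filter (\<lambda>i. w ! (n - i) = a) [Suc (n - length w)..<n - s]) s = s"
      by (intro nop) auto
    have outer: "fold (chain_act n) (filter (\<lambda>i. w ! (n - i) = a) [Suc (n - s)..<Suc n]) (Suc s) = Suc s"
      using assms by (intro nop) auto
    have "fold (chain_act n) (pos_letters n w a) s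
      = fold (chain_act n) (filter (\<lambda>i. w ! (n - i) = a) [Suc (n - s)..<Suc n])
          (chain_act n (n - s) (fold (chain_act n) (filter (\<lambda>i. w ! (n - i) = a) [Suc (n - length w)..<n - s]) s))"
      unfolding pos_letters_def split using True assms by simp
    also have "\<dots> = Suc s" unfolding inner using assms outer by (simp add: chain_act_def)
    finally show ?thesis using True by simp
  next
    case False
    have "fold (chain_act n) (pos_letters n w a) s = s"
      using False assms by (intro nop) (auto simp: pos_letters_def)
    then show ?thesis using False by simp
  qed
qed

lemma subseq_Cons_drop:
  "s < length w \<Longrightarrow> subseq (drop s w) (a # u) \<longleftrightarrow> (if w ! s = a then subseq (drop (Suc s) w) u else subseq (drop s w) u)"
  by (simp add: Cons_nth_drop_Suc[symmetric])

text \<open>The state follows the greedy embedding: it is the number of letters of \<open>w\<close>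
  matched so far, and greedy matching succeeds whenever some embedding exists.\<close>

lemma fold_pos_letters_word:
  assumes "length w \<le> n" "s \<le> length w"
  shows "fold (chain_act n) (concat (map (pos_letters n w) u)) s = length w \<longleftrightarrow> subseq (drop s w) u"
  using assms(2)
proof (induction u arbitrary: s)
  case Nil
  then show ?case by (cases "drop s w") auto
next
  case (Cons a u)
  show ?case
  proof (cases "s = length w")
    case True
    then show ?thesis using Cons.IH[of s] assms by (simp add: fold_pos_letters)
  next
    case False
    then have "s < length w" using Cons.prems by simp
    then show ?thesis using Cons.IH[of s] Cons.IH[of "Suc s"] assms Cons.prems
      by (simp add: fold_pos_letters subseq_Cons_drop)
  qed
qed

theorem Check_Id_styl: "(u, v) \<in> Check_Id (styl n) \<longleftrightarrow> subwords n u = subwords n v"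
proof
  assume L: "(u, v) \<in> Check_Id (styl n)"
  have "subseq w u \<longleftrightarrow> subseq w v" if "length w \<le> n" for w
  proof -
    let ?f = "pos_letters n w"
    have f: "set (?f a) \<subseteq> {1..n}" for a by (auto simp: pos_letters_def)
    have "\<forall>\<psi> \<in> monoid_hom free_monoid (styl n). \<psi> u = \<psi> v"
      using L by (simp add: Check_Id_def satisfies_identity_def)
    from bspec[OF this concat_map_monoid_hom_styl[of ?f, OF f]]
    have "styl_cong n `` {concat (map ?f u)} = styl_cong n `` {concat (map ?f v)}" .
    moreover have "concat (map ?f w) \<in> lists {1..n}" for w
      using f by (auto simp: subset_iff)
    ultimately have "(concat (map ?f u), concat (map ?f v)) \<in> styl_cong n"
      by (rule eq_equiv_class[OF _ equiv_presentation_cong])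
    from fold_chain_act_styl_cong[OF this] show ?thesis
      using fold_pos_letters_word[OF that, of 0 u] fold_pos_letters_word[OF that, of 0 v] by simp
  qed
  then show "subwords n u = subwords n v" by (auto simp: subwords_def)
next
  assume R: "subwords n u = subwords n v"
  have "\<psi> u = \<psi> v" if hom: "\<psi> \<in> monoid_hom free_monoid (styl n)" for \<psi>
  proof -
    obtain f where f: "\<And>a. set (f a) \<subseteq> {1..n}" "\<And>u. \<psi> u = styl_cong n `` {concat (map f u)}"
      using monoid_hom_styl[OF hom] by blast
    have s: "set (concat (map f u)) \<subseteq> {1..n}" for u using f by auto
    have "dec_lengths (concat (map f u)) = dec_lengths (concat (map f v))"
      using R by (intro equalityI dec_lengths_if_subwords[of _ n] s subwords_concat_map) auto
    then have "(concat (map f u), concat (map f v)) \<in> styl_cong n"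
      by (intro styl_cong_if_dec_lengths s)
    then have "styl_cong n `` {concat (map f u)} = styl_cong n `` {concat (map f v)}"
      by (rule equiv_class_eq[OF equiv_presentation_cong])
    then show ?thesis by (simp only: f(2))
  qed
  then show "(u, v) \<in> Check_Id (styl n)" by (auto simp: Check_Id_def satisfies_identity_def)
qed

section \<open>Inclusion of subwords by dynamic programming\<close>

text \<open>Positions count from 1 and 0 means absence, so zero-initialised memory is the table of
  the empty prefix.\<close>

definition last_occ :: "'a \<Rightarrow> 'a list \<Rightarrow> nat" where
  "last_occ a xs = length xs - length (takeWhile (\<lambda>x. x \<noteq> a) (rev xs))"

lemma last_occ_Nil [simp]: "last_occ a [] = 0"
  by (simp add: last_occ_def)

lemma last_occ_snoc [simp]: "last_occ a (xs @ [x]) = (if x = a then Suc (length xs) else last_occ a xs)"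
  by (simp add: last_occ_def)

lemma less_last_occ_iff: "j < last_occ a xs \<longleftrightarrow> (\<exists>p. j \<le> p \<and> p < length xs \<and> xs ! p = a)"
proof (induction xs rule: rev_induct)
  case Nil
  then show ?case by simp
next
  case (snoc x xs)
  have eq: "(\<exists>p. j \<le> p \<and> p < length (xs @ [x]) \<and> (xs @ [x]) ! p = a) \<longleftrightarrow>
    j \<le> length xs \<and> x = a \<or> (\<exists>p. j \<le> p \<and> p < length xs \<and> xs ! p = a)"
  proof -
    have "p < length (xs @ [x]) \<and> (xs @ [x]) ! p = a \<longleftrightarrow> p < length xs \<and> xs ! p = a \<or> p = length xs \<and> x = a" for p
      by (auto simp: nth_append)
    then show ?thesis by blast
  qed
  show ?case
  proof (cases "x = a")
    case True
    then have "j < last_occ a (xs @ [x]) \<longleftrightarrow> j \<le> length xs" by (simp add: less_Suc_eq_le)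
    moreover have "j \<le> length xs" if "j \<le> p" "p < length xs" for p using that by simp
    ultimately show ?thesis unfolding eq using True by blast
  next
    case False
    then show ?thesis unfolding eq using snoc by simp
  qed
qed

text \<open>One more than the largest \<open>j\<close> for which \<open>drop j v\<close> contains
  all subwords of \<open>w\<close> of length at most \<open>d\<close>, and 0 if there is none. In
  the recursion, \<open>max_start v d w - 1\<close> is the length of the longest prefix of
  \<open>v\<close> in which \<open>a\<close> may be matched; truncated subtraction turns failure
  into the empty prefix.\<close>

fun max_start :: "'a list \<Rightarrow> nat \<Rightarrow> 'a list \<Rightarrow> nat" where
  "max_start v 0 w = Suc (length v)"
| "max_start v (Suc d) [] = Suc (length v)"
| "max_start v (Suc d) (a # w) = min (max_start v (Suc d) w) (last_occ a (take (max_start v d w - 1) v))"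

lemma max_start_Nil [simp]: "max_start v d [] = Suc (length v)"
  by (cases d) auto

lemma max_start_le: "max_start v d w \<le> Suc (length v)"
  by (induction v d w rule: max_start.induct) auto

lemma max_start_Cons_le: "max_start v d (a # w) \<le> max_start v d w"
  by (cases d) auto

text \<open>All words of \<open>X\<close> can be continued after one common occurrence of
  \<open>a\<close>, the first one, which leaves the longest remainder. This exchange of quantifiers
  turns a condition on many words into one on a position.\<close>

lemma all_subseq_Cons_iff:
  assumes "X \<noteq> {}"
  shows "(\<forall>x \<in> X. subseq (a # x) ys) \<longleftrightarrow>
    (\<exists>p. p < length ys \<and> ys ! p = a \<and> (\<forall>x \<in> X. subseq x (drop (Suc p) ys)))"
proof (induction ys)
  case Nil
  then show ?case using assms by auto
next
  case (Cons b ys)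
  show ?case
  proof (cases "a = b")
    case True
    have "subseq x ys" if "subseq x (drop p ys)" for x p
      using that subseq_order.trans[OF that suffix_imp_subseq[OF suffix_drop]] by simp
    then show ?thesis using True by (fastforce intro: exI[of _ 0])
  next
    case False
    have "(\<forall>x \<in> X. subseq (a # x) (b # ys)) \<longleftrightarrow> (\<forall>x \<in> X. subseq (a # x) ys)"
      using False by (simp add: subseq_Cons2_neq)
    also have "\<dots> \<longleftrightarrow> (\<exists>p. p < length (b # ys) \<and> (b # ys) ! p = a \<and> (\<forall>x \<in> X. subseq x (drop (Suc p) (b # ys))))"
      unfolding Cons.IH
    proof (intro iffI; elim exE conjE)
      fix p assume "p < length ys" "ys ! p = a" "\<forall>x \<in> X. subseq x (drop (Suc p) ys)"
      then show "\<exists>p. p < length (b # ys) \<and> (b # ys) ! p = a \<and> (\<forall>x \<in> X. subseq x (drop (Suc p) (b # ys)))"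
        by (intro exI[of _ "Suc p"]) auto
    next
      fix p assume "p < length (b # ys)" "(b # ys) ! p = a" "\<forall>x \<in> X. subseq x (drop (Suc p) (b # ys))"
      then show "\<exists>p. p < length ys \<and> ys ! p = a \<and> (\<forall>x \<in> X. subseq x (drop (Suc p) ys))"
        using False by (cases p) auto
    qed
    finally show ?thesis .
  qed
qed

lemma subwords_Nil [simp]: "subwords d [] = {[]}"
  by (auto simp: subwords_def elim: list_emb.cases)

lemma Nil_in_subwords: "[] \<in> subwords d w"
  by (simp add: subwords_def)

lemma subwords_Suc_Cons: "subwords (Suc d) (a # w) = subwords (Suc d) w \<union> (#) a ` subwords d w"
proof (intro equalityI subsetI)
  fix x assume "x \<in> subwords (Suc d) (a # w)"
  then show "x \<in> subwords (Suc d) w \<union> (#) a ` subwords d w"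
    by (cases x) (auto simp: subwords_def split: if_splits)
next
  fix x assume "x \<in> subwords (Suc d) w \<union> (#) a ` subwords d w"
  then show "x \<in> subwords (Suc d) (a # w)"
    by (auto simp: subwords_def)
qed

text \<open>Subwords of \<open>a # w\<close> either avoid the first letter or continue it by a
  shorter subword of \<open>w\<close>. For the latter, the common occurrence of \<open>a\<close>
  must leave a suffix admissible for \<open>w\<close>; the last such occurrence bounds
  \<open>j\<close>.\<close>

lemma less_max_start_iff:
  assumes "j \<le> length v"
  shows "j < max_start v d w \<longleftrightarrow> (\<forall>x \<in> subwords d w. subseq x (drop j v))"
  using assms
proof (induction v d w arbitrary: j rule: max_start.induct)
  case (1 v w)
  then show ?case by (auto simp: subwords_def)
next
  case (2 v d)
  then show ?case by simp
next
  case (3 v d a w)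
  have "(\<forall>x \<in> subwords d w. subseq (a # x) (drop j v)) \<longleftrightarrow>
    (\<exists>p. p < length (drop j v) \<and> drop j v ! p = a \<and> (\<forall>x \<in> subwords d w. subseq x (drop (Suc p) (drop j v))))"
    using Nil_in_subwords by (intro all_subseq_Cons_iff) blast
  also have "\<dots> \<longleftrightarrow> (\<exists>p. p + j < length v \<and> v ! (p + j) = a \<and> Suc (p + j) < max_start v d w)"
  proof (rule ex_cong1)
    fix p
    show "(p < length (drop j v) \<and> drop j v ! p = a \<and> (\<forall>x \<in> subwords d w. subseq x (drop (Suc p) (drop j v))))
      \<longleftrightarrow> (p + j < length v \<and> v ! (p + j) = a \<and> Suc (p + j) < max_start v d w)"
      using "3.IH"(2)[of "Suc (p + j)"] "3.prems" by (auto simp: add.commute)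
  qed
  also have "\<dots> \<longleftrightarrow> (\<exists>p. j \<le> p \<and> p < length v \<and> p < max_start v d w - 1 \<and> v ! p = a)"
    by (metis add.commute le_add1 le_Suc_ex less_diff_conv plus_1_eq_Suc)
  also have "\<dots> \<longleftrightarrow> j < last_occ a (take (max_start v d w - 1) v)"
    unfolding less_last_occ_iff by (rule ex_cong1) auto
  finally show ?case
    using "3.IH"(1)[OF "3.prems"] by (auto simp: subwords_Suc_Cons)
qed

lemma subwords_subset_iff_max_start: "subwords d u \<subseteq> subwords d v \<longleftrightarrow> 0 < max_start v d u"
  using less_max_start_iff[of 0 v d u] by (auto simp: subwords_def)


section \<open>Structured programs and their compilation\<close>

text \<open>Actions and tests are parameters, so that one compiler and one program logic serve the
  random access machine and the Turing machine alike.\<close>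

datatype ('a, 't) com =
    Skip
  | Act 'a
  | Seq "('a, 't) com" "('a, 't) com"
  | If 't "('a, 't) com" "('a, 't) com"
  | While 't "('a, 't) com"

datatype ('a, 't) ins = IAct 'a | IBr 't nat | IHalt bool

fun clen :: "('a, 't) com \<Rightarrow> nat" where
  "clen Skip = 0"
| "clen (Act a) = 1"
| "clen (Seq c d) = clen c + clen d"
| "clen (If t c d) = clen c + clen d + 2"
| "clen (While t c) = clen c + 3"

text \<open>The test \<open>tt\<close> is meant to succeed always, so that \<open>IBr tt l\<close> is an unconditional jump.\<close>

fun compile :: "'t \<Rightarrow> ('a, 't) com \<Rightarrow> nat \<Rightarrow> ('a, 't) ins list" where
  "compile tt Skip k = []"
| "compile tt (Act a) k = [IAct a]"
| "compile tt (Seq c d) k = compile tt c k @ compile tt d (k + clen c)"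
| "compile tt (If t c d) k =
    [IBr t (k + clen d + 2)] @ compile tt d (k + 1) @ [IBr tt (k + clen c + clen d + 2)] @
    compile tt c (k + clen d + 2)"
| "compile tt (While t c) k =
    [IBr t (k + 2), IBr tt (k + clen c + 3)] @ compile tt c (k + 2) @ [IBr tt k]"

lemma length_compile [simp]: "length (compile tt c k) = clen c"
  by (induction c arbitrary: k) auto

definition code_at :: "'i list \<Rightarrow> nat \<Rightarrow> 'i list \<Rightarrow> bool" where
  "code_at p k q \<longleftrightarrow> (\<forall>i < length q. k + i < length p \<and> p ! (k + i) = q ! i)"

lemma code_at_Nil [simp]: "code_at p k []"
  by (simp add: code_at_def)

lemma code_at_Cons [simp]: "code_at p k (x # q) \<longleftrightarrow> k < length p \<and> p ! k = x \<and> code_at p (Suc k) q"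
  by (auto simp: code_at_def less_Suc_eq_0_disj nth_Cons')

lemma code_at_append [simp]: "code_at p k (q @ r) \<longleftrightarrow> code_at p k q \<and> code_at p (k + length q) r"
  by (induction q arbitrary: k) auto

lemma code_at_self: "code_at (q @ r) (length q) r"
  by (auto simp: code_at_def)

text \<open>\<open>ok\<close> is meant to hold throughout a run, since both applications bound all
  intermediate configurations: the size of numbers on the RAM, the set of configurations on the
  Turing machine. \<open>safe\<close> is the condition under which an action preserves it.\<close>

locale machine =
  fixes act :: "'a \<Rightarrow> 's \<Rightarrow> 's" and tst :: "'t \<Rightarrow> 's \<Rightarrow> bool" and tt :: 't and ok :: "'s \<Rightarrow> bool"
    and safe :: "'a \<Rightarrow> 's \<Rightarrow> bool"
  assumes tst_tt: "ok s \<Longrightarrow> tst tt s"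
    and ok_act: "ok s \<Longrightarrow> safe a s \<Longrightarrow> ok (act a s)"
begin

text \<open>The number counts steps of the compiled code, jumps included: a false test of
  \<open>If\<close> costs an extra jump over the other branch, and a round of \<open>While\<close>
  costs a branch into the body and a jump back.\<close>

inductive exec :: "('a, 't) com \<Rightarrow> 's \<Rightarrow> nat \<Rightarrow> 's \<Rightarrow> bool" where
  exec_Skip: "exec Skip s 0 s"
| exec_Act: "safe a s \<Longrightarrow> exec (Act a) s (Suc 0) (act a s)"
| exec_Seq: "exec c s k s' \<Longrightarrow> exec d s' k' s'' \<Longrightarrow> exec (Seq c d) s (k + k') s''"
| exec_IfT: "tst t s \<Longrightarrow> exec c s k s' \<Longrightarrow> exec (If t c d) s (Suc k) s'"
| exec_IfF: "\<not> tst t s \<Longrightarrow> exec d s k s' \<Longrightarrow> exec (If t c d) s (Suc (Suc k)) s'"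
| exec_WhileF: "\<not> tst t s \<Longrightarrow> exec (While t c) s (Suc (Suc 0)) s"
| exec_WhileT: "tst t s \<Longrightarrow> exec c s k s' \<Longrightarrow> exec (While t c) s' k' s'' \<Longrightarrow>
    exec (While t c) s (Suc (Suc (k + k'))) s''"

inductive_cases exec_SkipE: "exec Skip s k s'"
inductive_cases exec_ActE: "exec (Act a) s k s'"
inductive_cases exec_SeqE: "exec (Seq c d) s k s'"
inductive_cases exec_IfE: "exec (If t c d) s k s'"
inductive_cases exec_WhileE: "exec (While t c) s k s'"

text \<open>Total correctness with time: an execution terminates, and its step count is passed to
  the postcondition.\<close>

definition wp :: "('a, 't) com \<Rightarrow> (nat \<Rightarrow> 's \<Rightarrow> bool) \<Rightarrow> 's \<Rightarrow> bool" where
  "wp c Q s \<longleftrightarrow> (\<exists>k s'. exec c s k s' \<and> Q k s')"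

lemma wp_Skip [simp]: "wp Skip Q s \<longleftrightarrow> Q 0 s"
  by (auto simp: wp_def intro: exec_Skip elim: exec_SkipE)

lemma wp_Act [simp]: "wp (Act a) Q s \<longleftrightarrow> safe a s \<and> Q (Suc 0) (act a s)"
  unfolding wp_def by (metis exec_Act exec_ActE)

lemma wp_Seq [simp]: "wp (Seq c d) Q s \<longleftrightarrow> wp c (\<lambda>k. wp d (\<lambda>k'. Q (k + k'))) s"
  unfolding wp_def by (blast intro: exec_Seq elim: exec_SeqE)

lemma wp_If [simp]:
  "wp (If t c d) Q s \<longleftrightarrow> (if tst t s then wp c (\<lambda>k. Q (Suc k)) s else wp d (\<lambda>k. Q (Suc (Suc k))) s)"
proof (cases "tst t s")
  case True
  then have "exec (If t c d) s k s' \<longleftrightarrow> (\<exists>j. k = Suc j \<and> exec c s j s')" for k s'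
    by (auto intro: exec_IfT elim: exec_IfE)
  then show ?thesis using True unfolding wp_def by auto
next
  case False
  then have "exec (If t c d) s k s' \<longleftrightarrow> (\<exists>j. k = Suc (Suc j) \<and> exec d s j s')" for k s'
    by (auto intro: exec_IfF elim: exec_IfE)
  then show ?thesis using False unfolding wp_def by auto
qed

lemma wp_While:
  "wp (While t c) Q s \<longleftrightarrow>
    (if tst t s then wp c (\<lambda>k. wp (While t c) (\<lambda>k'. Q (Suc (Suc (k + k'))))) s else Q (Suc (Suc 0)) s)"
proof (cases "tst t s")
  case True
  have "exec (While t c) s k s' \<longleftrightarrow>
    (\<exists>i j r. k = Suc (Suc (i + j)) \<and> exec c s i r \<and> exec (While t c) r j s')" for k s'
  proof
    assume "exec (While t c) s k s'"
    then show "\<exists>i j r. k = Suc (Suc (i + j)) \<and> exec c s i r \<and> exec (While t c) r j s'"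
      by (rule exec_WhileE) (use True in auto)
  next
    assume "\<exists>i j r. k = Suc (Suc (i + j)) \<and> exec c s i r \<and> exec (While t c) r j s'"
    then show "exec (While t c) s k s'" using exec_WhileT[OF True] by auto
  qed
  then show ?thesis using True unfolding wp_def by simp blast
next
  case False
  then have "exec (While t c) s k s' \<longleftrightarrow> k = Suc (Suc 0) \<and> s' = s" for k s'
    by (auto intro: exec_WhileF elim: exec_WhileE)
  then show ?thesis using False unfolding wp_def by simp
qed

lemma wp_mono: "wp c Q s \<Longrightarrow> (\<And>k s'. Q k s' \<Longrightarrow> Q' k s') \<Longrightarrow> wp c Q' s"
  unfolding wp_def by blast

text \<open>\<open>P m k\<close> says that the measure is \<open>m\<close> after \<open>k\<close> steps.\<close>

lemma wp_While_rule:
  fixes m :: nat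
  assumes "P m k s"
    and "\<And>m k s. P m k s \<Longrightarrow> tst t s \<Longrightarrow> wp c (\<lambda>k' s'. \<exists>m' < m. P m' (k + k' + 2) s') s"
    and "\<And>m k s. P m k s \<Longrightarrow> \<not> tst t s \<Longrightarrow> Q (k + 2) s"
  shows "wp (While t c) (\<lambda>k'. Q (k + k')) s"
  using assms(1)
proof (induction m arbitrary: k s rule: less_induct)
  case (less m)
  show ?case
  proof (cases "tst t s")
    case True
    have "wp c (\<lambda>k'. wp (While t c) (\<lambda>k''. Q (k + Suc (Suc (k' + k''))))) s"
      using assms(2)[OF less.prems True]
    proof (rule wp_mono)
      fix k' s' assume "\<exists>m' < m. P m' (k + k' + 2) s'"
      then have "wp (While t c) (\<lambda>k''. Q (k + k' + 2 + k'')) s'" using less.IH by blast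
      then show "wp (While t c) (\<lambda>k''. Q (k + Suc (Suc (k' + k'')))) s'" by (simp add: add.assoc)
    qed
    then show ?thesis using True by (subst wp_While) simp
  next
    case False
    then show ?thesis using assms(3)[OF less.prems False] by (subst wp_While) simp
  qed
qed

definition step :: "('a, 't) ins list \<Rightarrow> nat \<times> 's \<Rightarrow> nat \<times> 's" where
  "step p = (\<lambda>(i, s).
    if i < length p then
      (case p ! i of IAct a \<Rightarrow> (Suc i, act a s) | IBr t l \<Rightarrow> (if tst t s then l else Suc i, s) | IHalt b \<Rightarrow> (i, s))
    else (i, s))"

definition run :: "('a, 't) ins list \<Rightarrow> nat \<times> 's \<Rightarrow> nat \<Rightarrow> nat \<times> 's \<Rightarrow> bool" where
  "run p x k y \<longleftrightarrow> (step p ^^ k) x = y \<and> (\<forall>i \<le> k. ok (snd ((step p ^^ i) x)))"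

lemma run_trans: "run p x k y \<Longrightarrow> run p y k' z \<Longrightarrow> run p x (k + k') z"
proof -
  assume A: "run p x k y" and B: "run p y k' z"
  have *: "(step p ^^ (k + i)) x = (step p ^^ i) y" for i
    using A by (simp add: run_def funpow_add[of i k "step p", unfolded add.commute[of i k]])
  have "ok (snd ((step p ^^ i) x))" if "i \<le> k + k'" for i
  proof (cases "i \<le> k")
    case True
    then show ?thesis using A by (auto simp: run_def)
  next
    case False
    then show ?thesis using B *[of "i - k"] that by (auto simp: run_def)
  qed
  then show ?thesis using B by (auto simp: run_def *)
qed

lemma run_refl: "ok (snd x) \<Longrightarrow> run p x 0 x"
  by (simp add: run_def)

lemma run_step: "step p x = y \<Longrightarrow> ok (snd x) \<Longrightarrow> ok (snd y) \<Longrightarrow> run p x (Suc 0) y"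
  by (auto simp: run_def le_Suc_eq)

lemma run_ok: "run p x k y \<Longrightarrow> ok (snd y)"
  by (auto simp: run_def)

lemma run_branch:
  "code_at p i [IBr t l] \<Longrightarrow> ok s \<Longrightarrow> j = (if tst t s then l else Suc i) \<Longrightarrow> run p (i, s) 1 (j, s)"
  unfolding One_nat_def by (rule run_step) (auto simp: step_def)

lemma exec_run:
  assumes "exec c s k s'" "ok s" "code_at p i (compile tt c i)"
  shows "run p (i, s) k (i + clen c, s')"
  using assms
proof (induction arbitrary: i rule: exec.induct)
  case (exec_Skip s)
  then show ?case by (auto intro: run_refl)
next
  case (exec_Act a s)
  then show ?case using ok_act by (auto simp: step_def intro!: run_step)
next
  case (exec_Seq c s k s' d k' s'')
  have 1: "run p (i, s) k (i + clen c, s')" using exec_Seq by auto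
  have "run p (i + clen c, s') k' (i + clen c + clen d, s'')"
    using exec_Seq.prems run_ok[OF 1] by (intro exec_Seq.IH) auto
  from run_trans[OF 1 this] show ?case by (simp add: add.assoc)
next
  case (exec_IfT t s c k s' d)
  have 1: "run p (i, s) 1 (i + clen d + 2, s)"
    using exec_IfT.prems exec_IfT.hyps by (intro run_branch) auto
  have "run p (i + clen d + 2, s) k (i + clen d + 2 + clen c, s')"
    using exec_IfT.prems by (intro exec_IfT.IH) auto
  from run_trans[OF 1 this] show ?case by (simp add: ac_simps)
next
  case (exec_IfF t s d k s' c)
  have 1: "run p (i, s) 1 (i + 1, s)"
    using exec_IfF.prems exec_IfF.hyps by (intro run_branch) auto
  have 2: "run p (i + 1, s) k (i + 1 + clen d, s')"
    using exec_IfF.prems by (intro exec_IfF.IH) auto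
  have 3: "run p (i + 1 + clen d, s') 1 (i + clen c + clen d + 2, s')"
    using exec_IfF.prems run_ok[OF 2] tst_tt by (intro run_branch) auto
  from run_trans[OF run_trans[OF 1 2] 3] show ?case by (simp add: ac_simps)
next
  case (exec_WhileF t s c)
  have 1: "run p (i, s) 1 (Suc i, s)"
    using exec_WhileF by (intro run_branch) auto
  have 2: "run p (Suc i, s) 1 (i + clen c + 3, s)"
    using exec_WhileF tst_tt by (intro run_branch) auto
  from run_trans[OF 1 2] show ?case by (simp add: ac_simps numeral_2_eq_2)
next
  case (exec_WhileT t s c k s' k' s'')
  have 1: "run p (i, s) 1 (i + 2, s)"
    using exec_WhileT.prems exec_WhileT.hyps by (intro run_branch) auto
  have 2: "run p (i + 2, s) k (i + 2 + clen c, s')"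
    using exec_WhileT.prems by (intro exec_WhileT.IH) auto
  have 3: "run p (i + 2 + clen c, s') 1 (i, s')"
    using exec_WhileT.prems run_ok[OF 2] tst_tt by (intro run_branch) auto
  have 4: "run p (i, s') k' (i + clen (While t c), s'')"
    using exec_WhileT.prems run_ok[OF 2] by (intro exec_WhileT.IH) auto
  from run_trans[OF run_trans[OF run_trans[OF 1 2] 3] 4] show ?case by (simp add: ac_simps)
qed

text \<open>The prelude \<open>pre\<close> is run separately, so that it can establish
  \<open>ok\<close> in the first place.\<close>

definition program :: "('a, 't) ins list \<Rightarrow> ('a, 't) com \<Rightarrow> 't \<Rightarrow> ('a, 't) ins list" where
  "program pre c t = pre @ compile tt c (length pre) @
    [IBr t (length pre + clen c + 2), IHalt False, IHalt True]"

lemma program_run: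
  assumes "wp c Q s" "ok s"
  shows "\<exists>k s' i. Q k s' \<and> run (program pre c t) (length pre, s) (k + 1) (i, s') \<and>
    i < length (program pre c t) \<and> program pre c t ! i = IHalt (tst t s')"
proof -
  let ?p = "program pre c t" and ?i = "length pre"
  obtain k s' where k: "exec c s k s'" "Q k s'" using assms by (auto simp: wp_def)
  have code: "code_at ?p ?i (compile tt c ?i @ [IBr t (?i + clen c + 2), IHalt False, IHalt True])"
    unfolding program_def by (rule code_at_self)
  have 1: "run ?p (?i, s) k (?i + clen c, s')"
    using code by (intro exec_run[OF k(1) assms(2)]) simp
  have "run ?p (?i + clen c, s') 1 (if tst t s' then ?i + clen c + 2 else Suc (?i + clen c), s')"
    using code run_ok[OF 1] by (intro run_branch) auto
  from run_trans[OF 1 this] have 2: "run ?p (?i, s) (k + 1) (if tst t s' then ?i + clen c + 2 else Suc (?i + clen c), s')" .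
  show ?thesis
  proof (intro exI conjI)
    show "Q k s'" by (rule k(2))
    show "run ?p (?i, s) (k + 1) (if tst t s' then ?i + clen c + 2 else Suc (?i + clen c), s')" by (rule 2)
  qed (use code in auto)
qed

end

section \<open>The random access machine\<close>

datatype rop = RConst nat nat | RAdd nat nat nat | RSub nat nat nat | RLoad nat nat | RStore nat nat

type_synonym rcom = "(rop, nat \<times> nat) com"

type_synonym rstate = "(nat \<Rightarrow> nat) \<times> (nat \<Rightarrow> nat)"

fun ract :: "rop \<Rightarrow> rstate \<Rightarrow> rstate" where
  "ract (RConst d k) (r, m) = (r(d := k), m)"
| "ract (RAdd d x y) (r, m) = (r(d := r x + r y), m)"
| "ract (RSub d x y) (r, m) = (r(d := r x - r y), m)"
| "ract (RLoad d x) (r, m) = (r(d := m (r x)), m)"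
| "ract (RStore d x) (r, m) = (r, m(r d := r x))"

fun rtst :: "nat \<times> nat \<Rightarrow> rstate \<Rightarrow> bool" where
  "rtst (x, y) (r, m) \<longleftrightarrow> r x < r y"

text \<open>Registers 0 and 1 hold the constants 0 and 1, hence \<open>(0, 1)\<close> is a test that always succeeds.\<close>

fun rok :: "nat \<Rightarrow> rstate \<Rightarrow> bool" where
  "rok B (r, m) \<longleftrightarrow> r 0 = 0 \<and> r 1 = 1 \<and> (\<forall>i. r i < B) \<and> (\<forall>i. m i < B)"

fun rsafe :: "nat \<Rightarrow> rop \<Rightarrow> rstate \<Rightarrow> bool" where
  "rsafe B (RConst d k) (r, m) \<longleftrightarrow> 2 \<le> d \<and> k < B"
| "rsafe B (RAdd d x y) (r, m) \<longleftrightarrow> 2 \<le> d \<and> r x + r y < B"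
| "rsafe B (RSub d x y) (r, m) \<longleftrightarrow> 2 \<le> d"
| "rsafe B (RLoad d x) (r, m) \<longleftrightarrow> 2 \<le> d"
| "rsafe B (RStore d x) (r, m) \<longleftrightarrow> True"

lemma rok_ract: "rok B s \<Longrightarrow> rsafe B a s \<Longrightarrow> rok B (ract a s)"
  by (cases s; cases a) (auto intro: le_less_trans[OF diff_le_self])

global_interpretation ram: machine ract rtst "(0, 1)" "rok B" "rsafe B" for B
proof
  show "rok B s \<Longrightarrow> rtst (0, 1) s" for B s by (cases s) auto
qed (rule rok_ract)

fun seq :: "('a, 't) com list \<Rightarrow> ('a, 't) com" where
  "seq [] = Skip"
| "seq [c] = c"
| "seq (c # cs) = Seq c (seq cs)"

text \<open>Registers: 2--5 hold the base addresses and lengths of the two words, 6--8 the base addresses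
  of the arrays for \<^const>\<open>max_start\<close>, for the previous occurrences of the letters of the
  second word, and for the last occurrences (indexed by letters) in its prefix of length reg 9.\<close>

definition fill_body :: rcom where
  "fill_body = seq [Act (RAdd 12 6 10), Act (RStore 12 14), Act (RAdd 10 10 1)]"

definition fill :: rcom where
  "fill = seq [Act (RAdd 14 5 1), Act (RConst 10 0), Act (RAdd 15 3 1),
     While (10, 15) fill_body]"

text \<open>Each table update first saves the entry that it overwrites. The saved entries are the
  previous occurrences of the letters, and they form the undo log of
  \<open>roll_body\<close>.\<close>

definition scan_body :: rcom where
  "scan_body = seq [Act (RAdd 12 4 9), Act (RLoad 13 12), Act (RAdd 15 8 13), Act (RLoad 11 15),
     Act (RAdd 12 7 9), Act (RStore 12 11), Act (RAdd 9 9 1), Act (RStore 15 9)]"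

definition scan :: rcom where
  "scan = While (9, 5) scan_body"

definition roll_body :: rcom where
  "roll_body = seq [Act (RSub 9 9 1), Act (RAdd 12 4 9), Act (RLoad 13 12), Act (RAdd 12 7 9),
     Act (RLoad 11 12), Act (RAdd 15 8 13), Act (RStore 15 11)]"

definition roll :: rcom where
  "roll = While (18, 9) roll_body"

text \<open>Rows \<open>d\<close> and \<open>Suc d\<close> of the recursion share one array: an old
  entry is read just before the new one, waiting in register 14, replaces it.\<close>

definition descend_before :: rcom where
  "descend_before = seq [Act (RAdd 12 6 10), Act (RLoad 18 12), Act (RStore 12 14), Act (RSub 10 10 1),
     Act (RSub 18 18 1)]"

definition descend_after :: rcom where
  "descend_after = seq [Act (RAdd 12 2 10), Act (RLoad 13 12), Act (RAdd 12 8 13), Act (RLoad 11 12),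
     If (11, 14) (Act (RAdd 14 11 0)) Skip]"

definition descend :: rcom where
  "descend = While (0, 10) (seq [descend_before, roll, descend_after])"

text \<open>The last \<open>roll\<close>, with target 0, empties the table by undoing at most
  \<open>length v\<close> updates, so its cost does not depend on how large the letters are.\<close>

definition pass :: rcom where
  "pass = seq [Act (RConst 9 0), scan, seq [Act (RAdd 14 5 1), Act (RAdd 10 3 0)], descend,
     seq [Act (RStore 6 14), Act (RConst 18 0)], roll]"

fun passes :: "nat \<Rightarrow> rcom" where
  "passes 0 = Skip"
| "passes (Suc d) = Seq (passes d) pass"

definition check :: "nat \<Rightarrow> nat \<Rightarrow> rcom" where
  "check n d = seq [fill, passes n, Act (RLoad d 6)]"

definition init_regs :: rcom where
  "init_regs = seq [Act (RLoad 3 0), Act (RLoad 5 1), Act (RConst 2 2), Act (RAdd 4 2 3), Act (RAdd 6 4 5),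
     Act (RAdd 7 6 3), Act (RAdd 7 7 5), Act (RAdd 7 7 1), Act (RAdd 8 7 3), Act (RAdd 8 8 5)]"

definition swap :: rcom where
  "swap = seq [Act (RAdd 19 2 0), Act (RAdd 2 4 0), Act (RAdd 4 19 0),
     Act (RAdd 19 3 0), Act (RAdd 3 5 0), Act (RAdd 5 19 0)]"

definition decide :: "nat \<Rightarrow> rcom" where
  "decide n = seq [init_regs, check n 16, swap, check n 17, If (0, 16) Skip (Act (RConst 17 0))]"

lemma wp_SeqI:
  assumes "ram.wp B c R s" "\<And>k r m. R k (r, m) \<Longrightarrow> ram.wp B d (\<lambda>k'. Q (k + k')) (r, m)"
  shows "ram.wp B (Seq c d) Q s"
  using assms by (auto intro: ram.wp_mono)

text \<open>The relative order of the two words is left open, so that the locale can be instantiated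
  twice with the words exchanged. The letter table comes last because its extent depends on the
  letters.\<close>

locale ram_check =
  fixes u v :: "nat list" and bu bv bg bp bl B :: nat
  assumes layout: "bu + length u \<le> bg" "bv + length v \<le> bg" "bg + Suc (length u) \<le> bp" "bp + length v \<le> bl"
    and bound: "bl + Suc (length u + length v) < B" "\<forall>a \<in> set u \<union> set v. bl + a < B"
begin

section \<open>Memory predicates and correctness of the RAM subroutines\<close>

definition regs :: "(nat \<Rightarrow> nat) \<Rightarrow> bool" where
  "regs r \<longleftrightarrow> r 0 = 0 \<and> r 1 = 1 \<and> r 2 = bu \<and> r 3 = length u \<and> r 4 = bv \<and> r 5 = length v \<and>
     r 6 = bg \<and> r 7 = bp \<and> r 8 = bl"

definition words :: "(nat \<Rightarrow> nat) \<Rightarrow> bool" where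
  "words m \<longleftrightarrow> (\<forall>i < length u. m (bu + i) = u ! i) \<and> (\<forall>i < length v. m (bv + i) = v ! i)"

text \<open>The condition ranges over all letters, so every cell from \<open>bl\<close> on belongs
  to the table.\<close>

definition lasts :: "(nat \<Rightarrow> nat) \<Rightarrow> nat \<Rightarrow> bool" where
  "lasts m p \<longleftrightarrow> (\<forall>a. m (bl + a) = last_occ a (take p v))"

definition prevs :: "(nat \<Rightarrow> nat) \<Rightarrow> nat \<Rightarrow> bool" where
  "prevs m p \<longleftrightarrow> (\<forall>q < p. m (bp + q) = last_occ (v ! q) (take q v))"

definition starts :: "(nat \<Rightarrow> nat) \<Rightarrow> nat \<Rightarrow> bool" where
  "starts m d \<longleftrightarrow> (\<forall>i \<le> length u. m (bg + i) = max_start v d (drop i u))"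

definition same :: "nat set \<Rightarrow> (nat \<Rightarrow> nat) \<Rightarrow> (nat \<Rightarrow> nat) \<Rightarrow> bool" where
  "same X f g \<longleftrightarrow> (\<forall>x \<in> X. f x = g x)"

lemma regs_same: "same {..8} r' r \<Longrightarrow> regs r' \<longleftrightarrow> regs r"
  by (auto simp: regs_def same_def)

lemma regs_simps [simp]:
  assumes "regs r"
  shows "r 0 = 0" "r (Suc 0) = Suc 0" "r 2 = bu" "r 3 = length u" "r 4 = bv" "r 5 = length v"
    "r 6 = bg" "r 7 = bp" "r 8 = bl"
  using assms by (simp_all add: regs_def)

lemma words_same: "same {..<bg} m' m \<Longrightarrow> words m' \<longleftrightarrow> words m"
  using layout by (auto simp: words_def same_def)

lemma starts_same: "same {bg..<bp} m' m \<Longrightarrow> starts m' d \<longleftrightarrow> starts m d"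
  using layout by (auto simp: starts_def same_def)

lemma prevs_same: "p \<le> length v \<Longrightarrow> same {bp..<bl} m' m \<Longrightarrow> prevs m' p \<longleftrightarrow> prevs m p"
  using layout by (auto simp: prevs_def same_def)

abbreviation keep :: "(nat \<Rightarrow> nat) \<Rightarrow> (nat \<Rightarrow> nat) \<Rightarrow> bool" where
  "keep \<equiv> same ({..8} \<union> {16, 17})"

lemma same_refl [simp]: "same X f f"
  by (simp add: same_def)

lemma same_trans: "same X f g \<Longrightarrow> same X g h \<Longrightarrow> same X f h"
  by (simp add: same_def)

lemma same_mono: "same X f g \<Longrightarrow> Y \<subseteq> X \<Longrightarrow> same Y f g"
  by (auto simp: same_def)

lemma prevs_low: "same {..<bl} m' m \<Longrightarrow> prevs m' (length v) \<longleftrightarrow> prevs m (length v)"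
  by (rule prevs_same) (auto elim: same_mono)

lemma same_upd [simp]: "x \<notin> X \<Longrightarrow> same X (f(x := y)) g \<longleftrightarrow> same X f g"
  by (auto simp: same_def)

lemma lasts_Suc:
  assumes "lasts m p" "p < length v"
  shows "lasts (m(bl + v ! p := Suc p)) (Suc p)"
  using assms by (auto simp: lasts_def take_Suc_conv_app_nth)

lemma lasts_pred:
  assumes "lasts m (Suc p)" "p < length v"
  shows "lasts (m(bl + v ! p := last_occ (v ! p) (take p v))) p"
  using assms by (auto simp: lasts_def take_Suc_conv_app_nth)

lemma lasts_upd [simp]: "x < bl \<Longrightarrow> lasts (m(x := y)) p \<longleftrightarrow> lasts m p"
  by (auto simp: lasts_def)

lemma words_upd [simp]: "bg \<le> x \<Longrightarrow> words (m(x := y)) \<longleftrightarrow> words m"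
  by (intro words_same) simp

lemma prevs_Suc:
  assumes "prevs m p" "p < length v"
  shows "prevs (m(bp + p := last_occ (v ! p) (take p v), bl + a := y)) (Suc p)"
proof -
  have "bp + q \<noteq> bl + a" if "q \<le> p" for q using that assms layout by simp
  then show ?thesis using assms(1) by (auto simp: prevs_def less_Suc_eq)
qed

lemma keep_regs: "keep r' r \<Longrightarrow> regs r \<Longrightarrow> regs r'"
proof -
  assume "keep r' r" "regs r"
  moreover from this(1) have "same {..8} r' r" by (rule same_mono) blast
  ultimately show "regs r'" by (simp only: regs_same)
qed

lemma words_v: "words m \<Longrightarrow> p < length v \<Longrightarrow> m (bv + p) = v ! p"
  by (simp add: words_def)

lemma words_u: "words m \<Longrightarrow> i < length u \<Longrightarrow> m (bu + i) = u ! i"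
  by (simp add: words_def)

lemma lastsD: "lasts m p \<Longrightarrow> m (bl + a) = last_occ a (take p v)"
  by (simp add: lasts_def)

lemma prevsD: "prevs m p \<Longrightarrow> q < p \<Longrightarrow> m (bp + q) = last_occ (v ! q) (take q v)"
  by (simp add: prevs_def)

lemma letter_bound:
  assumes "p < length v" shows "bl + v ! p < B"
  using assms bound(2) by simp

lemma letter_bound_u:
  assumes "i < length u" shows "bl + u ! i < B"
  using assms bound(2) by simp

lemma fill_spec:
  assumes "regs r" "words m" "lasts m 0"
  shows "ram.wp B fill (\<lambda>k (r', m'). k \<le> 5 * length u + 10 \<and> keep r' r \<and> words m' \<and>
    lasts m' 0 \<and> starts m' 0) (r, m)"
proof -
  define P where "P = (\<lambda>n k s. case s of (r', m') \<Rightarrow>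
    n = Suc (length u) - r' 10 \<and> k = 5 * r' 10 \<and> r' 10 \<le> Suc (length u) \<and> r' 14 = Suc (length v) \<and>
    r' 15 = Suc (length u) \<and> keep r' r \<and> words m' \<and> lasts m' 0 \<and>
    (\<forall>i < r' 10. m' (bg + i) = Suc (length v)))"
  have loop: "ram.wp B (While (10, 15) fill_body) (\<lambda>k (r', m'). 0 + k \<le> 5 * length u + 7 \<and>
      keep r' r \<and> words m' \<and> lasts m' 0 \<and> starts m' 0)
    (r(14 := Suc (length v), 10 := 0, 15 := Suc (length u)), m)"
    (is "ram.wp B _ (\<lambda>k. ?Q (0 + k)) ?s")
  proof (rule ram.wp_While_rule)
    show "P (Suc (length u)) 0 ?s" using assms by (simp add: P_def)
  next
    fix n k s assume "P n k s" and t: "rtst (10, 15) s"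
    then obtain r' m' where s: "s = (r', m')" and P: "P n k (r', m')" by (cases s) auto
    then have r': "regs r'" using assms regs_same[of r' r] same_mono[of _ r' r] unfolding P_def by auto
    then show "ram.wp B fill_body (\<lambda>k' s'. \<exists>n' < n. P n' (k + k' + 2) s') s"
      using P t layout bound
      unfolding s P_def fill_body_def by (auto simp: less_Suc_eq)
  next
    fix n k s assume "P n k s" "\<not> rtst (10, 15) s"
    then show "?Q (k + 2) s"
      unfolding P_def starts_def by (cases s) (auto simp: less_Suc_eq_le)
  qed
  have "ram.wp B fill (\<lambda>k (r', m'). k \<le> 5 * length u + 10 \<and> keep r' r \<and> words m' \<and>
    lasts m' 0 \<and> starts m' 0) (r, m)"
    unfolding fill_def using assms bound layout
    by simp (rule ram.wp_mono[OF loop], auto)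
  then show ?thesis .
qed

lemma scan_spec:
  assumes "regs r" "words m" "lasts m 0" "r 9 = 0"
  shows "ram.wp B scan (\<lambda>k (r', m'). k \<le> 10 * length v + 2 \<and> keep r' r \<and>
    r' 9 = length v \<and> words m' \<and> lasts m' (length v) \<and> prevs m' (length v) \<and> same {bg..<bp} m' m) (r, m)" (is "ram.wp B _ ?Q ?s")
proof -
  define P where "P = (\<lambda>n k s. case s of (r', m') \<Rightarrow>
    n = length v - r' 9 \<and> k = 10 * r' 9 \<and> r' 9 \<le> length v \<and> keep r' r \<and> words m' \<and>
    lasts m' (r' 9) \<and> prevs m' (r' 9) \<and> same {bg..<bp} m' m)"
  have loop: "ram.wp B (While (9, 5) scan_body) (\<lambda>k. ?Q (0 + k)) ?s"
  proof (rule ram.wp_While_rule)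
    show "P (length v) 0 ?s" using assms by (simp add: P_def prevs_def)
  next
    fix n k s assume "P n k s" and t: "rtst (9, 5) s"
    then obtain r' m' where s: "s = (r', m')" and P: "P n k (r', m')" by (cases s) auto
    obtain p where p9: "r' 9 = p" by simp
    have r': "regs r'" using assms keep_regs[of r' r] P unfolding P_def by auto
    then have p: "p < length v" using t s by (simp add: p9)
    have c: "m' (bv + p) = v ! p" using P p words_v by (simp add: P_def)
    have x: "m' (bl + v ! p) = last_occ (v ! p) (take p v)"
      using P by (intro lastsD) (simp add: P_def p9)
    have "lasts (m'(bp + p := last_occ (v ! p) (take p v), bl + v ! p := Suc p)) (Suc p)"
      using P p layout by (intro lasts_Suc) (simp_all add: P_def p9)
    moreover have "prevs (m'(bp + p := last_occ (v ! p) (take p v), bl + v ! p := Suc p)) (Suc p)"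
      using P p by (intro prevs_Suc) (simp_all add: P_def p9)
    ultimately show "ram.wp B scan_body (\<lambda>k' s'. \<exists>n' < n. P n' (k + k' + 2) s') s"
      using P p r' c x layout bound letter_bound[OF p]
      unfolding s P_def scan_body_def by (simp add: p9)
  next
    fix n k s assume P: "P n k s" and t: "\<not> rtst (9, 5) s"
    obtain r' m' where s: "s = (r', m')" by (cases s)
    have "regs r'" using assms keep_regs[of r' r] P s unfolding P_def by auto
    then have "r' 9 = length v" using P t s by (auto simp: P_def)
    then show "?Q (k + 2) s" using P unfolding P_def s by simp
  qed
  then show ?thesis by (simp add: scan_def)
qed

text \<open>The time is charged to the decrease of register 9. This lets the caller amortise: apart
  from loop exits, all calls within one descent together cost at most 9 steps per letter of
  \<open>v\<close>.\<close>

lemma roll_spec: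
  assumes "regs r" "words m" "lasts m (r 9)" "prevs m (length v)" "r 9 \<le> length v"
  shows "ram.wp B roll (\<lambda>k (r', m'). k \<le> 9 * (r 9 - r' 9) + 2 \<and> r' 9 = min (r 9) (r 18) \<and>
    same (- {9, 11, 12, 13, 15}) r' r \<and> words m' \<and> lasts m' (r' 9) \<and> same {..<bl} m' m) (r, m)" (is "ram.wp B _ ?Q ?s")
proof -
  define P where "P = (\<lambda>n k s. case s of (r', m') \<Rightarrow>
    n = r' 9 \<and> k + 9 * r' 9 = 9 * r 9 \<and> r' 9 \<le> r 9 \<and> min (r 9) (r 18) \<le> r' 9 \<and>
    same (- {9, 11, 12, 13, 15}) r' r \<and> words m' \<and> lasts m' (r' 9) \<and> same {..<bl} m' m)"
  have keep: "regs r'" "r' 18 = r 18" if "same (- {9, 11, 12, 13, 15}) r' r" for r'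
  proof -
    have "same {..8} r' r" using that by (rule same_mono) auto
    then show "regs r'" using assms(1) by (simp only: regs_same)
    show "r' 18 = r 18" using that by (auto simp: same_def)
  qed
  have loop: "ram.wp B (While (18, 9) roll_body) (\<lambda>k. ?Q (0 + k)) ?s"
  proof (rule ram.wp_While_rule)
    show "P (r 9) 0 ?s" using assms by (simp add: P_def)
  next
    fix n k s assume "P n k s" and t: "rtst (18, 9) s"
    then obtain r' m' where s: "s = (r', m')" and P: "P n k (r', m')" by (cases s) auto
    define p where "p = r' 9 - 1"
    have r': "regs r'" "r' 18 = r 18" using P keep by (auto simp: P_def)
    have p: "r' 9 = Suc p" "p < length v" using t s P assms by (auto simp: p_def P_def)
    have c: "m' (bv + p) = v ! p" using P p words_v by (simp add: P_def)
    have "prevs m' (length v)"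
      using P prevs_low assms by (auto simp: P_def)
    then have x: "m' (bp + p) = last_occ (v ! p) (take p v)" using p by (intro prevsD)
    have "lasts (m'(bl + v ! p := last_occ (v ! p) (take p v))) p"
      using P p by (intro lasts_pred) (simp_all add: P_def)
    then show "ram.wp B roll_body (\<lambda>k' s'. \<exists>n' < n. P n' (k + k' + 2) s') s"
      using P p r' c x t layout bound letter_bound[OF p(2)]
      unfolding s P_def roll_body_def by simp
  next
    fix n k s assume P: "P n k s" and t: "\<not> rtst (18, 9) s"
    then show "?Q (k + 2) s" using keep(2) unfolding P_def by (cases s) auto
  qed
  then show ?thesis by (simp add: roll_def)
qed

lemma descend_before_spec:
  assumes "regs r" "r 10 = Suc i" "i < length u"
  shows "ram.wp B descend_before (\<lambda>k (r', m'). k = 5 \<and> keep r' r \<and> r' 9 = r 9 \<and>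
    r' 10 = i \<and> r' 14 = r 14 \<and> r' 18 = m (bg + Suc i) - 1 \<and> m' = m(bg + Suc i := r 14)) (r, m)"
  using assms layout bound unfolding descend_before_def by simp

lemma descend_after_spec:
  assumes "regs r" "words m" "r 10 = i" "i < length u" "lasts m p" "r 14 \<le> Suc (length v)"
  shows "ram.wp B descend_after (\<lambda>k (r', m'). k \<le> 6 \<and> keep r' r \<and> r' 9 = r 9 \<and>
    r' 10 = r 10 \<and> r' 14 = min (r 14) (last_occ (u ! i) (take p v)) \<and> m' = m) (r, m)"
  using assms(1,3,4,6) layout bound letter_bound_u[OF assms(4)] words_u[OF assms(2,4)] lastsD[OF assms(5), of "u ! i"]
  unfolding descend_after_def by simp

text \<open>The 15 steps per letter of \<open>u\<close> are 5 before the rollback, 2 for leaving its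
  loop, at most 6 after it and 2 for the outer loop; the rollbacks proper add 9 per letter of
  \<open>v\<close> in total.\<close>

lemma descend_spec:
  assumes "regs r" "words m" "lasts m (length v)" "prevs m (length v)" "starts m d"
    and "r 9 = length v" "r 10 = length u" "r 14 = Suc (length v)"
  shows "ram.wp B descend (\<lambda>k (r', m'). k \<le> 15 * length u + 9 * length v + 2 \<and>
    keep r' r \<and> r' 9 \<le> length v \<and> words m' \<and> lasts m' (r' 9) \<and> prevs m' (length v) \<and>
    r' 14 = max_start v (Suc d) u \<and>
    (\<forall>i. 0 < i \<and> i \<le> length u \<longrightarrow> m' (bg + i) = max_start v (Suc d) (drop i u))) (r, m)" (is "ram.wp B _ ?Q ?s")
proof -
  \<comment> \<open>The conjunct on register 9 says that the table still covers the next prefix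
    asked for, so it only ever has to shrink. Array entries beyond the index in register 10 belong
    to row \<open>Suc d\<close>, the others still to row \<open>d\<close>.\<close>
  define P where "P = (\<lambda>n k s. case s of (r', m') \<Rightarrow> n = r' 10 \<and> r' 10 \<le> length u \<and>
    k \<le> 15 * (length u - r' 10) + 9 * (length v - r' 9) \<and>
    keep r' r \<and> r' 9 \<le> length v \<and> words m' \<and> lasts m' (r' 9) \<and> prevs m' (length v) \<and>
    max_start v d (drop (r' 10) u) - 1 \<le> r' 9 \<and> r' 14 = max_start v (Suc d) (drop (r' 10) u) \<and>
    (\<forall>i \<le> r' 10. m' (bg + i) = max_start v d (drop i u)) \<and>
    (\<forall>i. r' 10 < i \<and> i \<le> length u \<longrightarrow> m' (bg + i) = max_start v (Suc d) (drop i u)))"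
  have loop: "ram.wp B (While (0, 10) (seq [descend_before, roll, descend_after])) (\<lambda>k. ?Q (0 + k)) ?s"
  proof (rule ram.wp_While_rule)
    show "P (length u) 0 ?s" using assms by (simp add: P_def starts_def)
  next
    fix n k s assume "P n k s" and t: "rtst (0, 10) s"
    then obtain r1 m1 where s: "s = (r1, m1)" and P: "P n k (r1, m1)" by (cases s) auto
    define i where "i = r1 10 - 1"
    have r1: "regs r1" using P keep_regs assms(1) by (auto simp: P_def)
    then have i: "r1 10 = Suc i" "i < length u" using P t s by (auto simp: P_def i_def)
    define j where "j = max_start v d (drop (Suc i) u) - 1"
    have j: "j \<le> r1 9" "m1 (bg + Suc i) - 1 = j" using P i by (auto simp: P_def j_def)
    have u_i: "drop i u = u ! i # drop (Suc i) u" using i by (simp add: Cons_nth_drop_Suc)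
    have next_cur: "max_start v (Suc d) (drop i u) =
      min (max_start v (Suc d) (drop (Suc i) u)) (last_occ (u ! i) (take j v))"
      by (simp add: u_i j_def)
    show "ram.wp B (seq [descend_before, roll, descend_after]) (\<lambda>k' s'. \<exists>n' < n. P n' (k + k' + 2) s') s"
      unfolding s seq.simps
    proof (rule wp_SeqI[OF descend_before_spec[OF r1 i]], goal_cases)
      case (1 k2 r2 m2)
      then have k2: "k2 = 5" and same2: "keep r2 r1" and r2: "r2 9 = r1 9" "r2 10 = i"
        "r2 14 = r1 14" "r2 18 = j" and m2_def: "m2 = m1(bg + Suc i := r1 14)"
        using j by simp_all
      have regs2: "regs r2" using keep_regs[OF same2 r1] .
      have m2: "words m2" "lasts m2 (r2 9)" "prevs m2 (length v)"
        using P layout i prevs_same[of "length v" m2 m1] r2 by (auto simp: P_def m2_def)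
      show ?case
        unfolding k2
      proof (rule wp_SeqI[OF roll_spec[OF regs2 m2]], goal_cases)
        case 1
        then show ?case using P r2 by (simp add: P_def)
      next
        case (2 k3 r3 m3)
        then have k3: "k3 \<le> 9 * (r1 9 - r3 9) + 2" and r3: "r3 9 = j" and same3: "same (- {9, 11, 12, 13, 15}) r3 r2"
          and m3: "words m3" "lasts m3 j" "same {..<bl} m3 m2"
          using r2 j by auto
        have r3': "r3 10 = i" "r3 14 = r1 14" using same3 r2 by (auto simp: same_def)
        have same3': "keep r3 r2" using same3 by (rule same_mono) auto
        have regs3: "regs r3" using keep_regs[OF same3' regs2] .
        have prevs3: "prevs m3 (length v)"
          using m2 prevs_low[OF m3(3)] by auto
        have mem3: "m3 (bg + l) = (if l = Suc i then r1 14 else m1 (bg + l))" if "l \<le> length u" for l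
          using m3(3) that layout by (auto simp: same_def m2_def)
        have "r3 14 \<le> Suc (length v)" using P max_start_le by (auto simp: P_def r3')
        from descend_after_spec[OF regs3 m3(1) r3'(1) i(2) m3(2) this] show ?case
        proof (rule ram.wp_mono, goal_cases)
          case (1 k4 s4)
          obtain r4 m4 where s4: "s4 = (r4, m4)" by (cases s4)
          have k4: "k4 \<le> 6" and same4: "keep r4 r3" and r4: "r4 9 = j" "r4 10 = i"
            "r4 14 = max_start v (Suc d) (drop i u)" "m4 = m3"
            using 1 r3 r3' P i by (auto simp: s4 next_cur P_def)
          have "P i (k + (5 + (k3 + k4)) + 2) (r4, m4)"
            unfolding P_def prod.case
          proof (intro conjI)
            show "k + (5 + (k3 + k4)) + 2 \<le> 15 * (length u - r4 10) + 9 * (length v - r4 9)"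
            proof -
              have "length u - i = Suc (length u - Suc i)" using i by simp
              moreover have "length v - j = (length v - r1 9) + (r1 9 - j)" using P j by (simp add: P_def)
              moreover have "k \<le> 15 * (length u - Suc i) + 9 * (length v - r1 9)" using P i by (simp add: P_def)
              ultimately show ?thesis using k3 k4 r4 r3 by simp
            qed
            show "keep r4 r"
              using P same4 same3' same2 by (simp add: same_def P_def)
            \<comment> \<open>Monotonicity of the maximal starts: the next prefix asked for is no
              longer than the present one.\<close>
            show "max_start v d (drop (r4 10) u) - 1 \<le> r4 9"
              using max_start_Cons_le[of v d "u ! i" "drop (Suc i) u"] by (simp add: r4 u_i j_def)
            show "\<forall>l \<le> r4 10. m4 (bg + l) = max_start v d (drop l u)"
              using P i by (simp add: r4 mem3 P_def)
            show "\<forall>l. r4 10 < l \<and> l \<le> length u \<longrightarrow> m4 (bg + l) = max_start v (Suc d) (drop l u)"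
              using P i by (simp add: r4 mem3 P_def)
          qed (use i r4 m3 prevs3 P j in \<open>simp_all add: P_def\<close>)
          then show ?case using P i s4 by (auto simp: P_def add.assoc)
        qed
      qed
    qed
  next
    fix n k s assume P: "P n k s" and t: "\<not> rtst (0, 10) s"
    obtain r' m' where s: "s = (r', m')" by (cases s)
    have "regs r'" using assms keep_regs[of r' r] P s unfolding P_def by auto
    then have "r' 10 = 0" using t s by simp
    moreover have "k \<le> 15 * length u + 9 * length v"
    proof -
      have "k \<le> 15 * length u + 9 * (length v - r' 9)" using P s \<open>r' 10 = 0\<close> by (simp add: P_def)
      moreover have "9 * (length v - r' 9) \<le> 9 * length v" by simp
      ultimately show ?thesis by linarith
    qed
    ultimately show "?Q (k + 2) s" using P unfolding P_def s by simp
  qed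
  then show ?thesis by (simp add: descend_def)
qed

text \<open>The factor 28 consists of 10 for \<open>scan\<close>, 9 for the rollbacks during
  \<open>descend\<close> and 9 for the final one.\<close>

lemma pass_spec:
  assumes "regs r" "words m" "lasts m 0" "starts m d"
  shows "ram.wp B pass (\<lambda>k (r', m'). k \<le> 15 * length u + 28 * length v + 20 \<and>
    keep r' r \<and> words m' \<and> lasts m' 0 \<and> starts m' (Suc d)) (r, m)"
  unfolding pass_def seq.simps
proof (rule wp_SeqI[where R = "\<lambda>k (r', m'). k = 1 \<and> keep r' r \<and> r' 9 = 0 \<and> m' = m"], goal_cases)
  case 1
  then show ?case using bound by simp
next
  case (2 k1 r1 m1)
  then have k1: "k1 = 1" and same1: "keep r1 r" and r1: "r1 9 = 0" and m1: "m1 = m" by auto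
  have regs1: "regs r1" using keep_regs[OF same1 assms(1)] .
  show ?case unfolding m1
  proof (rule wp_SeqI[OF scan_spec[OF regs1 assms(2,3) r1]], goal_cases)
    case (1 k2 r2 m2)
    then have k2: "k2 \<le> 10 * length v + 2" and same2: "keep r2 r1" and r2: "r2 9 = length v"
      and m2: "words m2" "lasts m2 (length v)" "prevs m2 (length v)" "same {bg..<bp} m2 m" by auto
    have regs2: "regs r2" using keep_regs[OF same2 regs1] .
    have starts2: "starts m2 d" using starts_same[OF m2(4)] assms(4) by simp
    show ?case
    proof (rule wp_SeqI[where R = "\<lambda>k (r', m'). k = 2 \<and> keep r' r2 \<and> r' 9 = length v \<and>
        r' 10 = length u \<and> r' 14 = Suc (length v) \<and> m' = m2"], goal_cases)
      case 1
      then show ?case using regs2 r2 bound layout by simp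
    next
      case (2 k3 r3 m3)
      then have k3: "k3 = 2" and same3: "keep r3 r2" and r3: "r3 9 = length v"
        "r3 10 = length u" "r3 14 = Suc (length v)" and m3: "m3 = m2" by auto
      have regs3: "regs r3" using keep_regs[OF same3 regs2] .
      show ?case unfolding m3
      proof (rule wp_SeqI[OF descend_spec[OF regs3 m2(1-3) starts2 r3]], goal_cases)
        case (1 k4 r4 m4)
        then have k4: "k4 \<le> 15 * length u + 9 * length v + 2" and same4: "keep r4 r3"
          and r4: "r4 9 \<le> length v" "r4 14 = max_start v (Suc d) u"
          and m4: "words m4" "lasts m4 (r4 9)" "prevs m4 (length v)"
            "\<And>i. 0 < i \<Longrightarrow> i \<le> length u \<Longrightarrow> m4 (bg + i) = max_start v (Suc d) (drop i u)" by auto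
        have regs4: "regs r4" using keep_regs[OF same4 regs3] .
        show ?case
        proof (rule wp_SeqI[where R = "\<lambda>k (r', m'). k = 2 \<and> keep r' r4 \<and> r' 9 = r4 9 \<and>
            r' 18 = 0 \<and> m' = m4(bg := r4 14)"], goal_cases)
          case 1
          then show ?case using regs4 bound layout by simp
        next
          case (2 k5 r5 m5)
          then have k5: "k5 = 2" and same5: "keep r5 r4" and r5: "r5 9 = r4 9" "r5 18 = 0"
            and m5_def: "m5 = m4(bg := r4 14)" by auto
          have regs5: "regs r5" using keep_regs[OF same5 regs4] .
          have m5: "words m5" "lasts m5 (r5 9)" "prevs m5 (length v)"
            using m4 layout prevs_same[of "length v" m5 m4] r5 by (auto simp: m5_def)
          have "m5 (bg + i) = max_start v (Suc d) (drop i u)" if "i \<le> length u" for i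
            using that m4(4)[of i] r4(2) by (cases "i = 0") (simp_all add: m5_def)
          then have starts5: "starts m5 (Suc d)" unfolding starts_def by blast
          have "r5 9 \<le> length v" using r5 r4 by simp
          from roll_spec[OF regs5 m5 this] show ?case
          proof (rule ram.wp_mono, goal_cases)
            case (1 k6 s6)
            obtain r6 m6 where s6: "s6 = (r6, m6)" by (cases s6)
            have k6: "k6 \<le> 9 * (r5 9 - r6 9) + 2" and r6: "r6 9 = 0" and same6: "same (- {9, 11, 12, 13, 15}) r6 r5"
              and m6: "words m6" "lasts m6 (r6 9)" "same {..<bl} m6 m5"
              using 1 r5 by (auto simp: s6)
            have "keep r6 r5" using same6 by (rule same_mono) auto
            then have "keep r6 r"
              using same1 same2 same3 same4 same5 by (simp add: same_def)
            moreover have "starts m6 (Suc d)"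
            proof -
              have "same {bg..<bp} m6 m5" using m6(3) layout by (auto simp: same_def)
              then show ?thesis using starts_same starts5 by simp
            qed
            moreover have "k1 + (k2 + (k3 + (k4 + (k5 + k6)))) \<le> 15 * length u + 28 * length v + 20"
              using k1 k2 k3 k4 k5 k6 r5 r4 r6 by simp
            ultimately show ?case using m6 r6 by (simp add: s6)
          qed
        qed
      qed
    qed
  qed
qed

lemma passes_spec:
  assumes "regs r" "words m" "lasts m 0" "starts m 0"
  shows "ram.wp B (passes d) (\<lambda>k (r', m'). k \<le> d * (15 * length u + 28 * length v + 20) \<and>
    keep r' r \<and> words m' \<and> lasts m' 0 \<and> starts m' d) (r, m)"
proof (induction d)
  case 0
  then show ?case using assms by simp
next
  case (Suc d)
  show ?case
    unfolding passes.simps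
  proof (rule wp_SeqI[OF Suc], goal_cases)
    case (1 k1 r1 m1)
    then have k1: "k1 \<le> d * (15 * length u + 28 * length v + 20)" and same1: "keep r1 r"
      and m1: "words m1" "lasts m1 0" "starts m1 d" by auto
    have "regs r1" using keep_regs[OF same1 assms(1)] .
    from pass_spec[OF this m1] show ?case
    proof (rule ram.wp_mono, goal_cases)
      case (1 k2 s2)
      then show ?case using k1 same1 same_trans[of _ _ r1 r] by (cases s2) (auto simp: same_def)
    qed
  qed
qed

text \<open>Filling row 0 and fetching the result cost no more than one pass, hence the factor
  \<open>Suc n\<close>. Only the output register \<open>q\<close> is exempt from the frame, so the
  result of the other inclusion survives.\<close>

lemma check_spec:
  assumes "regs r" "words m" "lasts m 0" "q = 16 \<or> q = 17"
  shows "ram.wp B (check n q) (\<lambda>k (r', m'). k \<le> Suc n * (15 * length u + 28 * length v + 20) \<and>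
    same ({..8} \<union> {16, 17} - {q}) r' r \<and> r' q = max_start v n u \<and> words m' \<and> lasts m' 0) (r, m)"
  unfolding check_def seq.simps
proof (rule wp_SeqI[OF fill_spec[OF assms(1-3)]], goal_cases)
  case (1 k1 r1 m1)
  then have k1: "k1 \<le> 5 * length u + 10" and same1: "keep r1 r"
    and m1: "words m1" "lasts m1 0" "starts m1 0" by auto
  have regs1: "regs r1" using keep_regs[OF same1 assms(1)] .
  show ?case
  proof (rule wp_SeqI[OF passes_spec[OF regs1 m1, of n]], goal_cases)
    case (1 k2 r2 m2)
    then have k2: "k2 \<le> n * (15 * length u + 28 * length v + 20)" and same2: "keep r2 r1"
      and m2: "words m2" "lasts m2 0" "starts m2 n" by auto
    have regs2: "regs r2" using keep_regs[OF same2 regs1] .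
    have "m2 bg = max_start v n u" using m2(3) by (auto simp: starts_def)
    moreover have "same ({..8} \<union> {16, 17} - {q}) r2 r"
      using same1 same2 by (auto simp: same_def)
    ultimately show ?case
      using regs2 m2 k1 k2 assms(4) by auto
  qed
qed

declare regs_simps [simp del]

end

definition input_mem :: "nat list \<Rightarrow> nat list \<Rightarrow> nat \<Rightarrow> nat" where
  "input_mem u v = (let xs = [length u, length v] @ u @ v in (\<lambda>i. if i < length xs then xs ! i else 0))"

lemma input_mem_simps:
  "input_mem u v 0 = length u" "input_mem u v (Suc 0) = length v"
  "i < length u \<Longrightarrow> input_mem u v (2 + i) = u ! i"
  "i < length v \<Longrightarrow> input_mem u v (2 + length u + i) = v ! i"
  "2 + length u + length v \<le> i \<Longrightarrow> input_mem u v i = 0"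
  by (auto simp: input_mem_def Let_def nth_append)

lemma input_mem_le: "input_mem u v i \<le> max_input (u, v)"
proof -
  have "xs ! i \<le> max_input (u, v)" if "set xs \<subseteq> insert (length u) (insert (length v) (set u \<union> set v))" "i < length xs" for xs
  proof -
    have "xs ! i \<in> insert (length u) (insert (length v) (set u \<union> set v))" using that nth_mem by blast
    moreover have "length u + length v \<le> max_input (u, v)" "\<And>x. x \<in> set u \<union> set v \<Longrightarrow> x \<le> max_input (u, v)"
      by (auto simp: max_input_def)
    ultimately show ?thesis by fastforce
  qed
  from this[of "[length u, length v] @ u @ v"] show ?thesis
    by (auto simp: input_mem_def Let_def simp del: append_Cons)
qed

lemma decide_spec:
  fixes u v :: "nat list"
  defines "N \<equiv> length u + length v"
  assumes B: "4 * N + 4 < B" "\<forall>a \<in> set u \<union> set v. 3 * N + 3 + a < B"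
  shows "ram.wp B (decide n) (\<lambda>k s. k \<le> Suc n * (43 * N + 40) + 20 \<and>
    (rtst (0, 17) s \<longleftrightarrow> subwords n u = subwords n v)) ((\<lambda>_. 0)(1 := 1), input_mem u v)"
proof -
  \<comment> \<open>The input words stay in place from cell 2 on. The arrays get
    \<open>N + 1\<close> and \<open>N\<close> cells, enough for either word, so the same base
    addresses serve both inclusions.\<close>
  interpret c1: ram_check u v 2 "2 + length u" "2 + N" "2 * N + 3" "3 * N + 3" B
    using B by unfold_locales (auto simp: N_def)
  interpret c2: ram_check v u "2 + length u" 2 "2 + N" "2 * N + 3" "3 * N + 3" B
    using B by unfold_locales (auto simp: N_def)
  let ?m = "input_mem u v"
  show ?thesis
    unfolding decide_def seq.simps
  proof (rule wp_SeqI[where R = "\<lambda>k (r', m'). k = 10 \<and> c1.regs r' \<and> m' = ?m"], goal_cases)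
    case 1
    then show ?case
      using B unfolding init_regs_def c1.regs_def by (simp add: input_mem_simps N_def)
  next
    case (2 k1 r1 m1)
    then have k1: "k1 = 10" and regs1: "c1.regs r1" and m1: "m1 = ?m" by auto
    have words1: "c1.words ?m" by (auto simp: c1.words_def input_mem_simps simp del: add_2_eq_Suc)
    have lasts1: "c1.lasts ?m 0" unfolding c1.lasts_def by (auto simp: input_mem_simps N_def)
    show ?case unfolding m1
    proof (rule wp_SeqI[OF c1.check_spec[OF regs1 words1 lasts1, of 16 n]], goal_cases)
      case 1
      then show ?case by simp
    next
      case (2 k2 r2 m2)
      then have k2: "k2 \<le> Suc n * (15 * length u + 28 * length v + 20)"
        and same2: "c1.same ({..8} \<union> {16, 17} - {16}) r2 r1" and r2: "r2 16 = max_start v n u"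
        and m2: "c1.words m2" "c1.lasts m2 0" by auto
      have "c1.same {..8} r2 r1" using same2 by (rule c1.same_mono) auto
      then have "c1.regs r2" using regs1 by (simp only: c1.regs_same)
      note regs2_simps = c1.regs_simps[OF this]
      show ?case
      proof (rule wp_SeqI[where R = "\<lambda>k (r', m'). k = 6 \<and> c2.regs r' \<and> r' 16 = r2 16 \<and> m' = m2"], goal_cases)
        case 1
        then show ?case
          using regs2_simps B unfolding swap_def c2.regs_def by (simp add: N_def)
      next
        case (2 k3 r3 m3)
        then have k3: "k3 = 6" and regs3: "c2.regs r3" and r3: "r3 16 = max_start v n u" and m3: "m3 = m2"
          using r2 by auto
        have words3: "c2.words m2" using m2(1) unfolding c1.words_def c2.words_def by blast
        \<comment> \<open>The table of the empty prefix is all zeros, whichever word it refers to,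
          so the cleared memory can be used for the second inclusion at once.\<close>
        have lasts3: "c2.lasts m2 0" using m2(2) unfolding c1.lasts_def c2.lasts_def by simp
        show ?case unfolding m3
        proof (rule wp_SeqI[OF c2.check_spec[OF regs3 words3 lasts3, of 17 n]], goal_cases)
          case 1
          then show ?case by simp
        next
          case (2 k4 r4 m4)
          then have k4: "k4 \<le> Suc n * (15 * length v + 28 * length u + 20)"
            and same4: "c2.same ({..8} \<union> {16, 17} - {17}) r4 r3" and r4: "r4 17 = max_start u n v" by auto
          have "c2.same {..8} r4 r3" using same4 by (rule c2.same_mono) auto
          then have "c2.regs r4" using regs3 by (simp only: c2.regs_same)
          then have r4_0: "r4 0 = 0" by (rule c2.regs_simps)
          have r4_16: "r4 16 = max_start v n u" using same4 r3 by (simp add: c2.same_def)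
          have "subwords n u = subwords n v \<longleftrightarrow> 0 < max_start v n u \<and> 0 < max_start u n v"
            unfolding set_eq_subset subwords_subset_iff_max_start ..
          moreover have "k1 + (k2 + (k3 + (k4 + 3))) \<le> Suc n * (43 * N + 40) + 20"
            using k1 k2 k3 k4 by (simp add: N_def algebra_simps)
          ultimately show ?case using r4 r4_0 r4_16 B by auto
        qed
      qed
    qed
  qed
qed

section \<open>Translation to RAM instructions and the time bound\<close>

fun to_instr :: "(rop, nat \<times> nat) ins \<Rightarrow> instr" where
  "to_instr (IAct (RConst d k)) = Const d k"
| "to_instr (IAct (RAdd d x y)) = Add d x y"
| "to_instr (IAct (RSub d x y)) = Sub d x y"
| "to_instr (IAct (RLoad d x)) = Load d x"
| "to_instr (IAct (RStore d x)) = Store d x"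
| "to_instr (IBr (x, y) l) = JumpLess x y l"
| "to_instr (IHalt b) = Halt b"

fun to_config :: "nat \<times> rstate \<Rightarrow> ram_config" where
  "to_config (i, (r, m)) = \<lparr>pc = i, reg = r, mem = m\<rparr>"

lemma ram_step_to_config: "ram_step (map to_instr p) (to_config c) = to_config (ram.step p c)"
proof -
  obtain i r m where c: "c = (i, (r, m))" by (metis surj_pair)
  show ?thesis
  proof (cases "i < length p")
    case True
    then show ?thesis
      by (cases "p ! i" rule: to_instr.cases) (auto simp: c ram_step_def ram.step_def)
  next
    case False
    then show ?thesis by (simp add: c ram_step_def ram.step_def)
  qed
qed

lemma ram_run_to_config: "ram_run (map to_instr p) t (to_config c) = to_config ((ram.step p ^^ t) c)"
  by (induction t) (simp_all add: ram_run_def ram_step_to_config)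

theorem styl_linearithmic: "decidable_in_linearithmic_time (Check_Id (styl n))"
proof -
  \<comment> \<open>Register 1 starts as 0; the prelude loads the constant that makes the test
    \<open>(0, 1)\<close> succeed.\<close>
  define p where "p = machine.program (0, 1) [IAct (RConst 1 1)] (decide n) (0, 17)"
  let ?R = "\<lambda>e t. ram_run (map to_instr p) t (ram_init e)"
  \<comment> \<open>Two steps more than the bound for \<open>decide\<close>: the prelude and the
    final branch.\<close>
  define T where "T = (\<lambda>l. Suc n * (43 * l + 40) + 22)"
  have main: "\<exists>t \<le> T (identity_size e). ram_halts_with (map to_instr p) (?R e t) (e \<in> Check_Id (styl n)) \<and>
    (\<forall>t i. reg (?R e t) i < (max_input e + 2) ^ 3 \<and>
           mem (?R e t) i < (max_input e + 2) ^ 3)" for e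
  proof -
    obtain u v where e: "e = (u, v)" by (cases e)
    define M where "M = max_input e"
    \<comment> \<open>The program needs bounds of about \<open>4 * M\<close>, coming from the letter
      table, and the cube is at least \<open>4 * (M + 2)\<close>.\<close>
    define B where "B = (M + 2) ^ 3"
    have M: "length u + length v \<le> M" "\<And>a. a \<in> set u \<union> set v \<Longrightarrow> a \<le> M"
      by (auto simp: M_def e max_input_def)
    have "4 * (M + 2) \<le> (M + 2) ^ 3"
    proof -
      have "2 * 2 * (M + 2) \<le> (M + 2) * (M + 2) * (M + 2)" by (intro mult_mono) auto
      then show ?thesis by (simp only: power3_eq_cube)
    qed
    then have B: "4 * M + 8 \<le> B" by (simp add: B_def)
    let ?s = "((\<lambda>_. 0)(1 := 1), input_mem u v)"
    have mem_B: "input_mem u v i < B" for i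
      using input_mem_le[of u v i] B by (simp add: M_def e)
    have rok: "rok B ?s" using mem_B B by simp
    have "4 * (length u + length v) + 4 < B" using M(1) B by simp
    moreover have "\<forall>a \<in> set u \<union> set v. 3 * (length u + length v) + 3 + a < B"
    proof
      fix a assume "a \<in> set u \<union> set v"
      then show "3 * (length u + length v) + 3 + a < B" using M B by fastforce
    qed
    ultimately have "ram.wp B (decide n) (\<lambda>k s. k \<le> Suc n * (43 * (length u + length v) + 40) + 20 \<and>
      (rtst (0, 17) s \<longleftrightarrow> subwords n u = subwords n v)) ?s"
      by (rule decide_spec)
    from ram.program_run[OF this rok, of "[IAct (RConst 1 1)]" "(0, 17)", folded p_def, unfolded list.size add_0]
    obtain k s' i where k: "k \<le> Suc n * (43 * (length u + length v) + 40) + 20"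
      and s': "rtst (0, 17) s' \<longleftrightarrow> subwords n u = subwords n v"
      and run: "ram.run B p (Suc 0, ?s) (k + 1) (i, s')"
      and halt: "i < length p" "p ! i = IHalt (rtst (0, 17) s')"
      by blast
    have init: "ram_init e = to_config (0, (\<lambda>_. 0, input_mem u v))"
      by (simp add: ram_init_def e input_mem_def Let_def)
    have first: "ram.step p (0, (\<lambda>_. 0, input_mem u v)) = (Suc 0, ?s)"
      unfolding p_def ram.program_def by (simp add: ram.step_def)
    define c where "c = (\<lambda>t. (ram.step p ^^ t) (0, (\<lambda>_. 0, input_mem u v)))"
    have c_Suc: "c (Suc t) = (ram.step p ^^ t) (Suc 0, ?s)" for t
      by (simp add: c_def first funpow_swap1)
    have c_end: "c (Suc (k + 1)) = (i, s')" using run unfolding c_Suc ram.run_def by blast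
    have c_stay: "c (Suc (k + 1) + j) = (i, s')" for j
    proof (induction j)
      case 0
      then show ?case using c_end by simp
    next
      case (Suc j)
      have "c (Suc (k + 1) + Suc j) = ram.step p (c (Suc (k + 1) + j))" by (simp add: c_def)
      also have "\<dots> = (i, s')" unfolding Suc using halt by (simp add: ram.step_def)
      finally show ?case .
    qed
    have bounded: "fst (snd (c t)) j < B \<and> snd (snd (c t)) j < B" for t j
    proof -
      \<comment> \<open>Three phases: before the prelude, when register 1 is still 0 and
        \<open>rok\<close> fails; during the run, where \<open>rok\<close> holds throughout; after
        halting, when nothing changes any more.\<close>
      have "t = 0 \<or> (\<exists>t'. t = Suc t' \<and> t' \<le> k + 1) \<or> (\<exists>j. t = Suc (k + 1) + j)" by presburger
      then consider "t = 0" | t' where "t = Suc t'" "t' \<le> k + 1" | j where "t = Suc (k + 1) + j" by blast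
      then show ?thesis
      proof cases
        case 1
        then show ?thesis using mem_B B by (simp add: c_def)
      next
        case (2 t')
        have "rok B (snd (c t))" using run 2(2) unfolding 2(1) c_Suc ram.run_def by blast
        then show ?thesis by (cases "snd (c t)") auto
      next
        case (3 j')
        then have "c t = (i, s')" using c_stay by blast
        moreover have "rok B s'" using ram.run_ok[OF run] by simp
        ultimately show ?thesis by (cases s') auto
      qed
    qed
    have run_c: "?R e t = to_config (c t)" for t
      unfolding init ram_run_to_config c_def ..
    have "e \<in> Check_Id (styl n) \<longleftrightarrow> rtst (0, 17) s'" unfolding e Check_Id_styl s' ..
    then have "ram_halts_with (map to_instr p) (?R e (Suc (k + 1))) (e \<in> Check_Id (styl n))"
      unfolding run_c c_end ram_halts_with_def using halt by (cases s') simp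
    moreover have "Suc (k + 1) \<le> T (identity_size e)" using k by (simp add: T_def identity_size_def e)
    moreover have "reg (to_config x) j = fst (snd x) j" "mem (to_config x) j = snd (snd x) j" for x j
      by (cases x rule: to_config.cases; simp)+
    ultimately show ?thesis using bounded unfolding run_c B_def M_def by auto
  qed
  have "ram_decides_in_time (map to_instr p) (Check_Id (styl n)) T"
    unfolding ram_decides_in_time_def
  proof (intro conjI allI)
    show "\<exists>t \<le> T (identity_size e). ram_halts_with (map to_instr p) (?R e t) (e \<in> Check_Id (styl n))" for e
      using main[of e] by blast
    show "\<exists>K. \<forall>e t i. reg (?R e t) i < (max_input e + 2) ^ K \<and>
      mem (?R e t) i < (max_input e + 2) ^ K"
      using main by blast
  qed
  moreover have "(\<lambda>l. real (T l)) \<in> O(\<lambda>l. real l * ln (real l))"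
  proof (rule bigoI)
    show "\<forall>\<^sub>F l in sequentially. norm (real (T l)) \<le> real (Suc n * 83 + 22) * norm (real l * ln (real l))"
      using eventually_ge_at_top[of 3]
    proof eventually_elim
      case (elim l)
      \<comment> \<open>The running time is linear. From \<open>l = 3\<close> on,
        \<open>ln l\<close> is at least 1 and may be added as a factor.\<close>
      have "exp 1 \<le> real l" using exp_le elim by linarith
      then have "1 \<le> ln (real l)" using elim by (subst ln_ge_iff) auto
      have "T l \<le> (Suc n * 83 + 22) * l"
      proof -
        have "Suc n * (43 * l + 40) \<le> Suc n * (83 * l)" using elim by (intro mult_left_mono) auto
        moreover have "22 \<le> 22 * l" using elim by simp
        ultimately show ?thesis by (simp add: T_def algebra_simps)
      qed
      then have "real (T l) \<le> real (Suc n * 83 + 22) * real l" by (metis of_nat_le_iff of_nat_mult)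
      also have "\<dots> \<le> real (Suc n * 83 + 22) * (real l * ln (real l))"
        using \<open>1 \<le> ln (real l)\<close> by (intro mult_left_mono) (auto simp: mult_le_cancel_left1)
      finally show ?case using \<open>1 \<le> ln (real l)\<close> by simp
    qed
  qed
  ultimately show ?thesis unfolding decidable_in_linearithmic_time_def by blast
qed

section \<open>Turing machines running structured programs\<close>

text \<open>Up to the first hit the values are pairwise distinct: a repetition at
  \<open>i < j\<close> could be cut out and would give an earlier hit. So the first hit needs at
  most \<open>card S\<close> steps, however large \<open>t\<close> is.\<close>

lemma funpow_reaches_within_card:
  fixes f :: "'a \<Rightarrow> 'a"
  assumes "finite S" "H ((f ^^ t) c)" "\<And>i. i \<le> t \<Longrightarrow> (f ^^ i) c \<in> S"
  shows "\<exists>t' \<le> card S. H ((f ^^ t') c)"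
proof -
  define l where "l = (LEAST t. H ((f ^^ t) c))"
  have l: "H ((f ^^ l) c)" "l \<le> t"
    unfolding l_def using assms(2) by (rule LeastI, rule Least_le)
  have not_before: "\<not> H ((f ^^ i) c)" if "i < l" for i
    using not_less_Least[OF that[unfolded l_def]] .
  have "inj_on (\<lambda>i. (f ^^ i) c) {..<l}"
  proof (rule linorder_inj_onI)
    fix i j assume ij: "i < j" "i \<in> {..<l}" "j \<in> {..<l}"
    show "(f ^^ i) c \<noteq> (f ^^ j) c"
    proof
      assume eq: "(f ^^ i) c = (f ^^ j) c"
      have "(f ^^ (l - j + i)) c = (f ^^ (l - j)) ((f ^^ j) c)"
        unfolding funpow_add using eq by simp
      also have "\<dots> = (f ^^ (l - j + j)) c" unfolding funpow_add by simp
      also have "\<dots> = (f ^^ l) c" using ij by simp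
      finally have "H ((f ^^ (l - j + i)) c)" using l(1) by simp
      moreover have "l - j + i < l" using ij by auto
      ultimately show False using not_before by blast
    qed
  qed auto
  moreover have "(\<lambda>i. (f ^^ i) c) ` {..<l} \<subseteq> S" using assms(3) l(2) by auto
  ultimately have "card {..<l} \<le> card S" using card_inj_on_le assms(1) by blast
  then show ?thesis using l(1) by auto
qed

text \<open>Two input bits become one symbol: 1 and 2 are the bits of a variable, 3 is the end of a
  variable and 4 the separator.\<close>

definition pack :: "nat \<Rightarrow> nat \<Rightarrow> nat" where
  "pack a b = (if a = 2 then (if b = 2 then 2 else 1) else (if b = 2 then 4 else 3))"

text \<open>States: 0, 1, 2 before and 3, 4, 5 after the separator, at the start of a variable, after a
  bit 0 and after a bit 1; 6 rejects.\<close>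

definition dfa :: "nat \<Rightarrow> nat \<Rightarrow> nat" where
  "dfa q c =
    (if c = 1 then (if q < 3 then 1 else if q < 6 then 4 else 6)
     else if c = 2 then (if q < 3 then 2 else if q < 6 then 5 else 6)
     else if c = 3 then (if q = 0 \<or> q = 2 then 0 else if q = 3 \<or> q = 5 then 3 else 6)
     else (if q = 0 then 3 else 6))"

lemma pack_less: "pack a b < 7"
  by (simp add: pack_def)

lemma dfa_less: "dfa q c < 7"
  by (simp add: dfa_def)

record tstate =
  ih :: int
  ct :: "nat \<Rightarrow> int \<Rightarrow> nat"
  hs :: "nat \<Rightarrow> int"
  fl :: "nat \<Rightarrow> nat"

text \<open>The tapes are the input tape, data tapes \<open>0, \<dots>, n\<close> and six tapes of which only one cell is used,
  each serving as a variable with a finite range.\<close>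

datatype tact = ReadBit | AppendSymbol | MoveL nat | MoveR nat | SetF nat nat

type_synonym ttest = "nat \<Rightarrow> (nat \<Rightarrow> nat) \<Rightarrow> (nat \<Rightarrow> nat) \<Rightarrow> bool"

type_synonym tcom = "(tact, ttest) com"

definition isym :: "bool list \<Rightarrow> tstate \<Rightarrow> nat" where
  "isym x s = snd (input_tape x) (ih s)"

definition sym :: "tstate \<Rightarrow> nat \<Rightarrow> nat" where
  "sym s i = ct s i (hs s i)"

text \<open>Copying writes the same symbol on all data tapes. Flag 0 keeps the first bit of a pair,
  flag 1 the state of the automaton; a pair cut off by the end of the input sends the latter to the
  rejecting state 6.\<close>

fun do_act :: "bool list \<Rightarrow> tact \<Rightarrow> tstate \<Rightarrow> tstate" where
  "do_act x ReadBit s = s\<lparr>ih := ih s + 1, fl := (fl s)(0 := isym x s)\<rparr>"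
| "do_act x AppendSymbol s = s\<lparr>ih := ih s + 1, ct := (\<lambda>i. (ct s i)(hs s i := pack (fl s 0) (isym x s))),
     hs := (\<lambda>i. hs s i + 1),
     fl := (fl s)(1 := if isym x s = 0 then 6 else dfa (fl s 1) (pack (fl s 0) (isym x s)))\<rparr>"
| "do_act x (MoveL i) s = s\<lparr>hs := (hs s)(i := hs s i - 1)\<rparr>"
| "do_act x (MoveR i) s = s\<lparr>hs := (hs s)(i := hs s i + 1)\<rparr>"
| "do_act x (SetF k v) s = s\<lparr>fl := (fl s)(k := min v 6)\<rparr>"

definition ttst :: "bool list \<Rightarrow> nat \<Rightarrow> ttest \<Rightarrow> tstate \<Rightarrow> bool" where
  "ttst x n t s = t (isym x s) (\<lambda>i. if i \<le> n then sym s i else 0) (\<lambda>k. if k < 6 then fl s k else 0)"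

definition cell :: "nat list \<Rightarrow> int \<Rightarrow> nat" where
  "cell cs i = (if 0 \<le> i \<and> i < int (length cs) then cs ! nat i else 0)"

lemma cell_Nil: "cell [] = (\<lambda>_. 0)"
  by (auto simp: cell_def)

definition bit_code :: "bool \<Rightarrow> nat" where
  "bit_code b = (if b then 2 else 1)"

fun pairs :: "bool list \<Rightarrow> nat list" where
  "pairs [] = []"
| "pairs [a] = [pack (bit_code a) 0]"
| "pairs (a # b # xs) = pack (bit_code a) (bit_code b) # pairs xs"

fun dfa_run :: "nat \<Rightarrow> bool list \<Rightarrow> nat" where
  "dfa_run q [] = q"
| "dfa_run q [a] = 6"
| "dfa_run q (a # b # xs) = dfa_run (dfa q (pack (bit_code a) (bit_code b))) xs"

text \<open>All data tapes carry the same prefix of \<open>pairs x\<close>, described by one number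
  \<open>j\<close>; this keeps the number of configurations polynomial. Heads may visit the blank at
  \<open>- 1\<close> when rewinding, and on an input of odd length the input head passes the first
  blank.\<close>

definition tok :: "bool list \<Rightarrow> tstate \<Rightarrow> bool" where
  "tok x s \<longleftrightarrow> 0 \<le> ih s \<and> ih s \<le> int (length x) + 1 \<and>
     (\<exists>j \<le> length (pairs x). ct s = (\<lambda>_. cell (take j (pairs x)))) \<and>
     (\<forall>i. - 1 \<le> hs s i \<and> hs s i \<le> int (length (pairs x))) \<and> (\<forall>k. fl s k < 7)"

fun tsafe :: "bool list \<Rightarrow> tact \<Rightarrow> tstate \<Rightarrow> bool" where
  "tsafe x (MoveL i) s \<longleftrightarrow> 0 \<le> hs s i"
| "tsafe x (MoveR i) s \<longleftrightarrow> hs s i < int (length (pairs x))"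
| "tsafe x (SetF k v) s \<longleftrightarrow> True"
| "tsafe x a s \<longleftrightarrow> tok x (do_act x a s)"

abbreviation always :: ttest where
  "always \<equiv> (\<lambda>_ _ _. True)"

global_interpretation tmm: machine "do_act x" "ttst x n" always "tok x" "tsafe x" for x n
proof
  show "ttst x n always s" for x n s by (simp add: ttst_def)
  show "tok x s \<Longrightarrow> tsafe x a s \<Longrightarrow> tok x (do_act x a s)" for x a s
    by (cases a) (auto simp: tok_def, (smt (verit))+)
qed

text \<open>States 1 and 2 are reserved for the answers, so address 0 keeps its number and the
  others are shifted by 2.\<close>

definition tm_state :: "(tact, ttest) ins list \<Rightarrow> nat \<Rightarrow> nat" where
  "tm_state p i = (if i < length p then
     (case p ! i of IHalt b \<Rightarrow> (if b then 1 else 2) | _ \<Rightarrow> (if i = 0 then 0 else i + 2)) else 1)"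

lemma tm_state_less: "tm_state p i < length p + 3"
  by (auto simp: tm_state_def split: ins.splits)

definition tm_conf :: "nat \<Rightarrow> bool list \<Rightarrow> (tact, ttest) ins list \<Rightarrow> nat \<times> tstate \<Rightarrow> tm_config" where
  "tm_conf n x p = (\<lambda>(i, s). (tm_state p i, (ih s, snd (input_tape x)) #
     map (\<lambda>i. (hs s i, ct s i)) [0..<Suc n] @ map (\<lambda>k. (0, (\<lambda>_. 0)(0 := fl s k))) [0..<6]))"

fun writes :: "nat \<Rightarrow> tact \<Rightarrow> nat \<Rightarrow> (nat \<Rightarrow> nat) \<Rightarrow> (nat \<Rightarrow> nat) \<Rightarrow> (nat \<times> move) list" where
  "writes n ReadBit b d g = (b, MoveRight) # map (\<lambda>i. (d i, Stay)) [0..<Suc n] @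
     map (\<lambda>k. (if k = 0 then b else g k, Stay)) [0..<6]"
| "writes n AppendSymbol b d g = (b, MoveRight) # map (\<lambda>i. (pack (g 0) b, MoveRight)) [0..<Suc n] @
     map (\<lambda>k. (if k = 1 then (if b = 0 then 6 else dfa (g 1) (pack (g 0) b)) else g k, Stay)) [0..<6]"
| "writes n (MoveL j) b d g = (b, Stay) # map (\<lambda>i. (d i, if i = j then MoveLeft else Stay)) [0..<Suc n] @
     map (\<lambda>k. (g k, Stay)) [0..<6]"
| "writes n (MoveR j) b d g = (b, Stay) # map (\<lambda>i. (d i, if i = j then MoveRight else Stay)) [0..<Suc n] @
     map (\<lambda>k. (g k, Stay)) [0..<6]"
| "writes n (SetF j v) b d g = (b, Stay) # map (\<lambda>i. (d i, Stay)) [0..<Suc n] @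
     map (\<lambda>k. (if k = j then min v 6 else g k, Stay)) [0..<6]"

definition tm_delta :: "nat \<Rightarrow> (tact, ttest) ins list \<Rightarrow> nat \<Rightarrow> nat list \<Rightarrow> nat \<times> (nat \<times> move) list" where
  "tm_delta n p q ss =
    (let i = (if q = 0 then 0 else q - 2); b = ss ! 0;
         d = (\<lambda>i. if i \<le> n then ss ! (i + 1) else 0); g = (\<lambda>k. if k < 6 then ss ! (n + 2 + k) else 0)
     in case p ! i of
          IAct a \<Rightarrow> (tm_state p (Suc i), writes n a b d g)
        | IBr t l \<Rightarrow> (tm_state p (if t b d g then l else Suc i), map (\<lambda>c. (c, Stay)) ss)
        | IHalt b \<Rightarrow> (1, map (\<lambda>c. (c, Stay)) ss))"

definition tm_of :: "nat \<Rightarrow> (tact, ttest) ins list \<Rightarrow> tm" where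
  "tm_of n p = \<lparr>tapes = n + 8, states = length p + 3, symbols = 7, delta = tm_delta n p\<rparr>"

lemma writes_wf:
  assumes "b < 7" "\<And>i. i \<le> n \<Longrightarrow> d i < 7" "\<And>k. k < 6 \<Longrightarrow> g k < 7"
  shows "length (writes n a b d g) = n + 8" "\<forall>(s, m) \<in> set (writes n a b d g). s < 7"
proof -
  show "length (writes n a b d g) = n + 8" by (cases a) auto
  have w: "\<forall>(s, m) \<in> set (y # map e [0..<Suc n] @ map h [0..<6]). s < 7"
    if "fst y < 7" "\<And>i. i \<le> n \<Longrightarrow> fst (e i) < 7" "\<And>k. k < 6 \<Longrightarrow> fst (h k) < 7"
    for y :: "nat \<times> move" and e h :: "nat \<Rightarrow> nat \<times> move"
  proof
    fix z assume "z \<in> set (y # map e [0..<Suc n] @ map h [0..<6])"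
    then consider "z = y" | i where "i \<le> n" "z = e i" | k where "k < 6" "z = h k"
      by (auto simp: less_Suc_eq_le simp del: upt_Suc)
    then have "fst z < 7" using that by cases auto
    then show "case z of (s, m) \<Rightarrow> s < 7" by (cases z) simp
  qed
  show "\<forall>(s, m) \<in> set (writes n a b d g). s < 7"
    by (cases a) (simp_all only: writes.simps, (rule w; use assms in \<open>simp add: pack_less dfa_less min_less_iff_disj\<close>)+)
qed

text \<open>\<open>wf_tm\<close> quantifies over all states, so every possible value of
  \<open>p ! i\<close> is treated, a halt included.\<close>

lemma wf_tm_of: "wf_tm (tm_of n p)"
proof -
  have "case tm_delta n p q ss of (q', as) \<Rightarrow>
      q' < length p + 3 \<and> length as = n + 8 \<and> (\<forall>(s, d) \<in> set as. s < 7)"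
    if ss: "length ss = n + 8" "\<forall>s \<in> set ss. s < 7" for q ss
  proof -
    have less: "ss ! i < 7" if "i < n + 8" for i using that ss by auto
    define d where "d = (\<lambda>i. if i \<le> n then ss ! (i + 1) else 0)"
    define g where "g = (\<lambda>k. if k < 6 then ss ! (n + 2 + k) else 0)"
    have dg: "ss ! 0 < 7" "\<And>i. i \<le> n \<Longrightarrow> d i < 7" "\<And>k. k < 6 \<Longrightarrow> g k < 7"
      using less by (auto simp: d_def g_def)
    have stay: "\<forall>(s, d) \<in> set (map (\<lambda>c. (c, Stay)) ss). s < 7" using ss by auto
    define i where "i = (if q = 0 then 0 else q - 2)"
    show ?thesis
    proof (cases "p ! i")
      case (IAct a)
      then have "tm_delta n p q ss = (tm_state p (Suc i), writes n a (ss ! 0) d g)"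
        by (simp add: tm_delta_def Let_def i_def d_def g_def)
      then show ?thesis using writes_wf[OF dg] tm_state_less by simp
    next
      case (IBr t l)
      then have "tm_delta n p q ss = (tm_state p (if t (ss ! 0) d g then l else Suc i), map (\<lambda>c. (c, Stay)) ss)"
        by (simp add: tm_delta_def Let_def i_def d_def g_def)
      then show ?thesis using stay ss(1) tm_state_less by (simp only: prod.case length_map simp_thms)
    next
      case (IHalt b)
      then have "tm_delta n p q ss = (1, map (\<lambda>c. (c, Stay)) ss)"
        by (simp add: tm_delta_def Let_def i_def)
      then show ?thesis using stay ss(1) by simp
    qed
  qed
  then show ?thesis unfolding wf_tm_def tm_of_def by simp
qed

lemma map2_tapes:
  "map2 f (y # map e xs @ map h ys) (y' # map e' xs @ map h' ys)
    = f y y' # map (\<lambda>i. f (e i) (e' i)) xs @ map (\<lambda>k. f (h k) (h' k)) ys"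
  by (simp add: zip_map_map map_zip_map map_zip_map2 zip_same_conv_map)

text \<open>An exact simulation, one machine step per program step, so that invariants of program
  states hold in all machine configurations.\<close>

lemma tm_step_conf:
  "tm_step (tm_of n p) (tm_conf n x p c) = tm_conf n x p (tmm.step x n p c)"
proof -
  obtain i s where c: "c = (i, s)" by (cases c)
  define T where "T = (ih s, snd (input_tape x)) #
     map (\<lambda>i. (hs s i, ct s i)) [0..<Suc n] @ map (\<lambda>k. (0 :: int, (\<lambda>_. 0 :: nat)(0 := fl s k))) [0..<6]"
  define ss where "ss = map (\<lambda>(h, f). f h) T"
  have ss: "ss = isym x s # map (sym s) [0..<Suc n] @ map (fl s) [0..<6]"
    by (simp add: ss_def T_def isym_def sym_def)
  have ss0: "ss ! 0 = isym x s" by (simp add: ss)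
  have ss1: "ss ! (i + 1) = sym s i" if "i \<le> n" for i
    using that unfolding ss by (simp add: nth_append del: upt_Suc)
  have ss2: "ss ! (n + 2 + k) = fl s k" if "k < 6" for k
    using that unfolding ss by (simp add: nth_append del: upt_Suc)
  define d where "d = (\<lambda>i. if i \<le> n then sym s i else 0)"
  define g where "g = (\<lambda>k. if k < 6 then fl s k else 0)"
  have d: "(\<lambda>i. if i \<le> n then ss ! (i + 1) else 0) = d" using ss1 by (auto simp: d_def)
  have g: "(\<lambda>k. if k < 6 then ss ! (n + 2 + k) else 0) = g" using ss2 by (auto simp: g_def)
  show ?thesis
  proof (cases "i < length p \<and> (\<forall>b. p ! i \<noteq> IHalt b)")
    case False
    have "(tm_state p i = 1 \<or> tm_state p i = 2) \<and> tmm.step x n p c = c"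
    proof (cases "i < length p")
      case True
      then obtain b where "p ! i = IHalt b" using False by blast
      then show ?thesis using True by (simp add: c tm_state_def tmm.step_def)
    next
      case False
      then show ?thesis by (simp add: c tm_state_def tmm.step_def)
    qed
    then show ?thesis by (simp add: c tm_conf_def del: upt_Suc)
  next
    case True
    define q where "q = tm_state p i"
    have q: "q \<noteq> 1" "q \<noteq> 2" "(if q = 0 then 0 else q - 2) = i"
      using True by (cases "p ! i"; simp add: q_def tm_state_def)+
    have delta: "tm_delta n p q ss = (case p ! i of
          IAct a \<Rightarrow> (tm_state p (Suc i), writes n a (isym x s) d g)
        | IBr t l \<Rightarrow> (tm_state p (if t (isym x s) d g then l else Suc i), map (\<lambda>c. (c, Stay)) ss)
        | IHalt b \<Rightarrow> (1, map (\<lambda>c. (c, Stay)) ss))"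
      unfolding tm_delta_def q(3) d g ss0 Let_def ..
    have conf: "tm_conf n x p c = (q, T)" by (simp add: c tm_conf_def q_def T_def del: upt_Suc)
    have step: "tm_step (tm_of n p) (tm_conf n x p c) =
      (case tm_delta n p q ss of (q', as) \<Rightarrow> (q', map2 tape_act as T))"
      unfolding conf using q(1,2) by (simp add: tm_of_def ss_def)
    show ?thesis
    proof (cases "p ! i")
      case (IAct a)
      have "map2 tape_act (writes n a (isym x s) d g) T = (ih (do_act x a s), snd (input_tape x)) #
        map (\<lambda>i. (hs (do_act x a s) i, ct (do_act x a s) i)) [0..<Suc n] @
        map (\<lambda>k. (0, (\<lambda>_. 0)(0 := fl (do_act x a s) k))) [0..<6]"
        unfolding T_def
        by (cases a; simp only: writes.simps map2_tapes; simp add: d_def g_def isym_def sym_def del: upt_Suc)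
      then show ?thesis
        unfolding step delta using True IAct by (simp add: c tmm.step_def tm_conf_def del: upt_Suc)
    next
      case (IBr t l)
      have "map2 tape_act (map (\<lambda>c. (c, Stay)) ss) T = T"
        by (rule nth_equalityI) (auto simp: ss_def split: prod.splits)
      moreover have "ttst x n t s = t (isym x s) d g" by (simp add: ttst_def d_def g_def)
      ultimately show ?thesis
        unfolding step delta using True IBr
        by (simp add: c tmm.step_def tm_conf_def T_def[symmetric] del: upt_Suc)
    next
      case (IHalt b)
      then show ?thesis using True by simp
    qed
  qed
qed

lemma tm_steps_conf:
  "(tm_step (tm_of n p) ^^ t) (tm_conf n x p c) = tm_conf n x p ((tmm.step x n p ^^ t) c)"
  by (induction t) (simp_all add: tm_step_conf)

section \<open>Initial configuration and the number of configurations\<close>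

definition init_state :: tstate where
  "init_state = \<lparr>ih = 0, ct = (\<lambda>_ _. 0), hs = (\<lambda>_. 0), fl = (\<lambda>_. 0)\<rparr>"

lemma tm_init_conf:
  assumes "p \<noteq> []" "\<forall>b. p ! 0 \<noteq> IHalt b"
  shows "tm_init (tm_of n p) x = tm_conf n x p (0, init_state)"
proof -
  have "map (\<lambda>i. (0 :: int, \<lambda>_ :: int. 0 :: nat)) [0..<Suc n] @ map (\<lambda>k. (0, (\<lambda>_. 0)(0 := 0))) [0..<6]
    = replicate (n + 7) (0, \<lambda>_. 0)"
  proof -
    have zero: "(\<lambda>_. 0 :: nat)(0 :: int := 0) = (\<lambda>_. 0)" by auto
    show ?thesis
      by (simp add: zero map_replicate_const replicate_add[symmetric] del: upt_Suc replicate_Suc)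
  qed
  moreover have "tm_state p 0 = 0" using assms by (auto simp: tm_state_def split: ins.splits)
  ultimately show ?thesis
    by (simp add: tm_init_def tm_of_def tm_conf_def init_state_def input_tape_def del: upt_Suc)
qed

lemma length_pairs_le: "length (pairs x) \<le> length x"
  by (induction x rule: pairs.induct) auto

definition conf_set :: "nat \<Rightarrow> nat \<Rightarrow> bool list \<Rightarrow> tm_config set" where
  "conf_set n S x = (\<lambda>(q, a, j, hl, gl). (q, (a, snd (input_tape x)) #
     map (\<lambda>h. (h, cell (take j (pairs x)))) hl @ map (\<lambda>f. (0, (\<lambda>_. 0)(0 := f))) gl)) `
     ({..<S} \<times> {0..int (length x) + 1} \<times> {..length x} \<times>
       {hl. set hl \<subseteq> {- 1..int (length x)} \<and> length hl = Suc n} \<times> {gl. set gl \<subseteq> {..<7} \<and> length gl = 6})"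

lemma conf_in_conf_set:
  assumes "tok x s"
  shows "tm_conf n x p (i, s) \<in> conf_set n (length p + 3) x"
proof -
  obtain j where j: "j \<le> length (pairs x)" "ct s = (\<lambda>_. cell (take j (pairs x)))"
    using assms by (auto simp: tok_def)
  have eq: "tm_conf n x p (i, s) = (\<lambda>(q, a, j, hl, gl). (q, (a, snd (input_tape x)) #
     map (\<lambda>h. (h, cell (take j (pairs x)))) hl @ map (\<lambda>f. (0, (\<lambda>_. 0)(0 := f))) gl))
     (tm_state p i, ih s, j, map (hs s) [0..<Suc n], map (fl s) [0..<6])"
    by (simp add: tm_conf_def j(2) del: upt_Suc)
  have hs: "hs s i \<in> {- 1..int (length x)}" for i
  proof -
    have "- 1 \<le> hs s i" "hs s i \<le> int (length (pairs x))" using assms by (auto simp: tok_def)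
    then show ?thesis using length_pairs_le[of x] by simp
  qed
  have "j \<le> length x" using j(1) length_pairs_le[of x] by simp
  moreover have "set (map (hs s) [0..<Suc n]) \<subseteq> {- 1..int (length x)}" using hs by auto
  moreover have "set (map (fl s) [0..<6]) \<subseteq> {..<7}" "ih s \<in> {0..int (length x) + 1}"
    using assms by (auto simp: tok_def)
  moreover note tm_state_less[of p i]
  ultimately show ?thesis
    unfolding conf_set_def eq by (intro imageI) (simp del: upt_Suc)
qed

lemma finite_conf_set: "finite (conf_set n S x)"
  unfolding conf_set_def
  by (intro finite_imageI finite_cartesian_product finite_lists_length_eq) auto

text \<open>The exponent counts the input head, the prefix length \<open>j\<close> and the
  \<open>n + 1\<close> data heads; the six flags contribute \<open>7 ^ 6\<close>.\<close>

lemma card_conf_set: "card (conf_set n S x) \<le> S * 7 ^ 6 * (length x + 2) ^ (n + 3)"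
proof -
  let ?m = "length x"
  let ?X = "{..<S} \<times> {0..int ?m + 1} \<times> {..?m} \<times>
       {hl. set hl \<subseteq> {- 1..int ?m} \<and> length hl = Suc n} \<times> {gl. set gl \<subseteq> {..<7 :: nat} \<and> length gl = 6}"
  have "finite ?X" by (intro finite_cartesian_product finite_lists_length_eq) auto
  then have "card (conf_set n S x) \<le> card ?X"
    unfolding conf_set_def by (rule card_image_le)
  also have "card ?X = S * ((?m + 2) * ((?m + 1) * ((?m + 2) ^ Suc n * 7 ^ 6)))"
  proof -
    have "card {0..int ?m + 1} = ?m + 2" "card {- 1..int ?m} = ?m + 2" by simp_all
    then show ?thesis
      by (simp only: card_cartesian_product card_lists_length_eq finite_atLeastAtMost_int finite_lessThan
          card_lessThan card_atMost Suc_eq_plus1)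
  qed
  also have "\<dots> \<le> S * ((?m + 2) * ((?m + 2) * ((?m + 2) ^ Suc n * 7 ^ 6)))"
    by (intro mult_le_mono) auto
  also have "\<dots> = S * 7 ^ 6 * (?m + 2) ^ (n + 3)"
    by (simp only: power_add power3_eq_cube power_Suc mult_ac)
  finally show ?thesis .
qed

text \<open>The premise asks for termination with the right answer and ignores the step count,
  because the number of admissible configurations already bounds the time.\<close>

lemma class_P_programI:
  assumes "\<And>x. tmm.wp x n c (\<lambda>k s. ttst x n t s \<longleftrightarrow> x \<in> L) init_state"
  shows "L \<in> class_P"
proof -
  \<comment> \<open>The dummy branch at address 0 never jumps; it makes the initial state visibly
    different from a halt.\<close>
  define p where "p = machine.program always [IBr (\<lambda>_ _ _. False) 0] c t"
  have p0: "p \<noteq> []" "\<forall>b. p ! 0 \<noteq> IHalt b" by (auto simp: p_def tmm.program_def)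
  let ?M = "\<lambda>x t. (tm_step (tm_of n p) ^^ t) (tm_init (tm_of n p) x)"
  define S where "S = length p + 3"
  \<comment> \<open>For a nonempty input, \<open>length x + 2\<close> is at most
    \<open>3 * length x\<close>; the additive \<open>K\<close> covers the empty input.\<close>
  define K where "K = S * 7 ^ 6 * 3 ^ (n + 3)"
  have "\<exists>t \<le> K * length x ^ (n + 3) + K. fst (?M x t) = (if x \<in> L then 1 else 2)" for x
  proof -
    have ok: "tok x init_state"
      by (auto simp: tok_def init_state_def cell_Nil intro!: exI[of _ 0])
    from tmm.program_run[OF assms ok, of "[IBr (\<lambda>_ _ _. False) 0]" t, folded p_def, unfolded list.size add_0]
    obtain k s' i where "ttst x n t s' \<longleftrightarrow> x \<in> L" and run: "tmm.run x n p (Suc 0, init_state) (k + 1) (i, s')"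
      and halt: "i < length p" "p ! i = IHalt (ttst x n t s')"
      by blast
    then have halt_L: "p ! i = IHalt (x \<in> L)" by simp
    have first: "tmm.step x n p (0, init_state) = (Suc 0, init_state)"
      unfolding p_def tmm.program_def by (simp add: tmm.step_def ttst_def)
    define d where "d = (\<lambda>t. (tmm.step x n p ^^ t) (0, init_state))"
    have d_Suc: "d (Suc t) = (tmm.step x n p ^^ t) (Suc 0, init_state)" for t
      by (simp add: d_def first funpow_swap1)
    have d_ok: "tok x (snd (d t))" if "t \<le> Suc (k + 1)" for t
    proof (cases t)
      case 0
      then show ?thesis using ok by (simp add: d_def)
    next
      case (Suc t')
      then show ?thesis using run that unfolding Suc d_Suc tmm.run_def by auto
    qed
    have conf: "?M x t = tm_conf n x p (d t)" for t
      unfolding tm_init_conf[OF p0] tm_steps_conf d_def ..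
    have end_state: "fst (tm_conf n x p (d (Suc (k + 1)))) = (if x \<in> L then 1 else 2)"
      using run halt(1) halt_L unfolding d_Suc tmm.run_def by (auto simp: tm_conf_def tm_state_def)
    have "\<exists>t' \<le> card (conf_set n S x). fst (?M x t') = (if x \<in> L then 1 else 2)"
    proof (rule funpow_reaches_within_card[OF finite_conf_set])
      show "fst (?M x (Suc (k + 1))) = (if x \<in> L then 1 else 2)"
        unfolding conf by (rule end_state)
      show "?M x i \<in> conf_set n S x" if "i \<le> Suc (k + 1)" for i
        using conf_in_conf_set[OF d_ok[OF that], of n p "fst (d i)"] unfolding conf S_def by simp
    qed
    moreover have "card (conf_set n S x) \<le> K * length x ^ (n + 3) + K"
    proof -
      have "(length x + 2) ^ (n + 3) \<le> 3 ^ (n + 3) * length x ^ (n + 3) + 3 ^ (n + 3)"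
      proof (cases "length x = 0")
        case True
        then have "(length x + 2) ^ (n + 3) \<le> 3 ^ (n + 3)" by (intro power_mono) auto
        then show ?thesis by (rule trans_le_add2)
      next
        case False
        then have "(length x + 2) ^ (n + 3) \<le> (3 * length x) ^ (n + 3)" by (intro power_mono; cases x) auto
        then show ?thesis by (simp only: power_mult_distrib) 
      qed
      then have "S * 7 ^ 6 * (length x + 2) ^ (n + 3) \<le> S * 7 ^ 6 * (3 ^ (n + 3) * length x ^ (n + 3) + 3 ^ (n + 3))"
        by (rule mult_le_mono2)
      also have "\<dots> = K * length x ^ (n + 3) + K" by (simp only: K_def distrib_left mult.assoc)
      finally show ?thesis using card_conf_set[of n S x] by linarith
    qed
    ultimately show ?thesis by (meson le_trans)
  qed
  then have "tm_decides_in_time (tm_of n p) L (\<lambda>m. K * m ^ (n + 3) + K)"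
    unfolding tm_decides_in_time_def by blast
  then show ?thesis using wf_tm_of unfolding class_P_def by blast
qed

section \<open>Reading and validating the input\<close>

definition copy :: "tcom" where
  "copy = While (\<lambda>b _ _. b \<noteq> 0) (Seq (Act ReadBit) (Act AppendSymbol))"

lemma cell_snoc: "(cell cs)(int (length cs) := c) = cell (cs @ [c])"
  by (auto simp: cell_def nth_append fun_eq_iff)

lemma input_cell:
  "snd (input_tape (pre @ a # rest)) (int (length pre)) = bit_code a"
  "int (length x) \<le> i \<Longrightarrow> snd (input_tape x) i = 0"
  by (auto simp: input_tape_def bit_code_def nth_append)

lemma bit_code_nonzero [simp]: "bit_code a \<noteq> 0"
  by (simp add: bit_code_def)

lemma bit_code_less [simp]: "bit_code a < 7"
  by (simp add: bit_code_def)

definition copying :: "bool list \<Rightarrow> bool list \<Rightarrow> nat list \<Rightarrow> nat \<Rightarrow> nat \<Rightarrow> int \<Rightarrow> tstate" where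
  "copying x rest cs a q i =
     \<lparr>ih = i, ct = (\<lambda>_. cell cs), hs = (\<lambda>_. int (length cs)), fl = (\<lambda>_. 0)(0 := a, 1 := q)\<rparr>"

lemma tok_copying:
  assumes "cs @ cs' = pairs x" "0 \<le> i" "i \<le> int (length x) + 1" "a < 7" "q < 7"
  shows "tok x (copying x rest cs a q i)"
proof -
  have "length cs \<le> length (pairs x)" "cs = take (length cs) (pairs x)"
    unfolding assms(1)[symmetric] by simp_all
  then show ?thesis using assms(2-) unfolding tok_def copying_def
    by (auto intro!: exI[of _ "length cs"])
qed

lemma copy_spec:
  "tmm.wp x n copy (\<lambda>k s. \<exists>a i. s = copying x [] (pairs x) a (dfa_run 0 x) i) init_state"
proof -
  \<comment> \<open>The last alternative arises at the end of an input of odd length, where the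
    second symbol of the final pair is read beyond the input.\<close>
  define P where "P = (\<lambda>m (k :: nat) s. \<exists>rest cs a q i. s = copying x rest cs a q i \<and> m = length rest \<and>
    cs @ pairs rest = pairs x \<and> dfa_run q rest = dfa_run 0 x \<and> q < 7 \<and>
    ((\<exists>pre. x = pre @ rest \<and> i = int (length pre)) \<or> rest = [] \<and> i = int (length x) + 1))"
  have "tmm.wp x n (While (\<lambda>b _ _. b \<noteq> 0) (Seq (Act ReadBit) (Act AppendSymbol)))
    (\<lambda>k. (\<lambda>k s. \<exists>a i. s = copying x [] (pairs x) a (dfa_run 0 x) i) (0 + k)) init_state"
  proof (rule tmm.wp_While_rule[where P = P])
    show "P (length x) 0 init_state"
      unfolding P_def
      by (rule exI[of _ x], rule exI[of _ "[]"], rule exI[of _ 0], rule exI[of _ 0], rule exI[of _ 0])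
        (auto simp: copying_def init_state_def cell_Nil)
  next
    fix m k s assume P: "P m k s" and t: "ttst x n (\<lambda>b _ _. b \<noteq> 0) s"
    obtain rest cs a q i where s: "s = copying x rest cs a q i" and m: "m = length rest"
      and cs: "cs @ pairs rest = pairs x" and q: "dfa_run q rest = dfa_run 0 x" "q < 7"
      and i: "(\<exists>pre. x = pre @ rest \<and> i = int (length pre)) \<or> rest = [] \<and> i = int (length x) + 1"
      using P unfolding P_def by blast
    have "rest \<noteq> []"
    proof
      assume "rest = []"
      then have "int (length x) \<le> i" using i by auto
      then show False using t input_cell(2) by (simp add: ttst_def isym_def s copying_def)
    qed
    then obtain pre where pre: "x = pre @ rest" "i = int (length pre)" using i by auto
    obtain b rest1 where b: "rest = b # rest1" using \<open>rest \<noteq> []\<close> by (cases rest) auto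
    have read: "do_act x ReadBit s = copying x rest cs (bit_code b) q (i + 1)"
      by (auto simp: s copying_def isym_def pre b input_cell(1))
    have ok_read: "tok x (copying x rest cs (bit_code b) q (i + 1))"
      using tok_copying[OF cs] pre b q by simp
    show "tmm.wp x n (Seq (Act ReadBit) (Act AppendSymbol)) (\<lambda>k' s'. \<exists>m' < m. P m' (k + k' + 2) s') s"
    proof (cases rest1)
      case Nil
      let ?s = "copying x [] (cs @ [pack (bit_code b) 0]) (bit_code b) 6 (i + 2)"
      have "snd (input_tape x) (i + 1) = 0" by (rule input_cell) (simp add: pre b Nil)
      then have app: "do_act x AppendSymbol (do_act x ReadBit s) = ?s"
        unfolding read by (auto simp: copying_def isym_def cell_snoc)
      have cs': "cs @ [pack (bit_code b) 0] = pairs x" using cs by (simp add: b Nil)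
      have ok: "tok x (?s)"
        using cs' pre b Nil by (intro tok_copying[of _ "[]"]) auto
      have "P 0 (k + 2 + 2) (?s)"
        unfolding P_def
        by (rule exI[of _ "[]"], rule exI[of _ "cs @ [pack (bit_code b) 0]"], rule exI[of _ "bit_code b"],
            rule exI[of _ 6], rule exI[of _ "i + 2"]) (use cs' q b Nil pre in auto)
      then show ?thesis
        unfolding tmm.wp_Seq tmm.wp_Act tsafe.simps app unfolding read using ok ok_read m b by auto
    next
      case (Cons c rest2)
      let ?s = "copying x rest2 (cs @ [pack (bit_code b) (bit_code c)]) (bit_code b)
        (dfa q (pack (bit_code b) (bit_code c))) (i + 2)"
      have "snd (input_tape x) (i + 1) = bit_code c"
        using input_cell(1)[of "pre @ [b]" c rest2] by (simp add: pre b Cons add.commute)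
      then have app: "do_act x AppendSymbol (do_act x ReadBit s) = ?s"
        unfolding read by (auto simp: copying_def isym_def cell_snoc)
      have cs': "(cs @ [pack (bit_code b) (bit_code c)]) @ pairs rest2 = pairs x" using cs by (simp add: b Cons)
      have ok: "tok x (?s)"
        using pre b Cons by (intro tok_copying[OF cs']) (auto simp: dfa_less)
      have "P (length rest2) (k + 2 + 2)
        (?s)"
        unfolding P_def
      proof (rule exI[of _ rest2], rule exI[of _ "cs @ [pack (bit_code b) (bit_code c)]"],
          rule exI[of _ "bit_code b"], rule exI[of _ "dfa q (pack (bit_code b) (bit_code c))"],
          rule exI[of _ "i + 2"], intro conjI)
        show "dfa_run (dfa q (pack (bit_code b) (bit_code c))) rest2 = dfa_run 0 x" using q by (simp add: b Cons)
        show "(\<exists>pre'. x = pre' @ rest2 \<and> i + 2 = int (length pre')) \<or> rest2 = [] \<and> i + 2 = int (length x) + 1"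
          by (rule disjI1, rule exI[of _ "pre @ [b, c]"]) (simp add: pre b Cons)
      qed (use cs' in \<open>simp_all add: dfa_less\<close>)
      then show ?thesis
        unfolding tmm.wp_Seq tmm.wp_Act tsafe.simps app unfolding read
        using ok ok_read m b Cons by (intro conjI exI[of _ "length rest2"]) simp_all
    qed
  next
    fix m k s assume P: "P m k s" and t: "\<not> ttst x n (\<lambda>b _ _. b \<noteq> 0) s"
    obtain rest cs a q i where s: "s = copying x rest cs a q i"
      and cs: "cs @ pairs rest = pairs x" and q: "dfa_run q rest = dfa_run 0 x"
      and i: "(\<exists>pre. x = pre @ rest \<and> i = int (length pre)) \<or> rest = [] \<and> i = int (length x) + 1"
      using P unfolding P_def by blast
    have "rest = []"
    proof (rule ccontr)
      assume "rest \<noteq> []"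
      then obtain b r pre where "x = pre @ b # r" "i = int (length pre)" using i by (cases rest) auto
      then have "snd (input_tape x) i = bit_code b" using input_cell(1) by simp
      then show False using t by (simp add: ttst_def isym_def s copying_def)
    qed
    then show "\<exists>a i. s = copying x [] (pairs x) a (dfa_run 0 x) i" using s cs q by auto
  qed
  then show ?thesis by (simp add: copy_def)
qed

section \<open>The automaton accepts exactly the encodings of identities\<close>

definition var_symbols :: "nat \<Rightarrow> nat list" where
  "var_symbols m = map bit_code (bits m) @ [3]"

lemma pack_codes: "pack (bit_code True) (bit_code b) = bit_code b"
  "pack (bit_code False) (bit_code True) = 4" "pack (bit_code False) (bit_code False) = 3"
  by (auto simp: pack_def bit_code_def)

lemma pairs_encode_var: "pairs (encode_var m @ y) = var_symbols m @ pairs y"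
proof -
  have "pairs (concat (map (\<lambda>b. [True, b]) bs) @ y) = map bit_code bs @ pairs y" for bs y
    by (induction bs) (auto simp: pack_codes)
  then show ?thesis by (simp add: encode_var_def var_symbols_def pack_codes)
qed

lemma pairs_encode_word: "pairs (encode_word u @ y) = concat (map var_symbols u) @ pairs y"
  by (induction u arbitrary: y) (simp_all add: encode_word_def pairs_encode_var)

lemma pairs_encode_identity:
  "pairs (encode_identity (u, v)) = concat (map var_symbols u) @ [4] @ concat (map var_symbols v)"
proof -
  have "pairs (encode_word v) = concat (map var_symbols v)" using pairs_encode_word[of v "[]"] by simp
  then show ?thesis by (simp add: encode_identity_def pairs_encode_word pack_codes)
qed

text \<open>The least significant bit comes first, so the last one is the leading bit of a positive
  number.\<close>

lemma last_bits: "bits m \<noteq> [] \<Longrightarrow> last (bits m)"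
proof (induction m rule: bits.induct)
  case (1 m)
  then have m: "m \<noteq> 0" by (cases "m = 0") (simp_all add: bits.simps[of 0])
  show ?case
  proof (cases "m div 2 = 0")
    case True
    then have "m = 1" using m by simp
    then show ?thesis by (simp add: bits.simps)
  next
    case False
    then have "bits (m div 2) \<noteq> []" by (simp add: bits.simps[of "m div 2"])
    then show ?thesis using 1 m by (simp add: bits.simps[of m])
  qed
qed

lemma ex_bits: "bs = [] \<or> last bs \<Longrightarrow> \<exists>m. bits m = bs"
proof (induction bs)
  case Nil
  show ?case by (rule exI[of _ 0]) (simp add: bits.simps)
next
  case (Cons b bs)
  then obtain m where m: "bits m = bs" by (auto split: if_splits)
  have "b \<or> m \<noteq> 0" using Cons.prems m by (auto simp: bits.simps)
  then have "bits (2 * m + of_bool b) = b # bs" using m by (subst bits.simps) auto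
  then show ?case by blast
qed

lemma dfa_values:
  "dfa 0 1 = 1" "dfa 1 1 = 1" "dfa 2 1 = 1" "dfa 3 1 = 4" "dfa 4 1 = 4" "dfa 5 1 = 4"
  "dfa 0 2 = 2" "dfa 1 2 = 2" "dfa 2 2 = 2" "dfa 3 2 = 5" "dfa 4 2 = 5" "dfa 5 2 = 5"
  "dfa 0 3 = 0" "dfa 1 3 = 6" "dfa 2 3 = 0" "dfa 3 3 = 3" "dfa 4 3 = 6" "dfa 5 3 = 3"
  "dfa 0 4 = 3" "0 < q \<Longrightarrow> dfa q 4 = 6" "dfa 6 c = 6"
  by (auto simp: dfa_def)

lemma dfa_run_6: "dfa_run 6 y = 6"
  by (induction "6 :: nat" y rule: dfa_run.induct) (auto simp: dfa_values)

text \<open>The states \<open>q\<close>, \<open>q + 1\<close>, \<open>q + 2\<close> mean that no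
  bit, a bit 0 or a bit 1 of the variable was read last. Its end is accepted only from
  \<open>q\<close> and \<open>q + 2\<close>, that is, for the number zero or after a leading 1; this
  excludes leading zeros.\<close>

lemma dfa_run_encode_var:
  assumes "q = 0 \<or> q = 3"
  shows "dfa_run q (encode_var m @ y) = dfa_run q y"
proof -
  have "dfa_run r (concat (map (\<lambda>b. [True, b]) bs) @ [False, False] @ y) = dfa_run q y"
    if "bs = [] \<longrightarrow> r = q \<or> r = q + 2" "bs \<noteq> [] \<longrightarrow> last bs" "r = q \<or> r = q + 1 \<or> r = q + 2" for r bs
    using that
  proof (induction bs arbitrary: r)
    case Nil
    then show ?case using assms by (auto simp: pack_codes dfa_def)
  next
    case (Cons b bs)
    have "dfa r (bit_code b) = (if b then q + 2 else q + 1)"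
      using Cons.prems(3) assms by (auto simp: bit_code_def dfa_def)
    moreover have "dfa_run (if b then q + 2 else q + 1) (concat (map (\<lambda>b. [True, b]) bs) @ [False, False] @ y) = dfa_run q y"
      using Cons.prems by (intro Cons.IH) auto
    ultimately show ?case by (simp add: pack_codes)
  qed
  from this[of "bits m" q] show ?thesis
    using last_bits[of m] by (simp add: encode_var_def)
qed

lemma dfa_run_encode_word: "q = 0 \<or> q = 3 \<Longrightarrow> dfa_run q (encode_word u @ y) = dfa_run q y"
  by (induction u) (simp_all add: encode_word_def dfa_run_encode_var)

lemma dfa_run_encode_identity: "dfa_run 0 (encode_identity e) = 3"
proof (cases e)
  case (Pair u v)
  have "dfa_run 3 (encode_word v) = 3" using dfa_run_encode_word[of 3 v "[]"] by simp
  then show ?thesis by (simp add: Pair encode_identity_def dfa_run_encode_word pack_codes dfa_values)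
qed

text \<open>What may still follow when no variable is pending: a whole identity before the
  separator, only a word after it.\<close>

definition accepted :: "nat \<Rightarrow> bool list set" where
  "accepted q = (if q < 3 then range encode_identity else range encode_word)"

lemma accepted_encode_var: "y \<in> accepted q \<Longrightarrow> encode_var m @ y \<in> accepted q"
proof -
  have "encode_var m @ encode_identity (u, v) = encode_identity (m # u, v)" for u v
    by (simp add: encode_identity_def encode_word_def)
  moreover have "encode_var m @ encode_word v = encode_word (m # v)" for v
    by (simp add: encode_word_def)
  ultimately show "y \<in> accepted q \<Longrightarrow> encode_var m @ y \<in> accepted q"
    unfolding accepted_def by (auto split: if_splits)
qed

text \<open>Generalised to all non-rejecting states for the induction. In the middle of a variable,
  further bits \<open>bs\<close> and an end mark precede the accepted rest \<open>y\<close>; if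
  \<open>bs\<close> is empty, the bit read last must have been 1.\<close>

lemma dfa_run_sound:
  assumes "dfa_run q x = 3" "q < 6"
  shows "\<exists>bs y. y \<in> accepted q \<and>
    (x = y \<and> (q = 0 \<or> q = 3) \<or>
     x = concat (map (\<lambda>b. [True, b]) bs) @ [False, False] @ y \<and>
       (if bs = [] then q \<in> {2, 5} else last bs) \<and> q \<noteq> 0 \<and> q \<noteq> 3)"
  using assms
proof (induction q x rule: dfa_run.induct)
  case (1 q)
  then have "q = 3" by simp
  moreover have "[] \<in> accepted 3" by (auto simp: accepted_def encode_word_def intro!: image_eqI[of _ _ "[]"])
  ultimately show ?case by blast
next
  case (2 q a)
  then show ?case by simp
next
  case (3 q a b x)
  define q' where "q' = dfa q (pack (bit_code a) (bit_code b))"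
  have run: "dfa_run q' x = 3" using "3.prems" by (simp add: q'_def)
  then have q'6: "q' < 6" using dfa_run_6[of x] dfa_less[of q "pack (bit_code a) (bit_code b)"]
    by (cases "q' = 6") (auto simp: q'_def)
  obtain bs y where y: "y \<in> accepted q'" and IH: "x = y \<and> (q' = 0 \<or> q' = 3) \<or>
     x = concat (map (\<lambda>b. [True, b]) bs) @ [False, False] @ y \<and>
       (if bs = [] then q' \<in> {2, 5} else last bs) \<and> q' \<noteq> 0 \<and> q' \<noteq> 3"
    using "3.IH"[folded q'_def, OF run q'6] by blast
  show ?case
  proof (cases a)
    case True
    have "pack (bit_code a) (bit_code b) = bit_code b" using True by (simp add: pack_codes)
    then have q': "q' = (if q < 3 then (if b then 2 else 1) else (if b then 5 else 4))"
      using "3.prems"(2) by (auto simp: q'_def bit_code_def dfa_def)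
    have acc: "accepted q' = accepted q" using q' by (auto simp: accepted_def)
    have x: "a # b # x = concat (map (\<lambda>b. [True, b]) (b # bs)) @ [False, False] @ y"
      and last: "last (b # bs)"
      using IH True q' by (auto split: if_splits)
    show ?thesis
    proof (cases "q = 0 \<or> q = 3")
      case True
      obtain m where "bits m = b # bs" using ex_bits[of "b # bs"] last by auto
      then have "a # b # x = encode_var m @ y" unfolding x by (simp add: encode_var_def)
      then have "a # b # x \<in> accepted q" using accepted_encode_var[OF y, of m] acc by simp
      then show ?thesis using True by blast
    next
      case False
      then show ?thesis using x last y acc by (intro exI[of _ "b # bs"] exI[of _ y]) simp
    qed
  next
    case a: False
    show ?thesis
    proof (cases b)
      case True
      then have "pack (bit_code a) (bit_code b) = 4" using a by (simp add: pack_codes)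
      then have "q = 0" "q' = 3" using q'6 by (auto simp: q'_def dfa_def split: if_splits)
      then have "x \<in> range encode_word" using IH y by (auto simp: accepted_def)
      then obtain v where "x = encode_word v" by blast
      then have "a # b # x = encode_identity ([], v)" using a True by (simp add: encode_identity_def encode_word_def)
      then have "a # b # x \<in> accepted q" using \<open>q = 0\<close> by (simp add: accepted_def)
      then show ?thesis using \<open>q = 0\<close> by blast
    next
      case False
      then have "pack (bit_code a) (bit_code b) = 3" using a by (simp add: pack_codes)
      then have q: "(q = 0 \<or> q = 2) \<and> q' = 0 \<or> (q = 3 \<or> q = 5) \<and> q' = 3"
        using q'6 by (auto simp: q'_def dfa_def split: if_splits)
      then have "x = y" and acc: "accepted q' = accepted q" using IH by (auto simp: accepted_def)
      have 0: "encode_var 0 = [False, False]" by (simp add: encode_var_def bits.simps)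
      show ?thesis
      proof (cases "q = 0 \<or> q = 3")
        case True
        have "a # b # x \<in> accepted q"
          using accepted_encode_var[OF y, of 0] a False acc \<open>x = y\<close> by (simp add: 0)
        then show ?thesis using True by blast
      next
        case q2: False
        then have "q = 2 \<or> q = 5" using q by blast
        moreover have "y \<in> accepted q" using y acc by simp
        ultimately show ?thesis using a False \<open>x = y\<close> by (intro exI[of _ "[]"] exI[of _ y]) auto
      qed
    qed
  qed
qed

lemma dfa_run_iff: "dfa_run 0 x = 3 \<longleftrightarrow> x \<in> range encode_identity"
  using dfa_run_sound[of 0 x] dfa_run_encode_identity by (auto simp: accepted_def)

section \<open>Comparing all short subwords\<close>

abbreviation is_bit :: "nat \<Rightarrow> bool" where
  "is_bit c \<equiv> c = 1 \<or> c = 2"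

definition next_token :: "nat \<Rightarrow> tcom" where
  "next_token i = Seq (While (\<lambda>_ d _. is_bit (d i)) (Act (MoveR i))) (Act (MoveR i))"

text \<open>The first move leaves the end symbol, on which the loop would stop at once; the last one
  returns from the end of the previous token or from the blank on the left.\<close>

definition token_start :: "nat \<Rightarrow> tcom" where
  "token_start i = Seq (Act (MoveL i)) (Seq (While (\<lambda>_ d _. is_bit (d i)) (Act (MoveL i))) (Act (MoveR i)))"

text \<open>The first move leaves the blank behind the last token, where a head stands after copying
  and after a complete round.\<close>

definition to_start :: "nat \<Rightarrow> tcom" where
  "to_start i = Seq (Act (MoveL i)) (Seq (While (\<lambda>_ d _. d i \<noteq> 0) (Act (MoveL i))) (Act (MoveR i)))"

text \<open>Flag 3 records that the token under head \<open>i\<close> has been found by the scanning head \<open>n\<close>; flags 4 and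
  5 that the current word is not a subword of the first and the second word, respectively; flag 2 that the
  identity fails.\<close>

definition compare_token :: "nat \<Rightarrow> nat \<Rightarrow> tcom" where
  "compare_token n i =
     Seq (While (\<lambda>_ d _. is_bit (d n) \<and> d n = d i) (Seq (Act (MoveR n)) (Act (MoveR i))))
     (Seq (If (\<lambda>_ d _. d n = d i) (Act (SetF 3 1)) Skip)
     (Seq (next_token n) (token_start i)))"

text \<open>A separator under head \<open>i\<close> stands for no letter, so words shorter than
  \<open>n\<close> are covered as well. The scan ends at \<open>stop\<close>: the separator 4 for
  the first word, the blank 0 for the second.\<close>

definition find_token :: "nat \<Rightarrow> nat \<Rightarrow> nat \<Rightarrow> nat \<Rightarrow> tcom" where
  "find_token n stop k i = If (\<lambda>_ d _. d i = 4) Skip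
     (Seq (Act (SetF 3 0))
     (Seq (While (\<lambda>_ d g. g 3 = 0 \<and> d n \<noteq> stop) (compare_token n i))
     (If (\<lambda>_ _ g. g 3 = 0) (Act (SetF k 1)) Skip)))"

fun match :: "nat \<Rightarrow> nat \<Rightarrow> nat \<Rightarrow> nat list \<Rightarrow> tcom" where
  "match n stop k [] = Skip"
| "match n stop k (i # is) = Seq (find_token n stop k i) (match n stop k is)"

definition check_word :: "nat \<Rightarrow> tcom" where
  "check_word n = Seq (Act (SetF 4 0)) (Seq (to_start n) (Seq (match n 4 4 [0..<n])
     (Seq (Act (SetF 5 0)) (Seq (to_start n) (Seq (While (\<lambda>_ d _. d n \<noteq> 4) (Act (MoveR n)))
     (Seq (Act (MoveR n)) (Seq (match n 0 5 [0..<n])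
     (If (\<lambda>_ _ g. g 4 \<noteq> g 5) (Act (SetF 2 1)) Skip))))))))"

text \<open>One nested loop per letter position. The depth is the rank, which is fixed, so the
  recursion unfolds into one program for all inputs.\<close>

fun check_all :: "nat \<Rightarrow> nat \<Rightarrow> tcom" where
  "check_all n 0 = check_word n"
| "check_all n (Suc d) = Seq (to_start d) (While (\<lambda>_ e _. e d \<noteq> 0) (Seq (check_all n d) (next_token d)))"

definition decide_tm :: "nat \<Rightarrow> tcom" where
  "decide_tm n = Seq copy (If (\<lambda>_ _ g. g 1 = 3) (check_all n n) (Act (SetF 2 1)))"

section \<open>Tokens on the data tapes\<close>

fun token :: "nat option \<Rightarrow> nat list" where
  "token None = [4]"
| "token (Some m) = var_symbols m"

lemma token_not_Nil [simp]: "token t \<noteq> []"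
  by (cases t) (auto simp: var_symbols_def)

lemma token_snoc: "\<exists>bs e. token t = map bit_code bs @ [e] \<and> (e = 3 \<or> e = 4)"
  by (cases t) (auto simp: var_symbols_def intro: exI[of _ "[]"])

text \<open>Tokens are self-delimiting: exactly the last symbol is not a bit, so a head recognises
  the end of its token locally.\<close>

lemma token_nth:
  assumes "r < length (token t)"
  shows "is_bit (token t ! r) \<longleftrightarrow> Suc r < length (token t)" "token t ! r \<noteq> 0"
proof -
  obtain bs e where t: "token t = map bit_code bs @ [e]" "e = 3 \<or> e = 4" using token_snoc by blast
  show "is_bit (token t ! r) \<longleftrightarrow> Suc r < length (token t)" "token t ! r \<noteq> 0"
    using assms t(2) unfolding t(1) by (auto simp: nth_append bit_code_def)
qed

lemma inj_token: "token t = token t' \<Longrightarrow> t = t'"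
proof -
  have "inj bit_code" by (auto simp: inj_def bit_code_def split: if_splits)
  then show "token t = token t' \<Longrightarrow> t = t'"
    by (cases t; cases t') (auto simp: var_symbols_def inj_map_eq_map dest: bits_inject)
qed

lemma token_first: "token (Some m) ! 0 \<noteq> 0" "token (Some m) ! 0 \<noteq> 4"
  by (cases "bits m"; simp add: var_symbols_def bit_code_def)+

text \<open>Matching a letter at its first occurrence is never a disadvantage; this justifies the
  greedy search.\<close>

lemma subseq_Cons_first:
  "m \<notin> set xs \<Longrightarrow> subseq (m # y) (xs @ m # ys) \<longleftrightarrow> subseq y ys"
  by (induction xs) (auto simp: subseq_Cons2_neq)

text \<open>The situation after a valid input has been copied; \<open>i0\<close> is where the input
  head has come to rest.\<close>

locale tm_check =
  fixes n :: nat and x :: "bool list" and u v :: "nat list" and i0 :: int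
  assumes x: "x = encode_identity (u, v)"
begin

definition toks :: "nat option list" where
  "toks = map Some u @ [None] @ map Some v"

abbreviation C :: "nat list" where
  "C \<equiv> pairs x"

abbreviation tk :: "nat \<Rightarrow> nat list" where
  "tk j \<equiv> token (toks ! j)"

abbreviation tlen :: "nat \<Rightarrow> nat" where
  "tlen j \<equiv> length (tk j)"

definition pos :: "nat \<Rightarrow> nat" where
  "pos j = length (concat (map token (take j toks)))"

lemma C_toks: "C = concat (map token toks)"
  by (simp add: x pairs_encode_identity toks_def comp_def)

lemma pos_0 [simp]: "pos 0 = 0"
  by (simp add: pos_def)

lemma pos_Suc: "j < length toks \<Longrightarrow> pos (Suc j) = pos j + tlen j"
  by (simp add: pos_def take_Suc_conv_app_nth)

lemma pos_end: "pos (length toks) = length C"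
  by (simp add: pos_def C_toks)

lemma C_split:
  "j < length toks \<Longrightarrow> C = concat (map token (take j toks)) @ tk j @ concat (map token (drop (Suc j) toks))"
  unfolding C_toks by (subst id_take_nth_drop[of j toks]) simp_all

lemma pos_less:
  assumes "j < length toks" "r < tlen j"
  shows "pos j + r < length C"
  using assms by (subst C_split[OF assms(1)]) (simp add: pos_def)

lemma pos_le: "j \<le> length toks \<Longrightarrow> pos j \<le> length C"
  using pos_less[of j 0] pos_end by (cases "j = length toks") auto

lemma cell_token:
  assumes "j < length toks" "r < tlen j"
  shows "cell C (int (pos j + r)) = tk j ! r"
proof -
  have "C ! (pos j + r) = tk j ! r"
    using assms by (subst C_split[OF assms(1)]) (simp add: pos_def nth_append)
  then show ?thesis using pos_less[OF assms] by (simp add: cell_def del: of_nat_add)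
qed

lemma cell_pos:
  assumes "j < length toks"
  shows "cell C (int (pos j)) = tk j ! 0"
  using cell_token[OF assms, of 0] by simp

lemma cell_end: "cell C (int (length C)) = 0" "cell C (- 1) = 0"
  by (simp_all add: cell_def)

text \<open>To the left of a token there is the end symbol of its predecessor or the blank; either
  stops the leftward loop of \<open>token_start\<close>.\<close>

lemma cell_before:
  assumes "j \<le> length toks"
  shows "\<not> is_bit (cell C (int (pos j) - 1))"
proof (cases j)
  case 0
  then show ?thesis by (simp add: cell_end)
next
  case (Suc k)
  define r where "r = tlen k - 1"
  have r: "Suc r = tlen k" by (simp add: r_def)
  have k: "k < length toks" using assms Suc by simp
  have "int (pos j) - 1 = int (pos k + r)" using pos_Suc[OF k] r by (simp add: Suc)
  then have "cell C (int (pos j) - 1) = tk k ! r" using cell_token[OF k, of r] r by simp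
  then show ?thesis using token_nth(1)[of r "toks ! k"] r by simp
qed

lemma cell_nonzero:
  assumes "0 \<le> i" "i < int (length C)"
  shows "cell C i \<noteq> 0"
proof -
  have "0 \<notin> set (token t)" for t using token_nth(2) by (metis in_set_conv_nth)
  then have "0 \<notin> set C" unfolding C_toks by auto
  moreover have "cell C i \<in> set C" using assms by (simp add: cell_def)
  ultimately show ?thesis by metis
qed

section \<open>Proof rules after the copying phase, when only heads and flags change\<close>

definition conf :: "(nat \<Rightarrow> int) \<Rightarrow> (nat \<Rightarrow> nat) \<Rightarrow> tstate" where
  "conf h f = \<lparr>ih = i0, ct = (\<lambda>_. cell C), hs = h, fl = f\<rparr>"

definition holds :: "ttest \<Rightarrow> (nat \<Rightarrow> int) \<Rightarrow> (nat \<Rightarrow> nat) \<Rightarrow> bool" where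
  "holds t h f = t (snd (input_tape x) i0) (\<lambda>i. if i \<le> n then cell C (h i) else 0) (\<lambda>k. if k < 6 then f k else 0)"

lemma ttst_conf: "ttst x n t (conf h f) = holds t h f"
  by (simp add: ttst_def holds_def conf_def isym_def sym_def cong: if_cong)

text \<open>The step count is dropped, and the postcondition speaks about heads and flags
  only.\<close>

definition W :: "tcom \<Rightarrow> ((nat \<Rightarrow> int) \<Rightarrow> (nat \<Rightarrow> nat) \<Rightarrow> bool) \<Rightarrow> (nat \<Rightarrow> int) \<Rightarrow> (nat \<Rightarrow> nat) \<Rightarrow> bool" where
  "W c Q h f \<longleftrightarrow> tmm.wp x n c (\<lambda>k s. \<exists>h' f'. s = conf h' f' \<and> Q h' f') (conf h f)"

lemma W_mono: "W c Q h f \<Longrightarrow> (\<And>h' f'. Q h' f' \<Longrightarrow> Q' h' f') \<Longrightarrow> W c Q' h f"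
  unfolding W_def by (erule tmm.wp_mono) blast

lemma W_Skip: "Q h f \<Longrightarrow> W Skip Q h f"
  unfolding W_def by auto

lemma W_Seq: "W c (\<lambda>h' f'. W d Q h' f') h f \<Longrightarrow> W (Seq c d) Q h f"
  unfolding W_def tmm.wp_Seq by (erule tmm.wp_mono) auto

lemma W_MoveL: "0 \<le> h i \<Longrightarrow> Q (h(i := h i - 1)) f \<Longrightarrow> W (Act (MoveL i)) Q h f"
  unfolding W_def by (auto simp: conf_def)

lemma W_MoveR: "h i < int (length C) \<Longrightarrow> Q (h(i := h i + 1)) f \<Longrightarrow> W (Act (MoveR i)) Q h f"
  unfolding W_def by (auto simp: conf_def)

lemma W_SetF: "Q h (f(k := min a 6)) \<Longrightarrow> W (Act (SetF k a)) Q h f"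
  unfolding W_def by (auto simp: conf_def)

lemma W_If: "(holds t h f \<Longrightarrow> W c Q h f) \<Longrightarrow> (\<not> holds t h f \<Longrightarrow> W d Q h f) \<Longrightarrow> W (If t c d) Q h f"
  unfolding W_def by (simp add: ttst_conf)

lemma W_While:
  fixes m :: nat
  assumes "P m h f"
    and "\<And>m h f. P m h f \<Longrightarrow> holds t h f \<Longrightarrow> W c (\<lambda>h' f'. \<exists>m' < m. P m' h' f') h f"
    and "\<And>m h f. P m h f \<Longrightarrow> \<not> holds t h f \<Longrightarrow> Q h f"
  shows "W (While t c) Q h f"
proof -
  let ?P = "\<lambda>m (k :: nat) s. \<exists>h f. s = conf h f \<and> P m h f"
  have "tmm.wp x n (While t c) (\<lambda>k. (\<lambda>k s. \<exists>h' f'. s = conf h' f' \<and> Q h' f') (0 + k)) (conf h f)"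
  proof (rule tmm.wp_While_rule[where P = ?P])
    show "?P m 0 (conf h f)" using assms(1) by blast
  next
    fix m k s assume "?P m k s" "ttst x n t s"
    then obtain h f where s: "s = conf h f" "P m h f" "holds t h f" using ttst_conf by blast
    from assms(2)[OF s(2,3)]
    have "tmm.wp x n c (\<lambda>k' s'. \<exists>h' f'. s' = conf h' f' \<and> (\<exists>m' < m. P m' h' f')) s"
      unfolding W_def s(1) .
    then show "tmm.wp x n c (\<lambda>k' s'. \<exists>m' < m. ?P m' (k + k' + 2) s') s"
      by (rule tmm.wp_mono) blast
  next
    fix m k s assume "?P m k s" "\<not> ttst x n t s"
    then show "\<exists>h' f'. s = conf h' f' \<and> Q h' f'" using assms(3) ttst_conf by blast
  qed
  then show ?thesis unfolding W_def by simp
qed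

lemma W_next_token:
  assumes i: "i \<le> n" and j: "j < length toks" and r: "r < tlen j" "h i = int (pos j + r)"
    and Q: "Q (h(i := int (pos (Suc j)))) f"
  shows "W (next_token i) Q h f"
  unfolding next_token_def
proof (rule W_Seq, rule W_While[where P = "\<lambda>m h' f'. \<exists>r < tlen j.
    m = tlen j - r \<and> h' = h(i := int (pos j + r)) \<and> f' = f"])
  show "\<exists>r' < tlen j. tlen j - r = tlen j - r' \<and>
    h = h(i := int (pos j + r')) \<and> f = f"
    using r by (intro exI[of _ r]) (auto simp: fun_eq_iff)
next
  fix m h' f'
  assume "\<exists>r < tlen j. m = tlen j - r \<and> h' = h(i := int (pos j + r)) \<and> f' = f"
  then obtain r where r: "r < tlen j" "m = tlen j - r"
    and h': "h' = h(i := int (pos j + r))" and f': "f' = f" by blast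
  have cell: "cell C (h' i) = tk j ! r" using cell_token[OF j r(1)] by (simp add: h')
  have less: "h' i < int (length C)" using pos_less[OF j r(1)] by (simp add: h')
  {
    assume "holds (\<lambda>_ d _. is_bit (d i)) h' f'"
    then have Sr: "Suc r < tlen j" using i cell token_nth(1)[OF r(1)] by (simp add: holds_def)
    show "W (Act (MoveR i)) (\<lambda>h'' f''. \<exists>m' < m. \<exists>r < tlen j.
        m' = tlen j - r \<and> h'' = h(i := int (pos j + r)) \<and> f'' = f) h' f'"
    proof (rule W_MoveR, rule less, rule exI[of _ "m - 1"], rule conjI, goal_cases)
      case 1
      then show ?case using r Sr by simp
    next
      case 2
      then show ?case using r f' Sr by (intro exI[of _ "Suc r"]) (simp add: h' algebra_simps)
    qed
  next
    assume "\<not> holds (\<lambda>_ d _. is_bit (d i)) h' f'"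
    then have "Suc r = tlen j" using i cell token_nth(1)[OF r(1)] r(1) by (simp add: holds_def)
    then have "h'(i := h' i + 1) = h(i := int (pos (Suc j)))"
      using pos_Suc[OF j] by (simp add: h' fun_eq_iff)
    then show "W (Act (MoveR i)) Q h' f'" using Q f' less by (intro W_MoveR) simp_all
  }
qed

lemma W_token_start:
  assumes i: "i \<le> n" and j: "j < length toks" and r: "r < tlen j" "h i = int (pos j + r)"
    and Q: "Q (h(i := int (pos j))) f"
  shows "W (token_start i) Q h f"
  unfolding token_start_def
proof (rule W_Seq, rule W_MoveL)
  show "0 \<le> h i" using r by simp
  let ?h = "h(i := h i - 1)"
  show "W (Seq (While (\<lambda>_ d _. is_bit (d i)) (Act (MoveL i))) (Act (MoveR i))) Q ?h f"
  proof (rule W_Seq, rule W_While[where P = "\<lambda>m h' f'. m \<le> r \<and> h' = h(i := int (pos j + m) - 1) \<and> f' = f"])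
    show "r \<le> r \<and> ?h = h(i := int (pos j + r) - 1) \<and> f = f" using r by simp
  next
    fix m h' f'
    assume "m \<le> r \<and> h' = h(i := int (pos j + m) - 1) \<and> f' = f"
    then have m: "m \<le> r" and h': "h' = h(i := int (pos j + m) - 1)" and f': "f' = f" by auto
    {
      assume t: "holds (\<lambda>_ d _. is_bit (d i)) h' f'"
      have "m \<noteq> 0"
      proof
        assume "m = 0"
        then show False using t i cell_before[of j] j by (simp add: holds_def h')
      qed
      then show "W (Act (MoveL i)) (\<lambda>h'' f''. \<exists>m' < m. m' \<le> r \<and> h'' = h(i := int (pos j + m') - 1) \<and> f'' = f) h' f'"
        using m f' by (intro W_MoveL exI[of _ "m - 1"] conjI) (auto simp: h' of_nat_diff)
    next
      assume t: "\<not> holds (\<lambda>_ d _. is_bit (d i)) h' f'"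
      have "m = 0"
      proof (rule ccontr)
        assume "m \<noteq> 0"
        then have "int (pos j + m) - 1 = int (pos j + (m - 1))" by simp
        then have "cell C (h' i) = tk j ! (m - 1)"
          unfolding h' fun_upd_same using cell_token[OF j, of "m - 1"] m r \<open>m \<noteq> 0\<close> by (simp only:)
        moreover have "is_bit (tk j ! (m - 1))"
          using token_nth(1)[of "m - 1" "toks ! j"] m r \<open>m \<noteq> 0\<close> by simp
        ultimately show False using t i by (simp add: holds_def)
      qed
      then have "h'(i := h' i + 1) = h(i := int (pos j))" by (simp add: h')
      moreover have "h' i < int (length C)" using pos_le[of j] j \<open>m = 0\<close> by (simp add: h')
      ultimately show "W (Act (MoveR i)) Q h' f'" using Q f' by (intro W_MoveR) simp_all
    }
  qed
qed

lemma W_to_start: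
  assumes i: "i \<le> n" and h: "0 \<le> h i" "h i \<le> int (length C)" and Q: "Q (h(i := 0)) f"
  shows "W (to_start i) Q h f"
  unfolding to_start_def
proof (rule W_Seq, rule W_MoveL)
  show "0 \<le> h i" by (rule h)
  let ?h = "h(i := h i - 1)"
  show "W (Seq (While (\<lambda>_ d _. d i \<noteq> 0) (Act (MoveL i))) (Act (MoveR i))) Q ?h f"
  proof (rule W_Seq, rule W_While[where P = "\<lambda>m h' f'. m \<le> length C \<and> h' = h(i := int m - 1) \<and> f' = f"])
    show "nat (h i) \<le> length C \<and> ?h = h(i := int (nat (h i)) - 1) \<and> f = f" using h by simp
  next
    fix m h' f'
    assume "m \<le> length C \<and> h' = h(i := int m - 1) \<and> f' = f"
    then have m: "m \<le> length C" and h': "h' = h(i := int m - 1)" and f': "f' = f" by auto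
    {
      assume t: "holds (\<lambda>_ d _. d i \<noteq> 0) h' f'"
      have "m \<noteq> 0"
      proof
        assume "m = 0"
        then show False using t i by (simp add: holds_def h' cell_end)
      qed
      then show "W (Act (MoveL i)) (\<lambda>h'' f''. \<exists>m' < m. m' \<le> length C \<and> h'' = h(i := int m' - 1) \<and> f'' = f) h' f'"
        using m f' by (intro W_MoveL exI[of _ "m - 1"] conjI) (auto simp: h' of_nat_diff)
    next
      assume t: "\<not> holds (\<lambda>_ d _. d i \<noteq> 0) h' f'"
      have "m = 0"
      proof (rule ccontr)
        assume "m \<noteq> 0"
        then have "cell C (int m - 1) \<noteq> 0" using m by (intro cell_nonzero) auto
        then show False using t i by (simp add: holds_def h')
      qed
      moreover have "0 < length C" using pos_less[of 0 0] by (simp add: toks_def)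
      ultimately show "W (Act (MoveR i)) Q h' f'" using Q f' by (intro W_MoveR) (simp_all add: h')
    }
  qed
qed

text \<open>Both heads advance while they read equal bits. When the loop ends, the tokens agree iff
  the two current symbols do: if these are equal, they are no bits, so both tokens end here after
  equal prefixes.\<close>

lemma W_compare_token:
  assumes i: "i < n" and j: "j < length toks" "h n = int (pos j)" and j': "j' < length toks" "h i = int (pos j')"
    and Q: "Q (h(n := int (pos (Suc j)))) (if toks ! j = toks ! j' then f(3 := 1) else f)"
  shows "W (compare_token n i) Q h f"
  unfolding compare_token_def
proof (rule W_Seq, rule W_While[where P = "\<lambda>m h' f'. \<exists>r. r < tlen j \<and> r < tlen j' \<and>
    take r (tk j) = take r (tk j') \<and> m = tlen j - r \<and>
    h' = h(n := int (pos j + r), i := int (pos j' + r)) \<and> f' = f"])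
  show "\<exists>r. r < tlen j \<and> r < tlen j' \<and>
    take r (tk j) = take r (tk j') \<and> tlen j = tlen j - r \<and>
    h = h(n := int (pos j + r), i := int (pos j' + r)) \<and> f = f"
    using j j' by (intro exI[of _ 0]) (auto simp: fun_eq_iff)
next
  fix m h' f'
  assume "\<exists>r. r < tlen j \<and> r < tlen j' \<and>
    take r (tk j) = take r (tk j') \<and> m = tlen j - r \<and>
    h' = h(n := int (pos j + r), i := int (pos j' + r)) \<and> f' = f"
  then obtain r where r: "r < tlen j" and r': "r < tlen j'"
    and take: "take r (tk j) = take r (tk j')" and m: "m = tlen j - r"
    and h': "h' = h(n := int (pos j + r), i := int (pos j' + r))" and f': "f' = f" by blast
  have cell_n: "cell C (h' n) = tk j ! r" using cell_token[OF j(1) r] i by (simp add: h')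
  have cell_i: "cell C (h' i) = tk j' ! r" using cell_token[OF j'(1) r'] by (simp add: h')
  have less: "h' n < int (length C)" "h' i < int (length C)"
    using pos_less[OF j(1) r] pos_less[OF j'(1) r'] i by (simp_all add: h')
  {
    assume "holds (\<lambda>_ d _. is_bit (d n) \<and> d n = d i) h' f'"
    then have "is_bit (cell C (h' n)) \<and> cell C (h' n) = cell C (h' i)" using i by (auto simp: holds_def)
    then have bit: "is_bit (tk j ! r)" and eq: "tk j ! r = tk j' ! r"
      unfolding cell_n cell_i by blast+
    have r2: "Suc r < tlen j" "Suc r < tlen j'"
      using bit eq token_nth(1)[OF r] token_nth(1)[OF r'] by simp_all
    have take2: "take (Suc r) (tk j) = take (Suc r) (tk j')"
      using take eq r r' by (simp add: take_Suc_conv_app_nth)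
    have h2: "h'(n := h' n + 1, i := (h'(n := h' n + 1)) i + 1) = h(n := int (pos j + Suc r), i := int (pos j' + Suc r))"
      using i by (auto simp: h' fun_eq_iff)
    show "W (Seq (Act (MoveR n)) (Act (MoveR i))) (\<lambda>h'' f''. \<exists>m' < m. \<exists>r. r < tlen j \<and>
      r < tlen j' \<and> take r (tk j) = take r (tk j') \<and>
      m' = tlen j - r \<and> h'' = h(n := int (pos j + r), i := int (pos j' + r)) \<and> f'' = f) h' f'"
    proof (rule W_Seq, rule W_MoveR, rule less(1), rule W_MoveR)
      show "(h'(n := h' n + 1)) i < int (length C)" using less i by simp
      show "\<exists>m' < m. \<exists>r. r < tlen j \<and>
        r < tlen j' \<and> take r (tk j) = take r (tk j') \<and>
        m' = tlen j - r \<and>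
        h'(n := h' n + 1, i := (h'(n := h' n + 1)) i + 1) = h(n := int (pos j + r), i := int (pos j' + r)) \<and> f' = f"
      proof (rule exI[of _ "m - 1"], rule conjI, goal_cases)
        case 1
        then show ?case using r2 m by simp
      next
        case 2
        then show ?case unfolding h2 using r2 take2 f' m by (intro exI[of _ "Suc r"]) simp
      qed
    qed
  next
    assume exit: "\<not> holds (\<lambda>_ d _. is_bit (d n) \<and> d n = d i) h' f'"
    let ?f = "if toks ! j = toks ! j' then f(3 := 1) else f"
    have iff: "toks ! j = toks ! j' \<longleftrightarrow> tk j ! r = tk j' ! r"
    proof
      assume eq: "tk j ! r = tk j' ! r"
      moreover have "\<not> (is_bit (cell C (h' n)) \<and> cell C (h' n) = cell C (h' i))"
        using exit i by (auto simp: holds_def)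
      ultimately have "\<not> is_bit (tk j ! r)" unfolding cell_n cell_i by blast
      moreover from this have "\<not> is_bit (tk j' ! r)" unfolding eq .
      ultimately have "tlen j = Suc r" "tlen j' = Suc r"
        using token_nth(1)[OF r] token_nth(1)[OF r'] r r' by simp_all
      then have "tk j = take (Suc r) (tk j)" "tk j' = take (Suc r) (tk j')"
        by simp_all
      moreover have "take (Suc r) (tk j) = take (Suc r) (tk j')"
        using take eq r r' by (simp add: take_Suc_conv_app_nth)
      ultimately have "tk j = tk j'" by metis
      then show "toks ! j = toks ! j'" by (rule inj_token)
    qed simp
    have rest: "W (Seq (next_token n) (token_start i)) Q h' ?f"
    proof (rule W_Seq, rule W_next_token[OF _ j(1) r])
      show "h' n = int (pos j + r)" using i by (simp add: h')
      show "W (token_start i) Q (h'(n := int (pos (Suc j)))) ?f"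
      proof (rule W_token_start[OF _ j'(1) r'])
        show "(h'(n := int (pos (Suc j)))) i = int (pos j' + r)" using i by (simp add: h')
        have "h'(n := int (pos (Suc j)), i := int (pos j')) = h(n := int (pos (Suc j)))"
          using i j'(2) by (auto simp: h' fun_eq_iff)
        then show "Q (h'(n := int (pos (Suc j)), i := int (pos j'))) ?f" using Q by simp
      qed (use i in simp)
    qed simp
    show "W (Seq (If (\<lambda>_ d _. d n = d i) (Act (SetF 3 1)) Skip) (Seq (next_token n) (token_start i))) Q h' f'"
    proof (rule W_Seq, rule W_If)
      assume "holds (\<lambda>_ d _. d n = d i) h' f'"
      then have "?f = f'(3 := min 1 6)" using i cell_n cell_i iff f' by (simp add: holds_def)
      then show "W (Act (SetF 3 1)) (W (Seq (next_token n) (token_start i)) Q) h' f'"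
        using rest by (intro W_SetF) simp
    next
      assume "\<not> holds (\<lambda>_ d _. d n = d i) h' f'"
      then have "?f = f'" using i cell_n cell_i iff f' by (simp add: holds_def)
      then show "W Skip (W (Seq (next_token n) (token_start i)) Q) h' f'"
        using rest by (intro W_Skip) simp
    qed
  }
qed

text \<open>The last three premises are the possible outcomes: no letter to look for, the letter
  found, the letter absent. That \<open>q\<close> is its first occurrence from \<open>p\<close> on
  is what greedy matching needs.\<close>

lemma W_find_token:
  assumes w: "off + length w \<le> length toks" "\<And>p. p < length w \<Longrightarrow> toks ! (off + p) = Some (w ! p)"
    and stop: "cell C (int (pos (off + length w))) = stop" "stop = 0 \<or> stop = 4"
    and i: "i < n" and j: "j < length toks" "h i = int (pos j)" and p: "p \<le> length w" "h n = int (pos (off + p))"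
    and k: "k = 4 \<or> k = 5"
    and none: "toks ! j = None \<Longrightarrow> Q h f"
    and found: "\<And>m q. toks ! j = Some m \<Longrightarrow> p \<le> q \<Longrightarrow> q < length w \<Longrightarrow> w ! q = m \<Longrightarrow>
      m \<notin> set (take (q - p) (drop p w)) \<Longrightarrow> Q (h(n := int (pos (off + Suc q)))) (f(3 := 1))"
    and missing: "\<And>m. toks ! j = Some m \<Longrightarrow> m \<notin> set (drop p w) \<Longrightarrow>
      Q (h(n := int (pos (off + length w)))) (f(3 := 0, k := 1))"
  shows "W (find_token n stop k i) Q h f"
  unfolding find_token_def
proof (rule W_If)
  assume "holds (\<lambda>_ d _. d i = 4) h f"
  then have "tk j ! 0 = 4" using i j cell_pos[OF j(1)] by (simp add: holds_def)
  then have "toks ! j = None" using token_first(2) by (cases "toks ! j") auto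
  then show "W Skip Q h f" by (intro W_Skip none)
next
  assume "\<not> holds (\<lambda>_ d _. d i = 4) h f"
  then have "tk j ! 0 \<noteq> 4" using i j cell_pos[OF j(1)] by (simp add: holds_def)
  then obtain m where m: "toks ! j = Some m" by (cases "toks ! j") auto
  \<comment> \<open>With flag 3 set, the head has already passed the occurrence, hence
    \<open>q - 1\<close>.\<close>
  define P where "P = (\<lambda>l h' f'. \<exists>q \<le> length w. p \<le> q \<and> l = length w - q \<and> h' = h(n := int (pos (off + q))) \<and>
    (f' = f(3 := 0) \<and> m \<notin> set (take (q - p) (drop p w)) \<or>
     f' = f(3 := 1) \<and> p < q \<and> w ! (q - 1) = m \<and> m \<notin> set (take (q - 1 - p) (drop p w))))"
  show "W (Seq (Act (SetF 3 0)) (Seq (While (\<lambda>_ d g. g 3 = 0 \<and> d n \<noteq> stop) (compare_token n i))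
    (If (\<lambda>_ _ g. g 3 = 0) (Act (SetF k 1)) Skip))) Q h f"
  proof (rule W_Seq, rule W_SetF, rule W_Seq, rule W_While[where P = P])
    show "P (length w - p) h (f(3 := min 0 6))"
      unfolding P_def using p by (intro exI[of _ p]) (auto simp: fun_eq_iff)
  next
    fix l h' f'
    assume P: "P l h' f'" and t: "holds (\<lambda>_ d g. g 3 = 0 \<and> d n \<noteq> stop) h' f'"
    then have f'3: "f' 3 = 0" and cell: "cell C (h' n) \<noteq> stop" by (simp_all add: holds_def)
    then obtain q where q: "q \<le> length w" "p \<le> q" "l = length w - q" and h': "h' = h(n := int (pos (off + q)))"
      and f': "f' = f(3 := 0)" and notin: "m \<notin> set (take (q - p) (drop p w))"
      using P unfolding P_def by auto
    have "q \<noteq> length w" using cell stop(1) by (auto simp: h')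
    then have q_less: "q < length w" using q by simp
    then have tok: "off + q < length toks" "toks ! (off + q) = Some (w ! q)" using w by simp_all
    have take_q: "take (Suc q - p) (drop p w) = take (q - p) (drop p w) @ [w ! q]"
      using q q_less by (simp add: Suc_diff_le take_Suc_conv_app_nth)
    show "W (compare_token n i) (\<lambda>h' f'. \<exists>l' < l. P l' h' f') h' f'"
    proof (rule W_compare_token[OF i tok(1) _ j(1)])
      show "h' n = int (pos (off + q))" by (simp add: h')
      show "h' i = int (pos j)" using i j(2) by (simp add: h')
      show "\<exists>l' < l. P l' (h'(n := int (pos (Suc (off + q))))) (if toks ! (off + q) = toks ! j then f'(3 := 1) else f')"
      proof (intro exI[of _ "length w - Suc q"] conjI)
        show "length w - Suc q < l" using q q_less by simp
        show "P (length w - Suc q) (h'(n := int (pos (Suc (off + q))))) (if toks ! (off + q) = toks ! j then f'(3 := 1) else f')"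
          unfolding P_def
        proof (intro exI[of _ "Suc q"] conjI)
          show "(if toks ! (off + q) = toks ! j then f'(3 := 1) else f') = f(3 := 0) \<and> m \<notin> set (take (Suc q - p) (drop p w)) \<or>
            (if toks ! (off + q) = toks ! j then f'(3 := 1) else f') = f(3 := 1) \<and> p < Suc q \<and> w ! (Suc q - 1) = m \<and>
            m \<notin> set (take (Suc q - 1 - p) (drop p w))"
            using notin q unfolding take_q by (cases "w ! q = m") (simp_all add: tok(2) m f')
        qed (use q q_less h' in simp_all)
      qed
    qed
  next
    fix l h' f'
    assume P: "P l h' f'" and t: "\<not> holds (\<lambda>_ d g. g 3 = 0 \<and> d n \<noteq> stop) h' f'"
    from P obtain q where q: "q \<le> length w" "p \<le> q" and h': "h' = h(n := int (pos (off + q)))"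
      and cases: "f' = f(3 := 0) \<and> m \<notin> set (take (q - p) (drop p w)) \<or>
        f' = f(3 := 1) \<and> p < q \<and> w ! (q - 1) = m \<and> m \<notin> set (take (q - 1 - p) (drop p w))"
      unfolding P_def by blast
    show "W (If (\<lambda>_ _ g. g 3 = 0) (Act (SetF k 1)) Skip) Q h' f'"
    proof (rule W_If)
      assume "holds (\<lambda>_ _ g. g 3 = 0) h' f'"
      then have f'3: "f' 3 = 0" by (simp add: holds_def)
      then have f': "f' = f(3 := 0)" and notin: "m \<notin> set (take (q - p) (drop p w))" using cases by auto
      have "cell C (h' n) = stop" using t f'3 by (simp add: holds_def)
      \<comment> \<open>No variable token begins with 0 or 4, so the stop symbol is met only behind
        the last letter.\<close>
      have "q = length w"
      proof (rule ccontr)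
        assume "q \<noteq> length w"
        then have "q < length w" using q by simp
        then have "off + q < length toks" "toks ! (off + q) = Some (w ! q)" using w by simp_all
        then have "cell C (h' n) = token (Some (w ! q)) ! 0" using cell_pos by (simp add: h')
        then show False using \<open>cell C (h' n) = stop\<close> stop(2) token_first[of "w ! q"] by auto
      qed
      then have "Q h' (f'(k := 1))" using missing[OF m] notin by (simp add: h' f')
      then show "W (Act (SetF k 1)) Q h' f'" by (intro W_SetF) simp
    next
      assume "\<not> holds (\<lambda>_ _ g. g 3 = 0) h' f'"
      then have "f' 3 \<noteq> 0" by (simp add: holds_def)
      then have f': "f' = f(3 := 1)" and pq: "p < q" "w ! (q - 1) = m" "m \<notin> set (take (q - 1 - p) (drop p w))"
        using cases by auto
      then have "Q (h(n := int (pos (off + Suc (q - 1))))) (f(3 := 1))"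
        using q by (intro found[OF m]) auto
      then show "W Skip Q h' f'" using pq by (intro W_Skip) (simp add: h' f')
    qed
  qed
qed

section \<open>Greedy matching of a whole word\<close>

abbreviation scanned :: "(nat \<Rightarrow> int) \<Rightarrow> (nat \<Rightarrow> int) \<Rightarrow> bool" where
  "scanned h h' \<equiv> (\<forall>i. i \<noteq> n \<longrightarrow> h' i = h i) \<and> 0 \<le> h' n \<and> h' n \<le> int (length C)"

definition letter :: "nat \<Rightarrow> nat list" where
  "letter j = (case toks ! j of None \<Rightarrow> [] | Some m \<Rightarrow> [m])"

abbreviation letters :: "(nat \<Rightarrow> nat) \<Rightarrow> nat list \<Rightarrow> nat list" where
  "letters J is \<equiv> concat (map (\<lambda>i. letter (J i)) is)"

abbreviation match_post :: "nat \<Rightarrow> nat list \<Rightarrow> nat list \<Rightarrow> (nat \<Rightarrow> int) \<Rightarrow> (nat \<Rightarrow> nat) \<Rightarrow>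
    (nat \<Rightarrow> int) \<Rightarrow> (nat \<Rightarrow> nat) \<Rightarrow> bool" where
  "match_post k y w h f \<equiv> \<lambda>h' f'. scanned h h' \<and> (\<forall>l. l \<noteq> 3 \<and> l \<noteq> k \<longrightarrow> f' l = f l) \<and>
     f' k = (if subseq y w then f k else 1)"

text \<open>After a failure the remaining searches still run, but none of them resets flag
  \<open>k\<close>, so it stays 1.\<close>

lemma W_match:
  assumes w: "off + length w \<le> length toks" "\<And>p. p < length w \<Longrightarrow> toks ! (off + p) = Some (w ! p)"
    and stop: "cell C (int (pos (off + length w))) = stop" "stop = 0 \<or> stop = 4"
    and J: "\<And>i. i \<in> set is \<Longrightarrow> i < n \<and> J i < length toks \<and> h i = int (pos (J i))"
    and p: "p \<le> length w" "h n = int (pos (off + p))"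
    and k: "k = 4 \<or> k = 5"
  shows "W (match n stop k is) (match_post k (letters J is) (drop p w) h f) h f"
  using J p
proof (induction "is" arbitrary: h f p)
  case Nil
  have "pos (off + p) \<le> length C" using w(1) Nil.prems(2) by (intro pos_le) simp
  then show ?case using Nil.prems by (auto intro!: W_Skip)
next
  case (Cons i "is")
  have i: "i < n" "J i < length toks" "h i = int (pos (J i))" using Cons.prems(1)[of i] by simp_all
  have IH: "W (match n stop k is) (\<lambda>h' f'. scanned h h' \<and>
      (\<forall>l. l \<noteq> 3 \<and> l \<noteq> k \<longrightarrow> f' l = f l) \<and> f' k = (if b then f k else 1)) (h(n := int (pos (off + q)))) g"
    if "q \<le> length w" "\<And>l. l \<noteq> 3 \<Longrightarrow> l \<noteq> k \<Longrightarrow> g l = f l"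
      "(if subseq (letters J is) (drop q w) then g k else 1) = (if b then f k else 1)" for q g b
  proof (rule W_mono[OF Cons.IH[of "h(n := int (pos (off + q)))" q g]], goal_cases)
    case (1 i')
    then show ?case using Cons.prems(1)[of i'] by auto
  next
    case (4 h' f')
    then show ?case using that by auto
  qed (use that in simp_all)
  show ?case
    unfolding match.simps
  proof (rule W_Seq, rule W_find_token[OF w stop i Cons.prems(2,3) k], assumption)
    assume "toks ! J i = None"
    then have "letter (J i) = []" by (simp add: letter_def)
    then show "W (match n stop k is) (match_post k (letters J (i # is)) (drop p w) h f) h f"
      using IH[OF Cons.prems(2), of f] Cons.prems(3)[symmetric] by simp
  next
    fix m q
    assume m: "toks ! J i = Some m" and q: "p \<le> q" "q < length w" "w ! q = m" "m \<notin> set (take (q - p) (drop p w))"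
    have "drop p w = take (q - p) (drop p w) @ m # drop (Suc q) w"
      using q id_take_nth_drop[of "q - p" "drop p w"] by simp
    then have "subseq (m # y) (drop p w) \<longleftrightarrow> subseq y (drop (Suc q) w)" for y
      using subseq_Cons_first[OF q(4)] by metis
    then show "W (match n stop k is) (match_post k (letters J (i # is)) (drop p w) h f)
      (h(n := int (pos (off + Suc q)))) (f(3 := 1))"
      using q k by (intro IH) (auto simp: letter_def m)
  next
    fix m
    assume m: "toks ! J i = Some m" "m \<notin> set (drop p w)"
    then have "\<not> subseq (m # y) (drop p w)" for y
      using subseq_set[of "m # y" "drop p w" m] by auto
    then show "W (match n stop k is) (match_post k (letters J (i # is)) (drop p w) h f)
      (h(n := int (pos (off + length w)))) (f(3 := 0, k := 1))"
      by (intro IH) (auto simp: letter_def m(1))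
  qed
qed

definition word :: "(nat \<Rightarrow> nat) \<Rightarrow> nat list" where
  "word J = letters J [0..<n]"

lemma length_toks: "length toks = length u + 1 + length v"
  by (simp add: toks_def)

lemma toks_u: "p < length u \<Longrightarrow> toks ! p = Some (u ! p)"
  by (simp add: toks_def nth_append)

lemma toks_sep: "toks ! length u = None"
  by (simp add: toks_def nth_append)

lemma toks_v: "p < length v \<Longrightarrow> toks ! (Suc (length u) + p) = Some (v ! p)"
  by (simp add: toks_def nth_append)

lemma cell_sep: "cell C (int (pos (length u))) = 4"
  using cell_pos[of "length u"] by (simp add: length_toks toks_sep)

text \<open>The tokens of \<open>u\<close> contain no 4, so a scan for 4 from the left ends at the
  separator.\<close>

lemma cell_u:
  assumes "i < pos (length u)"
  shows "cell C (int i) \<noteq> 4"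
proof -
  have take: "concat (map token (take (length u) toks)) = concat (map var_symbols u)"
    by (simp add: toks_def comp_def)
  have "4 \<notin> set (concat (map var_symbols u))" by (auto simp: var_symbols_def bit_code_def)
  moreover have "cell C (int i) = concat (map var_symbols u) ! i"
  proof -
    have "i < length (concat (map var_symbols u))" using assms unfolding pos_def take .
    then show ?thesis by (simp add: cell_def x pairs_encode_identity nth_append)
  qed
  ultimately show ?thesis using assms nth_mem unfolding pos_def take by metis
qed

abbreviation check_post :: "(nat \<Rightarrow> nat) \<Rightarrow> (nat \<Rightarrow> int) \<Rightarrow> (nat \<Rightarrow> nat) \<Rightarrow>
    (nat \<Rightarrow> int) \<Rightarrow> (nat \<Rightarrow> nat) \<Rightarrow> bool" where
  "check_post J h f \<equiv> \<lambda>h' f'. scanned h h' \<and>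
     f' 2 = (if subseq (word J) u \<longleftrightarrow> subseq (word J) v then f 2 else 1)"

lemma W_check_word:
  assumes J: "\<And>i. i < n \<Longrightarrow> J i < length toks \<and> h i = int (pos (J i))" and h: "0 \<le> h n" "h n \<le> int (length C)"
  shows "W (check_word n) (check_post J h f) h f"
  unfolding check_word_def
proof (rule W_Seq, rule W_SetF, rule W_Seq, rule W_to_start, simp, rule h, rule h, rule W_Seq)
  let ?h = "h(n := 0)" and ?f = "f(4 := min 0 6)"
  have "W (match n 4 4 [0..<n]) (\<lambda>h' f'. scanned ?h h' \<and>
    (\<forall>l. l \<noteq> 3 \<and> l \<noteq> 4 \<longrightarrow> f' l = ?f l) \<and>
    f' 4 = (if subseq (letters J [0..<n]) (drop 0 u) then ?f 4 else 1)) ?h ?f"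
    by (rule W_match[where off = 0]) (use J in \<open>auto simp: length_toks toks_u cell_sep\<close>)
  then show "W (match n 4 4 [0..<n]) (W (Seq (Act (SetF 5 0)) (Seq (to_start n) (Seq (While (\<lambda>_ d _. d n \<noteq> 4) (Act (MoveR n)))
     (Seq (Act (MoveR n)) (Seq (match n 0 5 [0..<n])
     (If (\<lambda>_ _ g. g 4 \<noteq> g 5) (Act (SetF 2 1)) Skip))))))
     (check_post J h f)) ?h ?f"
  proof (rule W_mono, goal_cases)
    case (1 h1 f1)
    then have h1: "\<And>i. i \<noteq> n \<Longrightarrow> h1 i = h i" "0 \<le> h1 n" "h1 n \<le> int (length C)" and f1: "f1 2 = f 2"
      "f1 4 = (if subseq (word J) u then 0 else 1)"
      by (simp_all add: word_def)
    let ?f1 = "f1(5 := min 0 6)"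
    show ?case
    proof (rule W_Seq, rule W_SetF, rule W_Seq, rule W_to_start, simp, rule h1, rule h1, rule W_Seq,
        rule W_While[where P = "\<lambda>m h' f'. m \<le> pos (length u) \<and> h' = h1(n := int (pos (length u) - m)) \<and> f' = ?f1"])
      show "pos (length u) \<le> pos (length u) \<and> h1(n := 0) = h1(n := int (pos (length u) - pos (length u))) \<and> ?f1 = ?f1"
        by simp
    next
      fix m h' f'
      assume "m \<le> pos (length u) \<and> h' = h1(n := int (pos (length u) - m)) \<and> f' = ?f1"
      then have m: "m \<le> pos (length u)" and h': "h' = h1(n := int (pos (length u) - m))" and f': "f' = ?f1" by auto
      have pos_u: "pos (length u) < length C" using pos_less[of "length u" 0] by (simp add: length_toks)
      {
        assume t: "holds (\<lambda>_ d _. d n \<noteq> 4) h' f'"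
        have "m \<noteq> 0"
        proof
          assume "m = 0"
          then show False using t cell_sep by (simp add: holds_def h')
        qed
        then show "W (Act (MoveR n)) (\<lambda>h' f'. \<exists>m' < m. m' \<le> pos (length u) \<and>
            h' = h1(n := int (pos (length u) - m')) \<and> f' = ?f1) h' f'"
          using m f' pos_u by (intro W_MoveR exI[of _ "m - 1"] conjI) (auto simp: h')
      next
        assume t: "\<not> holds (\<lambda>_ d _. d n \<noteq> 4) h' f'"
        have "m = 0"
        proof (rule ccontr)
          assume "m \<noteq> 0"
          then have "cell C (h' n) \<noteq> 4" unfolding h' fun_upd_same using m by (intro cell_u) simp
          then show False using t by (simp add: holds_def)
        qed
        then have h'_n: "h' n = int (pos (length u))" by (simp add: h')
        let ?h2 = "h'(n := h' n + 1)"
        have h2: "?h2 n = int (pos (Suc (length u) + 0))" "\<And>i. i \<noteq> n \<Longrightarrow> ?h2 i = h i"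
          using pos_Suc[of "length u"] h1 by (simp_all add: length_toks toks_sep h'_n) (simp add: h')
        have "W (match n 0 5 [0..<n]) (\<lambda>h'' f''. scanned ?h2 h'' \<and>
          (\<forall>l. l \<noteq> 3 \<and> l \<noteq> 5 \<longrightarrow> f'' l = f' l) \<and>
          f'' 5 = (if subseq (letters J [0..<n]) (drop 0 v) then f' 5 else 1)) ?h2 f'"
        proof (rule W_match[where off = "Suc (length u)"])
          show "cell C (int (pos (Suc (length u) + length v))) = 0"
            using pos_end cell_end by (simp add: length_toks)
          show "?h2 n = int (pos (Suc (length u) + 0))" by (rule h2)
          show "i < n \<and> J i < length toks \<and> ?h2 i = int (pos (J i))" if "i \<in> set [0..<n]" for i
            using that J[of i] h2(2)[of i] by simp
        qed (use toks_v in \<open>auto simp: length_toks\<close>)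
        then show "W (Seq (Act (MoveR n)) (Seq (match n 0 5 [0..<n]) (If (\<lambda>_ _ g. g 4 \<noteq> g 5) (Act (SetF 2 1)) Skip)))
          (check_post J h f) h' f'"
        proof (intro W_Seq W_MoveR, goal_cases)
          case 1
          then show ?case using h'_n pos_u by simp
        next
          case 2
          then show ?case
          proof (rule W_mono, goal_cases)
            case (1 h3 f3)
            then have h3: "\<And>i. i \<noteq> n \<Longrightarrow> h3 i = h i" "0 \<le> h3 n" "h3 n \<le> int (length C)"
              and f3: "f3 2 = f 2" "f3 4 = (if subseq (word J) u then 0 else 1)"
                "f3 5 = (if subseq (word J) v then 0 else 1)"
              using h2(2) f1 by (simp_all add: word_def f')
            have iff: "holds (\<lambda>_ _ g. g 4 \<noteq> g 5) h3 f3 \<longleftrightarrow> \<not> (subseq (word J) u \<longleftrightarrow> subseq (word J) v)"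
              by (simp add: holds_def f3)
            show ?case
            proof (rule W_If)
              assume "holds (\<lambda>_ _ g. g 4 \<noteq> g 5) h3 f3"
              then show "W (Act (SetF 2 1)) (check_post J h f) h3 f3"
                unfolding iff using h3 by (intro W_SetF) simp
            next
              assume "\<not> holds (\<lambda>_ _ g. g 4 \<noteq> g 5) h3 f3"
              then show "W Skip (check_post J h f) h3 f3"
                unfolding iff using h3 f3(1) by (intro W_Skip) simp
            qed
          qed
        qed
      }
    qed
  qed
qed

section \<open>The loops over all words of length at most \<open>n\<close>\<close>

definition agree :: "(nat \<Rightarrow> nat) \<Rightarrow> bool" where
  "agree J \<longleftrightarrow> (subseq (word J) u \<longleftrightarrow> subseq (word J) v)"

text \<open>The part of the verdict that the loops below level \<open>d\<close> contribute, the
  heads from \<open>d\<close> on being fixed by \<open>J\<close>.\<close>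

definition all_agree :: "nat \<Rightarrow> (nat \<Rightarrow> nat) \<Rightarrow> bool" where
  "all_agree d J \<longleftrightarrow> (\<forall>J'. (\<forall>i \<ge> d. J' i = J i) \<longrightarrow> (\<forall>i < d. J' i < length toks) \<longrightarrow> agree J')"

lemma all_agree_0: "all_agree 0 J \<longleftrightarrow> agree J"
proof -
  have "(\<forall>i \<ge> 0. J' i = J i) \<longleftrightarrow> J' = J" for J' by auto
  then show ?thesis unfolding all_agree_def by auto
qed

lemma all_agree_Suc: "all_agree (Suc d) J \<longleftrightarrow> (\<forall>j < length toks. all_agree d (J(d := j)))"
proof
  assume A: "all_agree (Suc d) J"
  show "\<forall>j < length toks. all_agree d (J(d := j))"
  proof (intro allI impI)
    fix j assume j: "j < length toks"
    show "all_agree d (J(d := j))"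
      unfolding all_agree_def
    proof (intro allI impI)
      fix J' assume J': "\<forall>i \<ge> d. J' i = (J(d := j)) i" "\<forall>i < d. J' i < length toks"
      have "\<forall>i \<ge> Suc d. J' i = J i" using J'(1) by auto
      moreover have "\<forall>i < Suc d. J' i < length toks" using J' j by (auto simp: less_Suc_eq)
      ultimately show "agree J'" using A unfolding all_agree_def by blast
    qed
  qed
next
  assume A: "\<forall>j < length toks. all_agree d (J(d := j))"
  show "all_agree (Suc d) J"
    unfolding all_agree_def
  proof (intro allI impI)
    fix J' assume J': "\<forall>i \<ge> Suc d. J' i = J i" "\<forall>i < Suc d. J' i < length toks"
    have "\<forall>i \<ge> d. J' i = (J(d := J' d)) i" using J'(1) by (auto simp: Suc_le_eq)
    moreover have "\<forall>i < d. J' i < length toks" "J' d < length toks" using J'(2) by auto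
    ultimately show "agree J'" using A unfolding all_agree_def by blast
  qed
qed

text \<open>Flag 2 is set but never cleared here, so it accumulates the verdict. The heads below
  \<open>d\<close> may end anywhere on the tape, since \<open>to_start\<close> brings them
  back.\<close>

lemma W_check_all:
  assumes "d \<le> n" "\<And>i. d \<le> i \<Longrightarrow> i < n \<Longrightarrow> J i < length toks \<and> h i = int (pos (J i))"
    and "\<And>i. i \<le> n \<Longrightarrow> 0 \<le> h i \<and> h i \<le> int (length C)"
  shows "W (check_all n d) (\<lambda>h' f'. (\<forall>i. d \<le> i \<and> i < n \<longrightarrow> h' i = h i) \<and> (\<forall>i \<le> n. 0 \<le> h' i \<and> h' i \<le> int (length C)) \<and>
    f' 2 = (if all_agree d J then f 2 else 1)) h f"
  using assms
proof (induction d arbitrary: J h f)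
  case 0
  have "W (check_word n) (check_post J h f) h f"
    using "0.prems"(2)[OF le0] "0.prems"(3)[of n] by (intro W_check_word) auto
  then show ?case
    unfolding check_all.simps
  proof (rule W_mono, goal_cases)
    case (1 h' f')
    then have "0 \<le> h' i \<and> h' i \<le> int (length C)" if "i \<le> n" for i
      using "0.prems"(3)[OF that] by (cases "i = n") auto
    then show ?case using 1 by (auto simp: all_agree_0 agree_def)
  qed
next
  case (Suc d)
  have d: "d < n" using Suc.prems(1) by simp
  define P where "P = (\<lambda>m h' (f' :: nat \<Rightarrow> nat). \<exists>j \<le> length toks. m = length toks - j \<and> h' d = int (pos j) \<and>
    (\<forall>i. Suc d \<le> i \<and> i < n \<longrightarrow> h' i = h i) \<and> (\<forall>i \<le> n. 0 \<le> h' i \<and> h' i \<le> int (length C)) \<and>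
    f' 2 = (if \<forall>j' < j. all_agree d (J(d := j')) then f 2 else 1))"
  show ?case
    unfolding check_all.simps
  proof (rule W_Seq, rule W_to_start)
    show "d \<le> n" "0 \<le> h d" "h d \<le> int (length C)" using d Suc.prems(3)[of d] by simp_all
    show "W (While (\<lambda>_ e _. e d \<noteq> 0) (Seq (check_all n d) (next_token d)))
      (\<lambda>h' f'. (\<forall>i. Suc d \<le> i \<and> i < n \<longrightarrow> h' i = h i) \<and> (\<forall>i \<le> n. 0 \<le> h' i \<and> h' i \<le> int (length C)) \<and>
        f' 2 = (if all_agree (Suc d) J then f 2 else 1)) (h(d := 0)) f"
    proof (rule W_While[where P = P])
      show "P (length toks) (h(d := 0)) f"
        unfolding P_def using Suc.prems(3) by (intro exI[of _ 0]) auto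
    next
      fix m h1 f1
      assume P: "P m h1 f1" and t: "holds (\<lambda>_ e _. e d \<noteq> 0) h1 f1"
      obtain j where j: "j \<le> length toks" "m = length toks - j" and h1_d: "h1 d = int (pos j)"
        and h1: "\<And>i. Suc d \<le> i \<Longrightarrow> i < n \<Longrightarrow> h1 i = h i" "\<And>i. i \<le> n \<Longrightarrow> 0 \<le> h1 i \<and> h1 i \<le> int (length C)"
        and f1: "f1 2 = (if \<forall>j' < j. all_agree d (J(d := j')) then f 2 else 1)"
        using P unfolding P_def by blast
      have "j \<noteq> length toks"
      proof
        assume "j = length toks"
        then show False using t d by (simp add: holds_def h1_d pos_end cell_end)
      qed
      then have j_less: "j < length toks" using j by simp
      have "W (check_all n d) (\<lambda>h' f'. (\<forall>i. d \<le> i \<and> i < n \<longrightarrow> h' i = h1 i) \<and>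
        (\<forall>i \<le> n. 0 \<le> h' i \<and> h' i \<le> int (length C)) \<and>
        f' 2 = (if all_agree d (J(d := j)) then f1 2 else 1)) h1 f1"
      proof (rule Suc.IH)
        show "(J(d := j)) i < length toks \<and> h1 i = int (pos ((J(d := j)) i))" if "d \<le> i" "i < n" for i
          using that j_less h1_d h1(1)[of i] Suc.prems(2)[of i] by (cases "i = d") auto
      qed (use d h1(2) in auto)
      then show "W (Seq (check_all n d) (next_token d)) (\<lambda>h' f'. \<exists>m' < m. P m' h' f') h1 f1"
      proof (intro W_Seq, rule W_mono, goal_cases)
        case (1 h2 f2)
        then have h2: "\<And>i. d \<le> i \<Longrightarrow> i < n \<Longrightarrow> h2 i = h1 i" "\<And>i. i \<le> n \<Longrightarrow> 0 \<le> h2 i \<and> h2 i \<le> int (length C)"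
          and f2: "f2 2 = (if all_agree d (J(d := j)) then f1 2 else 1)" by auto
        show ?case
        proof (rule W_next_token[OF _ j_less])
          show "d \<le> n" using d by simp
          show "0 < tlen j" by simp
          show "h2 d = int (pos j + 0)" using h2(1)[of d] d h1_d by simp
          show "\<exists>m' < m. P m' (h2(d := int (pos (Suc j)))) f2"
          proof (rule exI[of _ "length toks - Suc j"], rule conjI)
            show "length toks - Suc j < m" using j j_less by simp
            show "P (length toks - Suc j) (h2(d := int (pos (Suc j)))) f2"
              unfolding P_def
            proof (rule exI[of _ "Suc j"], intro conjI)
              show "f2 2 = (if \<forall>j' < Suc j. all_agree d (J(d := j')) then f 2 else 1)"
                unfolding f2 f1 by (auto simp: less_Suc_eq)
              show "\<forall>i. Suc d \<le> i \<and> i < n \<longrightarrow> (h2(d := int (pos (Suc j)))) i = h i"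
                using h2(1) h1(1) by auto
              show "\<forall>i \<le> n. 0 \<le> (h2(d := int (pos (Suc j)))) i \<and> (h2(d := int (pos (Suc j)))) i \<le> int (length C)"
                using h2(2) pos_le[of "Suc j"] j_less by auto
            qed (use j_less in auto)
          qed
        qed
      qed
    next
      fix m h1 f1
      assume P: "P m h1 f1" and t: "\<not> holds (\<lambda>_ e _. e d \<noteq> 0) h1 f1"
      obtain j where j: "j \<le> length toks" and h1_d: "h1 d = int (pos j)"
        and h1: "\<forall>i. Suc d \<le> i \<and> i < n \<longrightarrow> h1 i = h i" "\<forall>i \<le> n. 0 \<le> h1 i \<and> h1 i \<le> int (length C)"
        and f1: "f1 2 = (if \<forall>j' < j. all_agree d (J(d := j')) then f 2 else 1)"
        using P unfolding P_def by blast
      have "j = length toks"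
      proof (rule ccontr)
        assume "j \<noteq> length toks"
        then have "j < length toks" using j by simp
        then show False using t d cell_pos[of j] token_nth(2)[of 0 "toks ! j"] by (simp add: holds_def h1_d)
      qed
      then have "f1 2 = (if all_agree (Suc d) J then f 2 else 1)" unfolding f1 all_agree_Suc by simp
      then show "(\<forall>i. Suc d \<le> i \<and> i < n \<longrightarrow> h1 i = h i) \<and> (\<forall>i \<le> n. 0 \<le> h1 i \<and> h1 i \<le> int (length C)) \<and>
        f1 2 = (if all_agree (Suc d) J then f 2 else 1)" using h1 by blast
    qed
  qed
qed

lemma length_word: "length (word J) \<le> n"
proof -
  have "length (letters J is) \<le> length is" for "is"
    by (induction "is") (auto simp: letter_def split: option.splits)
  from this[of "[0..<n]"] show ?thesis by (simp add: word_def)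
qed

lemma ex_word:
  assumes "length w \<le> n" "set w \<subseteq> set u \<union> set v"
  shows "\<exists>J. (\<forall>i < n. J i < length toks) \<and> (\<forall>i \<ge> n. J i = 0) \<and> word J = w"
proof -
  have "\<exists>j < length toks. toks ! j = Some a" if "a \<in> set w" for a
  proof -
    have "Some a \<in> set toks" using that assms(2) by (auto simp: toks_def)
    then show ?thesis by (metis in_set_conv_nth)
  qed
  then obtain g where g: "\<And>a. a \<in> set w \<Longrightarrow> g a < length toks \<and> toks ! g a = Some a" by metis
  \<comment> \<open>Surplus positions point to the separator, token number \<open>length u\<close>,
    which contributes no letter; indices from \<open>n\<close> on take the default 0 used in
    \<open>all_agree n (\<lambda>_. 0)\<close>.\<close>
  define J where "J = (\<lambda>i. if i < length w then g (w ! i) else if i < n then length u else 0)"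
  have "word J = concat (map (\<lambda>i. if i < length w then [w ! i] else []) [0..<n])"
    unfolding word_def using g toks_sep by (intro arg_cong[of _ _ concat] map_cong) (auto simp: J_def letter_def)
  also have "[0..<n] = [0..<length w] @ [length w..<n]"
    using upt_add_eq_append[of 0 "length w" "n - length w"] assms(1) by simp
  also have "concat (map (\<lambda>i. if i < length w then [w ! i] else []) ([0..<length w] @ [length w..<n]))
    = concat (map (\<lambda>i. [w ! i]) [0..<length w]) @ concat (map (\<lambda>i. []) [length w..<n])"
    unfolding map_append concat_append by (intro arg_cong2[of _ _ _ _ "(@)"] arg_cong[of _ _ concat] map_cong) auto
  also have "\<dots> = w" by (simp add: map_nth)
  finally show ?thesis
    using g assms(1) by (intro exI[of _ J]) (auto simp: J_def length_toks)
qed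

lemma all_agree_iff: "all_agree n (\<lambda>_. 0) \<longleftrightarrow> subwords n u = subwords n v"
proof
  assume A: "all_agree n (\<lambda>_. 0)"
  have "subseq w u \<longleftrightarrow> subseq w v" if len: "length w \<le> n" for w
  proof (cases "set w \<subseteq> set u \<union> set v")
    case True
    then obtain J where "\<forall>i < n. J i < length toks" "\<forall>i \<ge> n. J i = 0" "word J = w"
      using ex_word[OF len] by blast
    then show ?thesis using A unfolding all_agree_def agree_def by metis
  next
    \<comment> \<open>A word with a foreign letter is a subword of neither side, so the loops need
      not visit it.\<close>
    case False
    then obtain a where a: "a \<in> set w" "a \<notin> set u" "a \<notin> set v" by blast
    have "\<not> subseq w u" using subseq_set[OF _ a(1)] a(2) by auto
    moreover have "\<not> subseq w v" using subseq_set[OF _ a(1)] a(3) by auto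
    ultimately show ?thesis by simp
  qed
  then show "subwords n u = subwords n v" by (auto simp: subwords_def)
next
  assume E: "subwords n u = subwords n v"
  have "agree J" for J
  proof -
    have "word J \<in> subwords n u \<longleftrightarrow> word J \<in> subwords n v" using E by simp
    then show ?thesis using length_word[of J] by (simp add: agree_def subwords_def)
  qed
  then show "all_agree n (\<lambda>_. 0)" unfolding all_agree_def by blast
qed

end

lemma decide_tm_spec:
  "tmm.wp x n (decide_tm n) (\<lambda>k s. ttst x n (\<lambda>_ _ g. g 2 = 0) s \<longleftrightarrow> x \<in> encode_identity ` Check_Id (styl n)) init_state"
  unfolding decide_tm_def tmm.wp_Seq
proof (rule tmm.wp_mono[OF copy_spec], elim exE)
  fix k s a i
  assume s: "s = copying x [] (pairs x) a (dfa_run 0 x) i"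
  have flag: "ttst x n (\<lambda>_ _ g. g 1 = 3) s \<longleftrightarrow> dfa_run 0 x = 3"
    by (simp add: ttst_def s copying_def)
  show "tmm.wp x n (If (\<lambda>_ _ g. g 1 = 3) (check_all n n) (Act (SetF 2 1)))
    (\<lambda>k' s. ttst x n (\<lambda>_ _ g. g 2 = 0) s \<longleftrightarrow> x \<in> encode_identity ` Check_Id (styl n)) s"
  proof (cases "dfa_run 0 x = 3")
    case False
    then have "x \<notin> encode_identity ` Check_Id (styl n)" using dfa_run_iff[of x] by auto
    then show ?thesis using False flag by (simp add: ttst_def)
  next
    case True
    then obtain u v where x: "x = encode_identity (u, v)" using dfa_run_iff[of x] by auto
    interpret tm_check n x u v i by unfold_locales (rule x)
    have s_conf: "s = conf (\<lambda>_. int (length (pairs x))) ((\<lambda>_ :: nat. 0)(0 := a, 1 := dfa_run 0 x))"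
      by (simp add: s copying_def conf_def)
    have "W (check_all n n) (\<lambda>h' f'. (\<forall>i. n \<le> i \<and> i < n \<longrightarrow> h' i = int (length (pairs x))) \<and>
      (\<forall>i \<le> n. 0 \<le> h' i \<and> h' i \<le> int (length (pairs x))) \<and>
      f' 2 = (if all_agree n (\<lambda>_. 0) then ((\<lambda>_ :: nat. 0)(0 := a, 1 := dfa_run 0 x)) 2 else 1))
      (\<lambda>_. int (length (pairs x))) ((\<lambda>_ :: nat. 0)(0 := a, 1 := dfa_run 0 x))"
      by (rule W_check_all) auto
    then have "tmm.wp x n (check_all n n) (\<lambda>k s. ttst x n (\<lambda>_ _ g. g 2 = 0) s \<longleftrightarrow> all_agree n (\<lambda>_. 0)) s"
      unfolding W_def s_conf[symmetric]
    proof (rule tmm.wp_mono, elim exE conjE)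
      fix k' s' h' f'
      assume "s' = conf h' f'" "f' 2 = (if all_agree n (\<lambda>_. 0) then ((\<lambda>_ :: nat. 0)(0 := a, 1 := dfa_run 0 x)) 2 else 1)"
      then show "ttst x n (\<lambda>_ _ g. g 2 = 0) s' \<longleftrightarrow> all_agree n (\<lambda>_. 0)"
        by (simp add: ttst_conf holds_def)
    qed
    moreover have "all_agree n (\<lambda>_. 0) \<longleftrightarrow> x \<in> encode_identity ` Check_Id (styl n)"
      unfolding all_agree_iff Check_Id_styl[symmetric] x using inj_image_mem_iff[OF inj_encode_identity] by blast
    ultimately show ?thesis using True flag by simp
  qed
qed

theorem corollary4p3:
  fixes n :: nat
  assumes "n \<ge> 1"
  shows "decidable_in_linearithmic_time (Check_Id (styl n))
    \<and> encode_identity ` Check_Id (styl n) \<in> class_P"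
  using styl_linearithmic class_P_programI[OF decide_tm_spec] by blast

end
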